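(* Let $\mathcal{A}=\{A_1,\dots,A_N\}$ be a finite set of contracting, non-singular $2\times2$ real matrices, and let $\Phi=\{f_i(\underline{x})=A_i\underline{x}+\underline{t}_i\}_{i=1}^N$ be an iterated function system of affine maps on $\mathbb{R}^2$. Let $\nu$ be a left-shift invariant and ergodic Bernoulli probability measure on $\Sigma^+=\{1,\dots,N\}^{\mathbb{N}}$, and let $\mu$ be the corresponding self-affine measure. Assume that (1) $\mathcal{A}$ satisfies the dominated splitting condition; (2) $\mathcal{A}$ satisfies the backward non-overlapping condition, i.e. there exists a backward invariant multicone $M$ such that $A_i^{-1}(M^o)\subseteq M^o$ for every $i$ and $A_i^{-1}(M^o)\cap A_j^{-1}(M^o)=\emptyset$ for every $i\neq j$; (3) $\mathcal{A}$ satisfies the $1$-bunched property, i.e. $\alpha_1(A_i)^2\le\alpha_2(A_i)$ for every $i=1,\dots,N$; (4) $\Phi$ satisfies the strong separation condition. Then $$\dim_H\mu=\dim_{\mathrm{Lyap}}\mu=\frac{h_\nu}{\chi^s_\mu}\le1.$$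
   Context: Contracting means $\|A_i\|<1$ in the operator norm induced by the Euclidean norm. $\alpha_1(A)\ge\alpha_2(A)$ are the singular values of $A$. $0\in\mathbb{N}$. The attractor $\Lambda$ of $\Phi$ is the unique non-empty compact set with $\Lambda=\bigcup_i f_i(\Lambda)$. Measures: given a probability vector $\underline{p}=(p_1,\dots,p_N)$, $\nu=\{p_1,\dots,p_N\}^{\mathbb{N}}$ is the Bernoulli (product) measure on $\Sigma^+$; its entropy is $h_\nu=-\sum_i p_i\log p_i$. The natural projection is $\pi_+(i_0,i_1,\dots)=\lim_{n\to\infty}f_{i_0}\circ\cdots\circ f_{i_n}(\underline{0})$, and the corresponding self-affine measure is $\mu=\nu\circ\pi_+^{-1}$, i.e. the compactly supported probability measure, with support $\Lambda$, satisfying $\mu=\sum_i p_i\,\mu\circ f_i^{-1}$. Strong separation condition (SSC): there is a non-empty bounded open set $\mathcal{O}\subset\mathbb{R}^2$ with $f_i(\overline{\mathcal{O}})\subseteq\mathcal{O}$ for every $i$ and $f_i(\overline{\mathcal{O}})\cap f_j(\overline{\mathcal{O}})=\emptyset$ for $i\ne j$. Dominated splitting condition: there are $C,\delta>0$ such that $\alpha_1(A_{i_1}\cdots A_{i_n})/\alpha_2(A_{i_1}\cdots A_{i_n})\ge Ce^{\delta n}$ for all $n$ and all words $(i_1,\dots,i_n)$. Multicones: the standard positive cone is $C_+=\{(x,y)\in\mathbb{R}^2\setminus\{(0,0)\}:xy\ge0\}$; a cone is an image of $C_+$ under a linear isomorphism; a multicone is a disjoint union of finitely many cones; $M^o$ is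 the interior of $M$. A multicone $M$ is forward invariant for a set of matrices $\{B_1,\dots,B_N\}$ if $\bigcup_iB_i(M)\subset M^o$; it is backward invariant for $\mathcal{A}$ if it is forward invariant for $\{A_1^{-1},\dots,A_N^{-1}\}$. Lyapunov exponents: $0<\chi^s_\mu\le\chi^{ss}_\mu$ are the constants such that for $\nu$-a.e. $\mathbf{i}=(i_0,i_1,\dots)$, $\lim_n\frac1n\log\alpha_1(A_{i_0}\cdots A_{i_{n-1}})=-\chi^s_\mu$ and $\lim_n\frac1n\log\alpha_2(A_{i_0}\cdots A_{i_{n-1}})=-\chi^{ss}_\mu$. Lyapunov dimension: $\dim_{\mathrm{Lyap}}\mu=\min\left\{2,\frac{h_\nu}{\chi^s_\mu},1+\frac{h_\nu-\chi^s_\mu}{\chi^{ss}_\mu}\right\}$. Dimension of a measure: $\dim_H m=\operatorname{ess\,sup}_x\underline{d}_m(x)=\inf\{\dim_HA: m(A^c)=0\}$, where $\underline{d}_m(x)=\liminf_{r\to0+}\log m(B_r(x))/\log r$. *)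

theory Defs
  imports "HOL-Probability.Probability"
begin

(* Throughout, the alphabet {1,...,N} is an arbitrary finite index type 'i. *)

section \<open>Singular values\<close>

definition matrix_eigenvalues :: "real^'n^'n \<Rightarrow> real set" where
  "matrix_eigenvalues B = {l. \<exists>v. v \<noteq> 0 \<and> B *v v = l *\<^sub>R v}"

(* A 2x2 matrix has only two singular values, so they are the largest and the smallest one;
   if the eigenvalue of the Gram matrix is double, both definitions give the same number. *)

definition alpha1 :: "real^2^2 \<Rightarrow> real" where
  "alpha1 B = sqrt (Max (matrix_eigenvalues (transpose B ** B)))"

definition alpha2 :: "real^2^2 \<Rightarrow> real" where
  "alpha2 B = sqrt (Min (matrix_eigenvalues (transpose B ** B)))"

section \<open>Products of matrices along words\<close>

definition word_prod :: "('i \<Rightarrow> real^2^2) \<Rightarrow> 'i list \<Rightarrow> real^2^2" where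
  "word_prod A w = foldr (\<lambda>i B. A i ** B) w (mat 1)"

definition dominated_splitting :: "('i::finite \<Rightarrow> real^2^2) \<Rightarrow> bool" where
  "dominated_splitting A \<longleftrightarrow>
     (\<exists>C>0. \<exists>\<delta>>0. \<forall>w. alpha1 (word_prod A w) / alpha2 (word_prod A w) \<ge> C * exp (\<delta> * real (length w)))"

definition one_bunched :: "('i::finite \<Rightarrow> real^2^2) \<Rightarrow> bool" where
  "one_bunched A \<longleftrightarrow> (\<forall>i. alpha1 (A i) ^ 2 \<le> alpha2 (A i))"

section \<open>Multicones\<close>

definition std_cone :: "(real^2) set" where
  "std_cone = {v. v \<noteq> 0 \<and> v $ 1 * v $ 2 \<ge> 0}"

definition is_cone :: "(real^2) set \<Rightarrow> bool" where
  "is_cone K \<longleftrightarrow> (\<exists>T. linear T \<and> bij T \<and> K = T ` std_cone)"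

(* At least one cone is required: the empty set would satisfy all invariance conditions. *)
definition multicone :: "(real^2) set \<Rightarrow> bool" where
  "multicone M \<longleftrightarrow>
     (\<exists>\<K>. finite \<K> \<and> \<K> \<noteq> {} \<and> (\<forall>K\<in>\<K>. is_cone K) \<and> disjoint \<K> \<and> M = \<Union>\<K>)"

definition forward_invariant :: "(real^2) set \<Rightarrow> ('i \<Rightarrow> real^2^2) \<Rightarrow> bool" where
  "forward_invariant M B \<longleftrightarrow> (\<Union>i. (*v) (B i) ` M) \<subseteq> interior M"

definition backward_invariant :: "(real^2) set \<Rightarrow> ('i \<Rightarrow> real^2^2) \<Rightarrow> bool" where
  "backward_invariant M A \<longleftrightarrow> forward_invariant M (\<lambda>i. matrix_inv (A i))"

definition backward_non_overlapping :: "('i::finite \<Rightarrow> real^2^2) \<Rightarrow> bool" where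
  "backward_non_overlapping A \<longleftrightarrow>
     (\<exists>M. multicone M \<and> backward_invariant M A \<and>
          (\<forall>i. (*v) (matrix_inv (A i)) ` interior M \<subseteq> interior M) \<and>
          (\<forall>i j. i \<noteq> j \<longrightarrow>
             (*v) (matrix_inv (A i)) ` interior M \<inter> (*v) (matrix_inv (A j)) ` interior M = {}))"

section \<open>Affine iterated function systems\<close>

definition affine_ifs :: "('i \<Rightarrow> real^2^2) \<Rightarrow> ('i \<Rightarrow> real^2) \<Rightarrow> 'i \<Rightarrow> real^2 \<Rightarrow> real^2" where
  "affine_ifs A t i x = A i *v x + t i"

definition strong_separation :: "('i::finite \<Rightarrow> real^2 \<Rightarrow> real^2) \<Rightarrow> bool" where
  "strong_separation f \<longleftrightarrow>
     (\<exists>U. U \<noteq> {} \<and> bounded U \<and> open U \<and>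
          (\<forall>i. f i ` closure U \<subseteq> U) \<and>
          (\<forall>i j. i \<noteq> j \<longrightarrow> f i ` closure U \<inter> f j ` closure U = {}))"

definition natural_projection :: "('i \<Rightarrow> real^2 \<Rightarrow> real^2) \<Rightarrow> (nat \<Rightarrow> 'i) \<Rightarrow> real^2" where
  "natural_projection f \<omega> = lim (\<lambda>n. foldr f (map \<omega> [0..<Suc n]) 0)"

section \<open>Bernoulli measures and self-affine measures\<close>

definition bernoulli_measure :: "'i::finite pmf \<Rightarrow> (nat \<Rightarrow> 'i) measure" where
  "bernoulli_measure p = Pi\<^sub>M UNIV (\<lambda>_. measure_pmf p)"

definition self_affine_measure :: "('i::finite \<Rightarrow> real^2 \<Rightarrow> real^2) \<Rightarrow> 'i pmf \<Rightarrow> (real^2) measure" where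
  "self_affine_measure f p = distr (bernoulli_measure p) borel (natural_projection f)"

(* ln 0 = 0 gives the usual convention 0 log 0 = 0. *)
definition bernoulli_entropy :: "'i::finite pmf \<Rightarrow> real" where
  "bernoulli_entropy p = - (\<Sum>i\<in>UNIV. pmf p i * ln (pmf p i))"

section \<open>Lyapunov exponents and Lyapunov dimension\<close>

definition lyapunov_s :: "('i::finite \<Rightarrow> real^2^2) \<Rightarrow> 'i pmf \<Rightarrow> real" where
  "lyapunov_s A p = (THE c. AE \<omega> in bernoulli_measure p.
     (\<lambda>n. ln (alpha1 (word_prod A (map \<omega> [0..<n]))) / real n) \<longlonglongrightarrow> - c)"

definition lyapunov_ss :: "('i::finite \<Rightarrow> real^2^2) \<Rightarrow> 'i pmf \<Rightarrow> real" where
  "lyapunov_ss A p = (THE c. AE \<omega> in bernoulli_measure p.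
     (\<lambda>n. ln (alpha2 (word_prod A (map \<omega> [0..<n]))) / real n) \<longlonglongrightarrow> - c)"

definition lyapunov_dim :: "('i::finite \<Rightarrow> real^2^2) \<Rightarrow> 'i pmf \<Rightarrow> real" where
  "lyapunov_dim A p =
     Min {2,
          bernoulli_entropy p / lyapunov_s A p,
          1 + (bernoulli_entropy p - lyapunov_s A p) / lyapunov_ss A p}"

section \<open>Hausdorff dimension of a measure\<close>

(* Since ln 0 = 0 here, balls of measure zero are treated separately:
   log 0 = -\<infinity>, so the quotient is \<infinity> for small radii. *)
definition lower_local_dim :: "'a::metric_space measure \<Rightarrow> 'a \<Rightarrow> ereal" where
  "lower_local_dim m x =
     Liminf (at_right 0)
       (\<lambda>r. if measure m (ball x r) = 0 then \<infinity> else ereal (ln (measure m (ball x r)) / ln r))"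

definition dim_H_measure :: "'a::metric_space measure \<Rightarrow> ereal" where
  "dim_H_measure m = esssup m (lower_local_dim m)"

end

theory Submission
  imports Defs
begin

text \<open>Two points of the attractor whose codings split after the word \<open>u\<close> differ by \<open>A\<^sub>u z\<close> with \<open>z\<close>
  bounded away from zero, by strong separation. They are much closer than the length of the cylinder of
  \<open>u\<close> only if \<open>z\<close> nearly points in the direction contracted most by \<open>A\<^sub>u\<close>. These directions lie in the
  images of the backward multicone; the images belonging to words of equal length are disjoint, so an area count
  shows that few suffixes of \<open>u\<close> are possible, and bunching makes these suffixes long enough.
  Hence the correlation integral of the measure at scale \<open>exp (- n \<chi>\<^sup>s)\<close>, restricted to typical words,
  is at most \<open>exp (- n h + o(n))\<close>, and Markov's inequality and Borel-Cantelli give the lower bound for the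
  local dimension. The same area count gives \<open>h \<le> \<chi>\<^sup>s\<^sup>s - \<chi>\<^sup>s\<close>, which bunching bounds by \<open>\<chi>\<^sup>s\<close>.\<close>

section \<open>Plane linear algebra and singular values\<close>

text \<open>For a single point it is hard to bound how many other cylinders come close to it. For
  two fixed tails the question is linear: which words \<open>u\<close> shorten the fixed vector
  \<open>z\<close>? So the tails are fixed first and the words are counted afterwards. The inverse
  of A_u applies the last letter of \<open>u\<close> last, so a suffix of length k determines the
  direction that \<open>u\<close> contracts up to an angle of about exp (-k (chi_ss - chi_s)). If
  two points at distance exp (-n chi_s) split after m letters, then \<open>z\<close> lies within an
  angle of about exp (-(n - m) chi_s) of that direction. By bunching this angle is no larger than
  the previous one for k = n - m, so it leaves few suffixes of that length. Each has probability
  about exp (-(n - m) h), agreement of the first m letters costs exp (-m h), and the product exp (-n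
  h) does not depend on m. If m < n - m, the word is too short for such a suffix. But then the
  smaller singular value of A_u, about exp (-2 m chi_s) or more, keeps A_u z too long, unless n - 2m
  is negligible.\<close>

definition wedge :: "real^2 \<Rightarrow> real^2 \<Rightarrow> real" where
  "wedge x y = x $ 1 * y $ 2 - x $ 2 * y $ 1"

lemma norm_real2_squared: "(norm (x :: real^2))\<^sup>2 = (x $ 1)\<^sup>2 + (x $ 2)\<^sup>2"
  by (simp add: norm_vec_def L2_set_def sum_2)

lemma vec2_eq_iff: "(x :: real^2) = y \<longleftrightarrow> x $ 1 = y $ 1 \<and> x $ 2 = y $ 2"
  by (simp add: vec_eq_iff forall_2)

lemma matrix_vector_mult_2:
  fixes B :: "real^2^2"
  shows "(B *v x) $ 1 = B $ 1 $ 1 * x $ 1 + B $ 1 $ 2 * x $ 2"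
    and "(B *v x) $ 2 = B $ 2 $ 1 * x $ 1 + B $ 2 $ 2 * x $ 2"
  by (simp_all add: matrix_vector_mult_def sum_2)

lemma wedge_matrix_mult: "wedge (B *v x) (B *v y) = det B * wedge x y"
  by (simp add: wedge_def matrix_vector_mult_2 det_2 algebra_simps)

text \<open>In Lagrange's identity the missing part is the squared inner product. For unit vectors
  \<open>wedge\<close> is, up to sign, the sine of the angle; it measures closeness of directions
  throughout.\<close>

lemma abs_wedge_le: "\<bar>wedge x y\<bar> \<le> norm x * norm y"
proof -
  have "(wedge x y)\<^sup>2 + (x $ 1 * y $ 1 + x $ 2 * y $ 2)\<^sup>2 = (norm x * norm y)\<^sup>2"
    by (simp add: power_mult_distrib norm_real2_squared wedge_def) (simp add: algebra_simps power2_eq_square)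
  then have "(wedge x y)\<^sup>2 \<le> (norm x * norm y)\<^sup>2"
    by (smt (verit) zero_le_power2)
  then show ?thesis
    by (metis abs_le_square_iff abs_norm_cancel abs_mult)
qed

lemma wedge_scaleR [simp]: "wedge (a *\<^sub>R x) y = a * wedge x y" "wedge x (a *\<^sub>R y) = a * wedge x y"
  by (simp_all add: wedge_def algebra_simps)

text \<open>After division by the three norms this is a triangle inequality for sines of angles. It
  comes from Cramer's linear relation between three plane vectors.\<close>

lemma wedge_triangle:
  "norm s * \<bar>wedge y z\<bar> \<le> norm y * \<bar>wedge s z\<bar> + norm z * \<bar>wedge y s\<bar>"
proof -
  have "wedge y z *\<^sub>R s = wedge s z *\<^sub>R y + wedge y s *\<^sub>R z"
    by (simp add: vec2_eq_iff wedge_def algebra_simps)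
  then have "\<bar>wedge y z\<bar> * norm s \<le> norm (wedge s z *\<^sub>R y) + norm (wedge y s *\<^sub>R z)"
    by (metis norm_scaleR norm_triangle_ineq)
  then show ?thesis
    by (simp add: mult.commute)
qed

lemma bounded_linear_matrix: "bounded_linear ((*v) (B :: real^'n^'m))"
  by simp

lemma norm_matrix_mult_le: "norm (B *v x) \<le> onorm ((*v) (B :: real^'n^'m)) * norm x"
  by (rule onorm[OF bounded_linear_matrix])

lemma onorm_matrix_matrix_mult:
  fixes B :: "real^'n^'m" and C :: "real^'k^'n"
  shows "onorm ((*v) (B ** C)) \<le> onorm ((*v) B) * onorm ((*v) C)"
  using onorm_compose[OF bounded_linear_matrix bounded_linear_matrix, of B C]
  by (simp add: comp_def matrix_vector_mul_assoc)

text \<open>The smaller singular value is |det| divided by the norm: the area spanned by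
  \<open>x\<close> and its quarter turn \<open>y\<close> is multiplied by |det|, and the image of
  \<open>y\<close> is at most the norm times |x|.\<close>

lemma norm_matrix_mult_ge:
  fixes B :: "real^2^2"
  shows "\<bar>det B\<bar> * norm x \<le> onorm ((*v) B) * norm (B *v x)"
proof (cases "x = 0")
  case False
  define y :: "real^2" where "y = vector [- (x $ 2), x $ 1]"
  have n: "norm y = norm x"
    by (rule power2_eq_imp_eq) (simp_all add: norm_real2_squared y_def)
  have "wedge x y = (norm x)\<^sup>2"
    unfolding norm_real2_squared by (simp add: wedge_def y_def power2_eq_square)
  then have "\<bar>wedge x y\<bar> = (norm x)\<^sup>2"
    by simp
  then have "\<bar>det B\<bar> * (norm x)\<^sup>2 = \<bar>wedge (B *v x) (B *v y)\<bar>"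
    by (simp add: wedge_matrix_mult abs_mult)
  also have "\<dots> \<le> norm (B *v x) * norm (B *v y)"
    by (rule abs_wedge_le)
  also have "\<dots> \<le> norm (B *v x) * (onorm ((*v) B) * norm x)"
    using norm_matrix_mult_le[of B y] by (intro mult_left_mono) (auto simp: n)
  finally show ?thesis
    using False by (simp add: power2_eq_square mult_ac)
qed auto

lemma abs_det_le_onorm_squared: "\<bar>det B\<bar> \<le> (onorm ((*v) (B :: real^2^2)))\<^sup>2"
proof -
  let ?x = "axis 1 1 :: real^2"
  have "\<bar>det B\<bar> * norm ?x \<le> onorm ((*v) B) * norm (B *v ?x)"
    by (rule norm_matrix_mult_ge)
  also have "\<dots> \<le> onorm ((*v) B) * (onorm ((*v) B) * norm ?x)"
    by (intro mult_left_mono norm_matrix_mult_le onorm_pos_le) simp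
  finally show ?thesis
    by (simp add: power2_eq_square)
qed

lemma onorm_pos_if_invertible:
  assumes "invertible (B :: real^2^2)"
  shows "onorm ((*v) B) > 0"
proof -
  have "det B \<noteq> 0"
    using assms by (simp add: invertible_det_nz)
  then show ?thesis
    using abs_det_le_onorm_squared[of B] onorm_pos_le[OF bounded_linear_matrix, of B]
    by (cases "onorm ((*v) B) = 0") auto
qed

text \<open>The eigenvalues are the roots of the characteristic polynomial, whose discriminant is
  nonnegative by symmetry.\<close>

lemma matrix_eigenvalues_symmetric_2:
  fixes G :: "real^2^2"
  assumes sym: "G $ 2 $ 1 = G $ 1 $ 2"
  defines "R \<equiv> sqrt ((G $ 1 $ 1 - G $ 2 $ 2)\<^sup>2 + 4 * (G $ 1 $ 2)\<^sup>2)"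
  shows "matrix_eigenvalues G = {(G $ 1 $ 1 + G $ 2 $ 2 + R) / 2, (G $ 1 $ 1 + G $ 2 $ 2 - R) / 2}"
proof -
  define a b d where "a = G $ 1 $ 1" and "b = G $ 1 $ 2" and "d = G $ 2 $ 2"
  have R2: "R * R = (a - d)\<^sup>2 + 4 * b\<^sup>2"
    unfolding R_def a_def b_def d_def by simp
  have eig: "l \<in> matrix_eigenvalues G \<longleftrightarrow> (a - l) * (d - l) = b * b" for l
  proof
    assume "l \<in> matrix_eigenvalues G"
    then obtain v where v: "v \<noteq> 0" "G *v v = l *\<^sub>R v"
      by (auto simp: matrix_eigenvalues_def)
    then have 1: "(a - l) * v $ 1 + b * v $ 2 = 0" "b * v $ 1 + (d - l) * v $ 2 = 0"
      by (simp_all add: vec2_eq_iff matrix_vector_mult_2 a_def b_def d_def sym algebra_simps)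
    have "((a - l) * (d - l) - b * b) * v $ 1 = (d - l) * ((a - l) * v $ 1 + b * v $ 2) - b * (b * v $ 1 + (d - l) * v $ 2)"
      "((a - l) * (d - l) - b * b) * v $ 2 = (a - l) * (b * v $ 1 + (d - l) * v $ 2) - b * ((a - l) * v $ 1 + b * v $ 2)"
      by (simp_all add: algebra_simps)
    then have "((a - l) * (d - l) - b * b) * v $ 1 = 0" "((a - l) * (d - l) - b * b) * v $ 2 = 0"
      unfolding 1 by simp_all
    then show "(a - l) * (d - l) = b * b"
      using v(1) by (auto simp: vec2_eq_iff)
  next
    assume l: "(a - l) * (d - l) = b * b"
    show "l \<in> matrix_eigenvalues G"
    proof (cases "b = 0 \<and> l = a")
      case True
      then have "(axis 1 1 :: real^2) \<noteq> 0 \<and> G *v (axis 1 1) = l *\<^sub>R axis 1 1"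
        by (simp add: vec2_eq_iff matrix_vector_mult_2 axis_def a_def b_def sym)
      then show ?thesis
        unfolding matrix_eigenvalues_def by blast
    next
      case False
      \<comment> \<open>Solves the first row of \<open>G - l\<close>; the characteristic equation
        yields the second. It vanishes exactly in the case treated before.\<close>
      define v :: "real^2" where "v = vector [b, l - a]"
      have "v \<noteq> 0" "G *v v = l *\<^sub>R v"
        using False l
        by (auto simp: vec2_eq_iff matrix_vector_mult_2 v_def a_def b_def d_def sym algebra_simps)
      then show ?thesis
        unfolding matrix_eigenvalues_def by blast
    qed
  qed
  have "(a - l) * (d - l) = b * b \<longleftrightarrow> l = (a + d + R) / 2 \<or> l = (a + d - R) / 2" for l
  proof -
    have "4 * ((a - l) * (d - l) - b * b) = (2 * l - (a + d)) * (2 * l - (a + d)) - R * R"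
      unfolding R2 by (simp add: algebra_simps power2_eq_square)
    also have "\<dots> = (2 * l - (a + d) - R) * (2 * l - (a + d) + R)"
      by (simp add: algebra_simps)
    finally have "(a - l) * (d - l) = b * b \<longleftrightarrow> 2 * l - (a + d) - R = 0 \<or> 2 * l - (a + d) + R = 0"
      by (metis eq_iff_diff_eq_0 mult_eq_0_iff zero_neq_numeral)
    then show ?thesis
      by (auto simp: field_simps)
  qed
  then show ?thesis
    unfolding a_def[symmetric] d_def[symmetric] using eig by blast
qed

text \<open>The Rayleigh quotient of the Gram matrix is maximal at its larger eigenvalue
  \<open>l1\<close>: since (l1 - a)(l1 - d) = b^2, the form l1 |x|^2 - |Bx|^2 is positive
  semidefinite, and an eigenvector gives equality. The product of the eigenvalues is det^2.\<close>

lemma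
  fixes B :: "real^2^2"
  shows alpha1_eq_onorm: "alpha1 B = onorm ((*v) B)"
    and alpha1_mult_alpha2: "alpha1 B * alpha2 B = \<bar>det B\<bar>"
proof -
  define G where "G = transpose B ** B"
  define a b d where "a = G $ 1 $ 1" and "b = G $ 1 $ 2" and "d = G $ 2 $ 2"
  have G: "a = (B $ 1 $ 1)\<^sup>2 + (B $ 2 $ 1)\<^sup>2" "d = (B $ 1 $ 2)\<^sup>2 + (B $ 2 $ 2)\<^sup>2"
    "b = B $ 1 $ 1 * B $ 1 $ 2 + B $ 2 $ 1 * B $ 2 $ 2" and sym: "G $ 2 $ 1 = G $ 1 $ 2"
    by (simp_all add: G_def a_def b_def d_def matrix_matrix_mult_def transpose_def sum_2 power2_eq_square)
  define R where "R = sqrt ((a - d)\<^sup>2 + 4 * b\<^sup>2)"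
  define l1 l2 where "l1 = (a + d + R) / 2" and "l2 = (a + d - R) / 2"
  have R0: "R \<ge> 0" and R2: "R * R = (a - d)\<^sup>2 + 4 * b\<^sup>2"
    unfolding R_def by simp_all
  have ev: "matrix_eigenvalues G = {l1, l2}"
    using matrix_eigenvalues_symmetric_2[OF sym] by (simp add: a_def b_def d_def R_def l1_def l2_def)
  have a1: "alpha1 B = sqrt l1" and a2: "alpha2 B = sqrt l2"
    using R0 by (simp_all add: alpha1_def alpha2_def G_def[symmetric] ev l1_def l2_def)
  have "l1 * l2 = ((a + d) * (a + d) - R * R) / 4"
    by (simp add: l1_def l2_def algebra_simps)
  also have "\<dots> = (det B)\<^sup>2"
    unfolding R2 G det_2 by (simp add: field_simps power2_eq_square)
  finally show "alpha1 B * alpha2 B = \<bar>det B\<bar>"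
    unfolding a1 a2 by (simp flip: real_sqrt_mult)
  have qf: "(norm (B *v x))\<^sup>2 = a * (x $ 1)\<^sup>2 + 2 * b * (x $ 1 * x $ 2) + d * (x $ 2)\<^sup>2" for x
    unfolding norm_real2_squared matrix_vector_mult_2 G by (simp add: algebra_simps power2_eq_square)
  have R_ge: "R \<ge> \<bar>a - d\<bar>"
    unfolding R_def by (rule real_le_rsqrt) simp
  have pos: "l1 - a \<ge> 0" "l1 - d \<ge> 0"
    using R_ge by (simp_all add: l1_def)
  have l1_minus: "l1 - a = (R - (a - d)) / 2" "l1 - d = (R + (a - d)) / 2"
    by (simp_all add: l1_def field_simps)
  have "4 * ((l1 - a) * (l1 - d)) = (R - (a - d)) * (R + (a - d))"
    unfolding l1_minus by simp
  also have "\<dots> = R * R - (a - d)\<^sup>2"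
    by (simp add: algebra_simps power2_eq_square)
  finally have "4 * ((l1 - a) * (l1 - d)) = R * R - (a - d)\<^sup>2" .
  then have prod: "(l1 - a) * (l1 - d) = b\<^sup>2"
    unfolding R2 by simp
  have le: "(norm (B *v x))\<^sup>2 \<le> l1 * (norm x)\<^sup>2" for x
  proof -
    \<comment> \<open>p^2 and q^2 are the diagonal terms of l1 |x|^2 - |Bx|^2 and 2 p q is the
      modulus of its mixed term, so (p - q)^2 \<ge> 0 is enough.\<close>
    define p q where "p = sqrt (l1 - a) * \<bar>x $ 1\<bar>" and "q = sqrt (l1 - d) * \<bar>x $ 2\<bar>"
    have "p * q = sqrt ((l1 - a) * (l1 - d)) * \<bar>x $ 1 * x $ 2\<bar>"
      unfolding p_def q_def by (simp add: real_sqrt_mult abs_mult)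
    then have pq: "p * q = \<bar>b * (x $ 1 * x $ 2)\<bar>"
      unfolding prod by (simp add: abs_mult)
    have p2: "p\<^sup>2 = (l1 - a) * (x $ 1)\<^sup>2" "q\<^sup>2 = (l1 - d) * (x $ 2)\<^sup>2"
      unfolding p_def q_def using pos by (simp_all add: power_mult_distrib)
    have "0 \<le> (p - q)\<^sup>2"
      by simp
    then have "2 * (p * q) \<le> p\<^sup>2 + q\<^sup>2"
      by (simp add: power2_diff)
    moreover have "b * (x $ 1 * x $ 2) \<le> p * q"
      unfolding pq by simp
    ultimately have "2 * (b * (x $ 1 * x $ 2)) \<le> (l1 - a) * (x $ 1)\<^sup>2 + (l1 - d) * (x $ 2)\<^sup>2"
      unfolding p2 by linarith
    then show ?thesis
      unfolding qf[of x] norm_real2_squared[of x] by (simp add: algebra_simps)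
  qed
  have l1: "l1 \<ge> 0"
    using pos(1) by (simp add: G(1)) (smt (verit) zero_le_power2)
  have "onorm ((*v) B) \<le> sqrt l1"
  proof (rule onorm_le)
    fix x
    have "norm (B *v x) = sqrt ((norm (B *v x))\<^sup>2)"
      by simp
    also have "\<dots> \<le> sqrt (l1 * (norm x)\<^sup>2)"
      by (intro real_sqrt_le_mono le)
    finally show "norm (B *v x) \<le> sqrt l1 * norm x"
      by (simp add: real_sqrt_mult)
  qed
  moreover have "sqrt l1 \<le> onorm ((*v) B)"
  proof -
    have "l1 \<in> matrix_eigenvalues G"
      using ev by simp
    then obtain v where v: "v \<noteq> 0" "G *v v = l1 *\<^sub>R v"
      by (auto simp: matrix_eigenvalues_def)
    have "(norm (B *v v))\<^sup>2 = (G *v v) $ 1 * v $ 1 + (G *v v) $ 2 * v $ 2"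
      unfolding qf matrix_vector_mult_2 sym a_def b_def d_def by (simp add: algebra_simps power2_eq_square)
    also have "\<dots> = l1 * (norm v)\<^sup>2"
      unfolding v(2) norm_real2_squared by (simp add: algebra_simps power2_eq_square)
    finally have "(norm (B *v v))\<^sup>2 = (sqrt l1 * norm v)\<^sup>2"
      using l1 by (simp add: power_mult_distrib)
    then have "norm (B *v v) = sqrt l1 * norm v"
      by (simp add: l1 power2_eq_iff_nonneg)
    then show ?thesis
      using norm_matrix_mult_le[of B v] v(1) by simp
  qed
  ultimately show "alpha1 B = onorm ((*v) B)"
    unfolding a1 by simp
qed

lemma measure_box_real2:
  assumes "a \<ge> 0" "b \<ge> 0"
  shows "measure lebesgue (cbox (vector [-a, -b]) (vector [a, b] :: real^2)) = 4 * a * b"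
proof -
  have "cbox (vector [-a, -b]) (vector [a, b] :: real^2) \<noteq> {}"
    using assms by (auto simp: interval_ne_empty_cart forall_2)
  then show ?thesis
    by (simp add: content_cbox_cart UNIV_2)
qed

section \<open>Multicones\<close>

text \<open>Cones omit the origin, so topological arguments need it added back.\<close>

lemma closed_cone:
  assumes "is_cone K"
  shows "closed (insert 0 K)"
proof -
  obtain T where T: "linear T" "bij T" "K = T ` std_cone"
    using assms by (auto simp: is_cone_def)
  have "insert 0 std_cone = {v :: real^2. 0 \<le> v $ 1 * v $ 2}"
    by (auto simp: std_cone_def)
  also have "closed \<dots>"
    by (intro closed_Collect_le continuous_intros)
  finally have "closed (T ` insert 0 std_cone)"
    using T by (intro closed_injective_linear_image) (auto simp: bij_def)
  then show ?thesis
    by (simp add: T(3) linear_0[OF T(1)])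
qed

lemma cone_scaleR:
  assumes "is_cone K" "x \<in> K" "a \<noteq> 0"
  shows "a *\<^sub>R x \<in> K"
proof -
  obtain T v where T: "linear T" "bij T" "K = T ` std_cone" "v \<in> std_cone" "x = T v"
    using assms by (auto simp: is_cone_def)
  have "a *\<^sub>R v \<in> std_cone"
  proof -
    have "(a *\<^sub>R v) $ 1 * (a *\<^sub>R v) $ 2 = a\<^sup>2 * (v $ 1 * v $ 2)"
      by (simp only: vector_scaleR_component real_scaleR_def mult_ac power2_eq_square)
    also have "\<dots> \<ge> 0"
      using T(4) mult_nonneg_nonneg[of "a\<^sup>2" "v $ 1 * v $ 2"] by (simp only: std_cone_def mem_Collect_eq zero_le_power2 simp_thms)
    finally have "0 \<le> (a *\<^sub>R v) $ 1 * (a *\<^sub>R v) $ 2" .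
    moreover have "a *\<^sub>R v \<noteq> 0"
      using T(4) assms(3) by (simp add: std_cone_def)
    ultimately show ?thesis
      by (simp only: std_cone_def mem_Collect_eq simp_thms)
  qed
  then show ?thesis
    using T by (auto simp: linear_scale[symmetric])
qed

lemma cone_nonempty: "is_cone K \<Longrightarrow> K \<noteq> {}"
proof -
  have "vector [1, 0] \<in> std_cone"
    by (simp add: std_cone_def vec2_eq_iff)
  then show "is_cone K \<Longrightarrow> K \<noteq> {}"
    by (auto simp: is_cone_def)
qed

lemma zero_notin_cone: "is_cone K \<Longrightarrow> 0 \<notin> K"
  by (auto simp: is_cone_def std_cone_def bij_def) (metis injD linear_0)

lemma cone_proper:
  assumes "is_cone K"
  shows "\<exists>g. g \<noteq> 0 \<and> g \<notin> K"
proof -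
  obtain T where T: "linear T" "bij T" "K = T ` std_cone"
    using assms by (auto simp: is_cone_def)
  let ?v = "vector [1, -1] :: real^2"
  have v: "?v \<noteq> 0" "?v \<notin> std_cone"
    by (simp_all add: std_cone_def vec2_eq_iff)
  then have "T ?v \<noteq> 0" "T ?v \<notin> K"
    using T by (auto simp: bij_def inj_image_mem_iff) (metis injD linear_0)
  then show ?thesis
    by blast
qed

lemma multicone_scaleR: "multicone M \<Longrightarrow> x \<in> M \<Longrightarrow> a \<noteq> 0 \<Longrightarrow> a *\<^sub>R x \<in> M"
  unfolding multicone_def using cone_scaleR by blast

lemma zero_notin_multicone: "multicone M \<Longrightarrow> 0 \<notin> M"
  unfolding multicone_def using zero_notin_cone by blast

lemma multicone_nonempty: "multicone M \<Longrightarrow> M \<noteq> {}"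
  unfolding multicone_def using cone_nonempty by blast

lemma closed_Union_cones:
  assumes "finite \<K>" "\<And>K. K \<in> \<K> \<Longrightarrow> is_cone K"
  shows "closed (insert 0 (\<Union>\<K>))"
proof -
  have "insert 0 (\<Union>\<K>) = {0} \<union> (\<Union>K\<in>\<K>. insert 0 K)"
    by auto
  also have "closed \<dots>"
    using assms closed_cone by (intro closed_Un closed_UN) auto
  finally show ?thesis .
qed

lemma closed_multicone: "multicone M \<Longrightarrow> closed (insert 0 M)"
  unfolding multicone_def using closed_Union_cones by blast

text \<open>Otherwise one cone and the union of the others would divide the connected punctured
  plane into two disjoint, nonempty, relatively closed sets. The free direction found here is the
  centre of the test ball in the norm estimate.\<close>

lemma multicone_proper:
  assumes "multicone M"
  shows "\<exists>g. g \<noteq> 0 \<and> g \<notin> M"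
proof (rule ccontr)
  assume "\<not> ?thesis"
  then have all: "x \<in> M" if "x \<noteq> 0" for x
    using that by blast
  obtain \<K> where K: "finite \<K>" "\<K> \<noteq> {}" "\<And>K. K \<in> \<K> \<Longrightarrow> is_cone K" "disjoint \<K>" "M = \<Union>\<K>"
    using assms by (auto simp: multicone_def)
  obtain K where K1: "K \<in> \<K>"
    using K(2) by blast
  define L where "L = \<Union>(\<K> - {K})"
  have "connected (- {0 :: real^2})"
    by (rule connected_punctured_universe) simp
  moreover have "closed (insert 0 K)" "closed (insert 0 L)"
    using closed_cone[OF K(3)[OF K1]] closed_Union_cones[of "\<K> - {K}"] K(1,3) by (auto simp: L_def)
  moreover have "- {0} \<subseteq> insert 0 K \<union> insert 0 L"
    using all by (auto simp: K(5) L_def)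
  moreover have "K \<inter> L = {}"
    using K(4) K1 by (auto simp: L_def disjoint_def)
  then have "insert 0 K \<inter> insert 0 L \<inter> - {0} = {}"
    by auto
  moreover have "insert 0 K \<inter> - {0} \<noteq> {}"
    using cone_nonempty[OF K(3)[OF K1]] zero_notin_cone[OF K(3)[OF K1]] by auto
  moreover have "insert 0 L \<inter> - {0} \<noteq> {}"
    using cone_proper[OF K(3)[OF K1]] all by (auto simp: K(5) L_def)
  ultimately show False
    unfolding connected_closed by blast
qed

text \<open>Every vector is a multiple of the difference of two points g + s x and g - s x of the
  ball, wherever its centre lies.\<close>

lemma onorm_le_of_bound_on_ball:
  fixes B :: "real^'n^'m"
  assumes "r > 0" and bound: "\<And>x. x \<in> ball g r \<Longrightarrow> norm (B *v x) \<le> b"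
  shows "onorm ((*v) B) \<le> 2 * b / r"
proof (rule onorm_le)
  fix x :: "real^'n"
  show "norm (B *v x) \<le> 2 * b / r * norm x"
  proof (cases "x = 0")
    case False
    define s where "s = r / (2 * norm x)"
    have s: "s > 0" "norm (s *\<^sub>R x) = r / 2"
      using False \<open>r > 0\<close> by (simp_all add: s_def)
    have "B *v (g + s *\<^sub>R x) - B *v (g - s *\<^sub>R x) = s *\<^sub>R (B *v x) + s *\<^sub>R (B *v x)"
      by (simp only: matrix_vector_right_distrib matrix_vector_mult_diff_distrib
          matrix_vector_mult_scaleR) simp
    also have "\<dots> = (2 * s) *\<^sub>R (B *v x)"
      by (simp only: mult_2 scaleR_add_left)
    finally have "2 * s * norm (B *v x) = norm (B *v (g + s *\<^sub>R x) - B *v (g - s *\<^sub>R x))"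
      using s(1) by simp
    also have "\<dots> \<le> norm (B *v (g + s *\<^sub>R x)) + norm (B *v (g - s *\<^sub>R x))"
      by (rule norm_triangle_ineq4)
    also have "\<dots> \<le> b + b"
      using s(2) \<open>r > 0\<close> by (intro add_mono bound) (simp_all add: dist_norm)
    finally show ?thesis
      using False \<open>r > 0\<close> unfolding s_def by (simp add: divide_simps mult_ac)
  qed simp
qed

text \<open>A matrix whose inverse preserves \<open>M\<close> maps directions outside \<open>M\<close> to directions outside
  \<open>M\<close>, which stay away from \<open>x\<close>; the wedge product with \<open>x\<close> then controls the norm of the images.\<close>

lemma cone_expansion:
  fixes B :: "real^2^2"
  assumes scale: "\<And>x a. x \<in> M \<Longrightarrow> a \<noteq> 0 \<Longrightarrow> a *\<^sub>R x \<in> M"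
    and x: "ball x \<rho> \<subseteq> M" "\<rho> > 0" "norm x = 1"
    and g: "ball g r \<inter> M = {}" "r > 0"
    and B: "\<And>y. B *v y \<in> M \<Longrightarrow> y \<in> M" "B *v y = x"
  shows "onorm ((*v) B) \<le> 2 * ((1 + 1 / \<rho>) * (\<bar>det B\<bar> * ((norm g + r) * norm y))) / r"
proof (rule onorm_le_of_bound_on_ball)
  fix h assume h: "h \<in> ball g r"
  define z where "z = B *v h"
  have "z \<notin> M"
    using h g(1) B(1) unfolding z_def by blast
  \<comment> \<open>Coordinates of \<open>z\<close> in the orthonormal frame formed by
    \<open>x\<close> and its quarter turn \<open>x'\<close>.\<close>
  define a b where "a = z $ 1 * x $ 1 + z $ 2 * x $ 2" and "b = - wedge z x"
  define x' :: "real^2" where "x' = vector [- (x $ 2), x $ 1]"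
  have x1: "(x $ 1)\<^sup>2 + (x $ 2)\<^sup>2 = 1"
    using x(3) norm_real2_squared[of x] by simp
  have "norm x' = norm x"
    by (rule power2_eq_imp_eq) (simp_all add: norm_real2_squared x'_def)
  then have x': "norm x' = 1"
    using x(3) by simp
  have "z $ 1 * ((x $ 1)\<^sup>2 + (x $ 2)\<^sup>2) = a * x $ 1 + b * x' $ 1"
    "z $ 2 * ((x $ 1)\<^sup>2 + (x $ 2)\<^sup>2) = a * x $ 2 + b * x' $ 2"
    by (simp_all add: a_def b_def x'_def wedge_def algebra_simps power2_eq_square)
  then have z: "z = a *\<^sub>R x + b *\<^sub>R x'"
    unfolding x1 by (simp add: vec2_eq_iff)
  \<comment> \<open>If the slope b / a were below \<rho>, then z / a would lie in the ball about
    \<open>x\<close>, and scaling would put \<open>z\<close> into \<open>M\<close>.\<close>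
  have ab: "\<rho> * \<bar>a\<bar> \<le> \<bar>b\<bar>"
  proof (rule ccontr)
    assume less: "\<not> ?thesis"
    then have "a \<noteq> 0"
      by auto
    have "x + (b / a) *\<^sub>R x' \<in> ball x \<rho>"
      using less \<open>a \<noteq> 0\<close> by (simp add: dist_norm x' field_simps)
    then have "a *\<^sub>R (x + (b / a) *\<^sub>R x') \<in> M"
      using x(1) \<open>a \<noteq> 0\<close> by (intro scale) auto
    then show False
      using \<open>z \<notin> M\<close> \<open>a \<noteq> 0\<close> by (simp add: z scaleR_add_right)
  qed
  have "norm z \<le> \<bar>a\<bar> + \<bar>b\<bar>"
    using norm_triangle_ineq[of "a *\<^sub>R x" "b *\<^sub>R x'"] by (simp add: z x x')
  also have "\<dots> \<le> (1 + 1 / \<rho>) * \<bar>b\<bar>"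
    using ab x(2) by (simp add: field_simps)
  also have "\<bar>b\<bar> = \<bar>det B\<bar> * \<bar>wedge h y\<bar>"
    by (simp add: b_def z_def wedge_matrix_mult abs_mult flip: B(2))
  also have "\<bar>wedge h y\<bar> \<le> norm h * norm y"
    by (rule abs_wedge_le)
  also have "norm h \<le> norm g + r"
    using h norm_triangle_ineq2[of h g] by (simp add: dist_norm norm_minus_commute)
  finally show "norm (B *v h) \<le> (1 + 1 / \<rho>) * (\<bar>det B\<bar> * ((norm g + r) * norm y))"
    using x(2) by (simp add: z_def mult_left_mono mult_right_mono)
qed (rule g)

section \<open>Word products and uniform constants extracted from a multicone\<close>

lemma word_prod_Nil [simp]: "word_prod A [] = mat 1"
  and word_prod_Cons [simp]: "word_prod A (i # w) = A i ** word_prod A w"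
  by (simp_all add: word_prod_def)

lemma word_prod_append: "word_prod A (u @ w) = word_prod A u ** word_prod A w"
  by (induction u) (simp_all flip: matrix_mul_assoc)

lemma matrix_inv_mult_vec:
  fixes B :: "real^'n^'n"
  assumes "invertible B"
  shows "matrix_inv B *v (B *v x) = x" "B *v (matrix_inv B *v x) = x"
proof -
  have "B ** matrix_inv B = mat 1 \<and> matrix_inv B ** B = mat 1"
    using assms unfolding invertible_def matrix_inv_def by (rule someI_ex)
  then show "matrix_inv B *v (B *v x) = x" "B *v (matrix_inv B *v x) = x"
    by (simp_all only: matrix_vector_mul_assoc matrix_vector_mul_lid)
qed

text \<open>In the application \<open>V\<close> is the interior of the backward multicone and \<open>W\<close> the union of its images
  under the inverse matrices, a set of directions compactly contained in \<open>V\<close>.\<close>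

locale projective_ifs =
  fixes A :: "'i::finite \<Rightarrow> real^2^2" and V W :: "(real^2) set" and e :: "real^2" and \<kappa> \<rho> :: real
  assumes invertible: "\<And>i. invertible (A i)"
    and ball_e: "ball e \<rho> \<subseteq> V" and \<rho>: "0 < \<rho>" "\<rho> \<le> 1" and norm_e: "norm e = 1"
    and V_scaleR: "\<And>x a. x \<in> V \<Longrightarrow> a \<noteq> 0 \<Longrightarrow> a *\<^sub>R x \<in> V"
    and V_backward: "\<And>i y. A i *v y \<in> V \<Longrightarrow> y \<in> V"
    and V_disjoint: "\<And>i j y. A i *v y \<in> V \<Longrightarrow> A j *v y \<in> V \<Longrightarrow> i = j"
    and e_in_W: "e \<in> W"
    and W_backward: "\<And>i y. A i *v y \<in> W \<Longrightarrow> y \<in> W"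
    and W_expansion: "\<And>w y. word_prod A w *v y \<in> W \<Longrightarrow>
      onorm ((*v) (word_prod A w)) * norm (word_prod A w *v y) \<le> \<kappa> * \<bar>det (word_prod A w)\<bar> * norm y"

text \<open>Compactness makes the constants uniform: the unit vectors of \<open>W\<close> form a
  compact subset of the interior of \<open>M\<close>, so one radius serves for all of them. Together
  with one ball off \<open>M\<close> it gives an expansion constant valid for all words.\<close>

lemma backward_non_overlapping_imp_projective_ifs:
  fixes A :: "'i::finite \<Rightarrow> real^2^2"
  assumes inv: "\<And>i. invertible (A i)" and "backward_non_overlapping A"
  obtains V W e \<kappa> \<rho> where "projective_ifs A V W e \<kappa> \<rho>"
proof -
  obtain M where M: "multicone M" "backward_invariant M A"
    and disj: "\<forall>i j. i \<noteq> j \<longrightarrow> (*v) (matrix_inv (A i)) ` interior M \<inter> (*v) (matrix_inv (A j)) ` interior M = {}"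
    using assms(2) unfolding backward_non_overlapping_def by (elim exE conjE) (rule that)
  note scale = multicone_scaleR[OF M(1)]
  note zero = zero_notin_multicone[OF M(1)]
  have M_int: "y \<in> interior M" if "A i *v y \<in> M" for i y
  proof -
    have "matrix_inv (A i) *v (A i *v y) \<in> interior M"
      using M(2) that unfolding backward_invariant_def forward_invariant_def
      by (elim subsetD) (intro UN_I[of i] imageI UNIV_I)
    then show ?thesis
      by (simp only: matrix_inv_mult_vec(1)[OF inv])
  qed
  have M_back: "y \<in> M" if "A i *v y \<in> M" for i y
    using M_int[OF that] interior_subset by blast
  have M_back_word: "y \<in> M" if "word_prod A w *v y \<in> M" for w y
    using that
  proof (induction w)
    case (Cons i w)
    then have "A i *v (word_prod A w *v y) \<in> M"
      by (simp only: word_prod_Cons matrix_vector_mul_assoc)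
    then show ?case
      by (rule Cons.IH[OF M_back])
  qed simp
  have int_back: "y \<in> interior M" if "A i *v y \<in> interior M" for i y
    using that interior_subset[of M] by (intro M_int[of i y]) (rule subsetD)
  have disjoint: "i = j" if "A i *v y \<in> interior M" "A j *v y \<in> interior M" for i j y
  proof (rule ccontr)
    assume "i \<noteq> j"
    have "y \<in> (*v) (matrix_inv (A i)) ` interior M" "y \<in> (*v) (matrix_inv (A j)) ` interior M"
      using imageI[OF that(1), of "(*v) (matrix_inv (A i))"] imageI[OF that(2), of "(*v) (matrix_inv (A j))"]
      by (simp_all only: matrix_inv_mult_vec(1)[OF inv])
    then have "y \<in> (*v) (matrix_inv (A i)) ` interior M \<inter> (*v) (matrix_inv (A j)) ` interior M"
      by (rule IntI)
    then show False
      unfolding disj[rule_format, OF \<open>i \<noteq> j\<close>] by (rule emptyE)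
  qed
  have int_scale: "a *\<^sub>R x \<in> interior M" if "x \<in> interior M" "a \<noteq> 0" for a x
  proof -
    have "open ((*\<^sub>R) a ` interior M)"
      using that(2) by (intro open_scaling) auto
    moreover have "(*\<^sub>R) a ` interior M \<subseteq> M"
      using that(2) scale interior_subset by blast
    ultimately have "(*\<^sub>R) a ` interior M \<subseteq> interior M"
      by (rule interior_maximal[rotated])
    then show ?thesis
      using that(1) by blast
  qed
  define W where "W = {x. \<exists>i. A i *v x \<in> M}"
  have W_nz: "x \<noteq> 0" if "x \<in> W" for x
    using that zero by (auto simp: W_def)
  have W_scale: "a *\<^sub>R x \<in> W" if "x \<in> W" "a \<noteq> 0" for a x
    using that scale by (auto simp: W_def matrix_vector_mult_scaleR)
  have W_back: "y \<in> W" if "A i *v y \<in> W" for i y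
    using that M_back unfolding W_def by blast
  have cont: "continuous_on UNIV ((*v) (A i))" for i
    by (intro linear_continuous_on bounded_linear_matrix)
  have "closed ((*v) (A i) -` insert 0 M)" for i
    using continuous_closed_vimage[of "insert 0 M" "(*v) (A i)"] closed_multicone[OF M(1)] cont[of i]
    by (simp add: continuous_on_eq_continuous_at)
  then have "closed (sphere 0 1 \<inter> (\<Union>i. (*v) (A i) -` insert 0 M))"
    by (intro closed_Int closed_UN closed_sphere) auto
  \<comment> \<open>The origin was added only for closedness: by invertibility no unit vector is
    mapped to it.\<close>
  moreover have "sphere 0 1 \<inter> (\<Union>i. (*v) (A i) -` insert 0 M) = sphere 0 1 \<inter> W"
  proof -
    have nz: "x = 0" if "A i *v x = 0" for i x
      using matrix_inv_mult_vec(1)[OF inv, of i x] that by simp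
    show ?thesis
    proof (intro set_eqI iffI)
      fix x assume x: "x \<in> sphere 0 1 \<inter> (\<Union>i. (*v) (A i) -` insert 0 M)"
      then obtain i where "A i *v x = 0 \<or> A i *v x \<in> M"
        by auto
      moreover have "A i *v x \<noteq> 0"
        using nz x by force
      ultimately show "x \<in> sphere 0 1 \<inter> W"
        using x by (auto simp: W_def)
    qed (auto simp: W_def)
  qed
  ultimately have "compact (sphere 0 1 \<inter> W)"
    by (intro compact_eq_bounded_closed[THEN iffD2] conjI bounded_Int) auto
  moreover have "sphere 0 1 \<inter> W \<subseteq> interior M"
    using M_int by (auto simp: W_def)
  ultimately obtain \<rho>0 where \<rho>0: "\<rho>0 > 0" "(\<Union>x\<in>sphere 0 1 \<inter> W. ball x \<rho>0) \<subseteq> interior M"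
    using compact_subset_open_imp_ball_epsilon_subset[OF _ open_interior] by blast
  \<comment> \<open>The cap at 1 keeps the vectors of \<open>ball e \<rho>\<close> within norm
    2.\<close>
  define \<rho> where "\<rho> = min 1 \<rho>0"
  have \<rho>: "0 < \<rho>" "\<rho> \<le> 1" "\<rho> \<le> \<rho>0"
    using \<rho>0 by (auto simp: \<rho>_def)
  have ball_W: "ball x \<rho> \<subseteq> interior M" if "x \<in> W" "norm x = 1" for x
  proof -
    have "x \<in> sphere 0 1 \<inter> W"
      using that by simp
    then show ?thesis
      using \<rho>0(2) subset_ball[OF \<rho>(3), of x] by blast
  qed
  obtain m where m: "m \<in> M"
    using multicone_nonempty[OF M(1)] by blast
  \<comment> \<open>Any letter would do; \<open>undefined\<close> picks one.\<close>
  define m' where "m' = matrix_inv (A undefined) *v m"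
  have m': "m' \<in> W"
    unfolding W_def using m by (auto simp: m'_def matrix_inv_mult_vec(2)[OF inv] intro!: exI[of _ undefined])
  define e where "e = (1 / norm m') *\<^sub>R m'"
  have e: "e \<in> W" "norm e = 1"
    using W_scale[OF m', of "1 / norm m'"] W_nz[OF m'] by (auto simp: e_def)
  obtain g where g: "g \<noteq> 0" "g \<notin> M"
    using multicone_proper[OF M(1)] by blast
  have "open (- insert 0 M)" "g \<in> - insert 0 M"
    using closed_multicone[OF M(1)] g by auto
  then obtain r where r: "r > 0" "ball g r \<subseteq> - insert 0 M"
    using open_contains_ball by blast
  \<comment> \<open>The constant of \<open>cone_expansion\<close>; it involves neither the word nor
    the vector.\<close>
  define \<kappa> where "\<kappa> = 2 * ((1 + 1 / \<rho>) * (norm g + r)) / r"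
  have exp: "onorm ((*v) (word_prod A w)) * norm (word_prod A w *v y)
      \<le> \<kappa> * \<bar>det (word_prod A w)\<bar> * norm y" if "word_prod A w *v y \<in> W" for w y
  proof -
    define x where "x = word_prod A w *v y"
    have x: "x \<in> W" "x \<noteq> 0"
      using that W_nz unfolding x_def by auto
    have "onorm ((*v) (word_prod A w))
      \<le> 2 * ((1 + 1 / \<rho>) * (\<bar>det (word_prod A w)\<bar> * ((norm g + r) * norm ((1 / norm x) *\<^sub>R y)))) / r"
    proof (rule cone_expansion[where M = M])
      show "ball ((1 / norm x) *\<^sub>R x) \<rho> \<subseteq> M"
        using ball_W[of "(1 / norm x) *\<^sub>R x"] W_scale[OF x(1)] x(2) interior_subset[of M] by auto
      show "ball g r \<inter> M = {}"
        using r by auto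
      show "word_prod A w *v ((1 / norm x) *\<^sub>R y) = (1 / norm x) *\<^sub>R x"
        by (simp add: matrix_vector_mult_scaleR x_def)
    qed (use x \<rho> r scale M_back_word in auto)
    also have "\<dots> = \<kappa> * \<bar>det (word_prod A w)\<bar> * norm y / norm x"
    proof -
      have "2 * (q * (d * (h * (n / a)))) / r = 2 * (q * h) / r * d * n / a" for q d h n a :: real
        by (simp add: mult_ac)
      then show ?thesis
        unfolding \<kappa>_def norm_scaleR abs_divide abs_norm_cancel abs_one times_divide_eq_left mult_1 .
    qed
    finally show ?thesis
      using x(2) by (simp add: pos_le_divide_eq flip: x_def)
  qed
  have "projective_ifs A (interior M) W e \<kappa> \<rho>"
    by unfold_locales (use inv ball_W[OF e] \<rho> e int_scale int_back disjoint W_back exp in auto)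
  then show ?thesis
    by (rule that)
qed

section \<open>Preimages of a disc under matrix products\<close>

text \<open>For a unit vector \<open>z\<close> this is the orthogonal map (a reflection) that sends
  \<open>z\<close> to the first axis and the strip about the line of \<open>z\<close> to a
  horizontal strip.\<close>

definition rot_to :: "real^2 \<Rightarrow> real^2 \<Rightarrow> real^2" where
  "rot_to z y = vector [y $ 1 * z $ 1 + y $ 2 * z $ 2, wedge y z]"

lemma linear_rot_to: "linear (rot_to z)"
  by (rule linearI) (simp_all add: rot_to_def wedge_def vec2_eq_iff algebra_simps)

lemma det_matrix_2:
  fixes f :: "real^2 \<Rightarrow> real^2"
  shows "det (matrix f) = wedge (f (axis 1 1)) (f (axis 2 1))"
  by (simp add: det_2 matrix_def wedge_def)

lemma abs_det_rot_to: "norm z = 1 \<Longrightarrow> \<bar>det (matrix (rot_to z))\<bar> = 1"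
  using norm_real2_squared[of z]
  by (simp add: det_matrix_2 rot_to_def wedge_def axis_def power2_eq_square)

text \<open>In coordinates along and across \<open>z\<close>, all the disjoint sets fit into one
  rectangle with sides 2R and 2\<eta>.\<close>

lemma sum_measure_le_strip:
  fixes E :: "'a \<Rightarrow> (real^2) set"
  assumes "finite Q" and meas: "\<And>w. w \<in> Q \<Longrightarrow> E w \<in> lmeasurable"
    and disj: "disjoint_family_on E Q" and z: "norm z = 1" and "0 \<le> R" "0 \<le> \<eta>"
    and strip: "\<And>w y. w \<in> Q \<Longrightarrow> y \<in> E w \<Longrightarrow> norm y \<le> R \<and> \<bar>wedge y z\<bar> \<le> \<eta>"
  shows "(\<Sum>w\<in>Q. measure lebesgue (E w)) \<le> 4 * R * \<eta>"
proof -
  have U: "(\<Union>w\<in>Q. E w) \<in> lmeasurable"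
    using assms(1) meas by (intro fmeasurable.finite_UN) auto
  have "(\<Sum>w\<in>Q. measure lebesgue (E w)) = measure lebesgue (\<Union>w\<in>Q. E w)"
    using assms(1) meas disj by (intro measure_UNION'[symmetric]) (auto simp: disjoint_family_on_def pairwise_def disjnt_def)
  also have "\<dots> = measure lebesgue (rot_to z ` (\<Union>w\<in>Q. E w))"
    using measure_linear_image[OF linear_rot_to[of z] U] abs_det_rot_to[OF z] by simp
  also have "\<dots> \<le> measure lebesgue (cbox (vector [-R, -\<eta>]) (vector [R, \<eta>] :: real^2))"
  proof (rule measure_mono_fmeasurable)
    show "rot_to z ` (\<Union>w\<in>Q. E w) \<in> sets lebesgue"
      using measurable_linear_image[OF linear_rot_to[of z] U] by auto
    show "rot_to z ` (\<Union>w\<in>Q. E w) \<subseteq> cbox (vector [-R, -\<eta>]) (vector [R, \<eta>])"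
    proof safe
      fix w y assume y: "w \<in> Q" "y \<in> E w"
      have "y $ 1 * z $ 1 + y $ 2 * z $ 2 = y \<bullet> z"
        by (simp add: inner_vec_def sum_2)
      then have "\<bar>y $ 1 * z $ 1 + y $ 2 * z $ 2\<bar> \<le> R"
        using Cauchy_Schwarz_ineq2[of y z] strip[OF y] z by simp
      then show "rot_to z y \<in> cbox (vector [-R, -\<eta>]) (vector [R, \<eta>])"
        using strip[OF y] by (simp add: mem_box_cart forall_2 rot_to_def abs_le_iff)
    qed
  qed auto
  also have "\<dots> = 4 * R * \<eta>"
    using assms by (intro measure_box_real2) auto
  finally show ?thesis .
qed

lemma finite_words [simp]: "finite {w :: 'i::finite list. length w = n}"
  using finite_lists_length_eq[of "UNIV :: 'i set" n] by simp

section \<open>Almost multiplicative norms and the packing of ellipses\<close>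

context projective_ifs
begin

definition N :: "'i list \<Rightarrow> real" where "N w = onorm ((*v) (word_prod A w))"
definition D :: "'i list \<Rightarrow> real" where "D w = \<bar>det (word_prod A w)\<bar>"
text \<open>The direction contracted most by the word, up to constants: its image \<open>e\<close>
  lies in \<open>W\<close>, so the length shrinks by at most \<kappa> times the smaller singular
  value \<open>D w / N w\<close>.\<close>

definition x_of :: "'i list \<Rightarrow> real^2" where "x_of w = matrix_inv (word_prod A w) *v e"
text \<open>The preimage of the disc about \<open>e\<close>, rescaled to bounded length. It is
  stretched along \<open>x_of w\<close>, and its area is comparable to
  \<open>D w / (N w)\<^sup>2\<close>, the ratio of the singular values.\<close>

definition ellipse :: "'i list \<Rightarrow> (real^2) set" where
  "ellipse w = (\<lambda>b. (1 / norm (x_of w)) *\<^sub>R (matrix_inv (word_prod A w) *v b)) ` ball e \<rho>"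

lemma invertible_word_prod: "invertible (word_prod A w)"
proof (induction w)
  case (Cons i w)
  then show ?case
    using invertible invertible_mult[of "A i" "word_prod A w"] by simp
qed (simp add: invertible_det_nz)

lemma word_prod_inv [simp]:
  "matrix_inv (word_prod A w) *v (word_prod A w *v x) = x"
  "word_prod A w *v (matrix_inv (word_prod A w) *v x) = x"
  by (simp_all only: matrix_inv_mult_vec[OF invertible_word_prod])

lemma D_Nil [simp]: "D [] = 1" and D_append: "D (u @ w) = D u * D w"
  by (simp_all add: D_def word_prod_append det_mul abs_mult)

lemma D_pos: "D w > 0"
  using invertible_word_prod[of w] by (simp add: D_def invertible_det_nz)

lemma N_pos: "N w > 0"
  unfolding N_def by (rule onorm_pos_if_invertible[OF invertible_word_prod])

lemma N_Nil [simp]: "N [] = 1"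
proof -
  have "(*v) (mat 1) = (\<lambda>x :: real^2. x)"
    by (rule ext) (rule matrix_vector_mul_lid)
  then show ?thesis
    using onorm_id[where 'a = "real^2"] by (simp add: N_def)
qed

lemma N_append_le: "N (u @ w) \<le> N u * N w"
  unfolding N_def word_prod_append by (rule onorm_matrix_matrix_mult)

lemma word_prod_norm_le: "norm (word_prod A w *v x) \<le> N w * norm x"
  unfolding N_def by (rule norm_matrix_mult_le)

lemma word_prod_norm_ge: "D w * norm x \<le> N w * norm (word_prod A w *v x)"
  unfolding N_def D_def by (rule norm_matrix_mult_ge)

lemma D_le_N_squared: "D w \<le> (N w)\<^sup>2"
  unfolding N_def D_def by (rule abs_det_le_onorm_squared)

text \<open>Read with \<open>D w / N w\<close> as the smaller singular value: a vector that lands in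
  \<open>W\<close> has been contracted as strongly as possible, up to \<kappa>.\<close>

lemma W_expansion': "word_prod A w *v y \<in> W \<Longrightarrow> N w * norm (word_prod A w *v y) \<le> \<kappa> * D w * norm y"
  unfolding N_def D_def by (rule W_expansion)

lemma W_backward_word: "word_prod A w *v y \<in> W \<Longrightarrow> y \<in> W"
proof (induction w)
  case (Cons i w)
  then show ?case
    using W_backward[of i "word_prod A w *v y"] by (simp add: matrix_vector_mul_assoc)
qed simp

text \<open>By \<open>V_backward\<close> the two tails already send \<open>y\<close> into
  \<open>V\<close>, so induction identifies them; then \<open>V_disjoint\<close> identifies the
  first letters.\<close>

lemma V_disjoint_word:
  assumes "length w = length v" "word_prod A w *v y \<in> V" "word_prod A v *v y \<in> V"
  shows "w = v"
  using assms
proof (induction w v rule: list_induct2)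
  case (Cons i w j v)
  have "A i *v (word_prod A w *v y) \<in> V" "A j *v (word_prod A v *v y) \<in> V"
    using Cons.prems by (simp_all add: matrix_vector_mul_assoc)
  then have "word_prod A w *v y \<in> V" "word_prod A v *v y \<in> V"
    using V_backward by blast+
  then have "w = v"
    by (rule Cons.IH)
  then show ?case
    using Cons.prems V_disjoint[of i "word_prod A w *v y" j] by (simp add: matrix_vector_mul_assoc)
qed simp

lemma word_prod_x_of [simp]: "word_prod A w *v x_of w = e"
  by (simp add: x_of_def)

lemma word_prod_x_of_append: "word_prod A w *v x_of (u @ w) = x_of u"
proof -
  have "word_prod A u *v (word_prod A w *v x_of (u @ w)) = e"
    using word_prod_x_of[of "u @ w"] by (simp add: word_prod_append matrix_vector_mul_assoc)
  then show ?thesis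
    unfolding x_of_def[of u] by (metis word_prod_inv(1))
qed

lemma x_of_in_W: "x_of w \<in> W"
  using e_in_W W_backward_word[of w "x_of w"] by simp

lemma N_le_norm_x_of: "N w \<le> \<kappa> * D w * norm (x_of w)"
  using W_expansion'[of w "x_of w"] e_in_W by (simp add: norm_e)

lemma norm_x_of_le: "D w * norm (x_of w) \<le> N w"
  using word_prod_norm_ge[of w "x_of w"] by (simp add: norm_e)

lemma kappa_ge_1: "\<kappa> \<ge> 1"
  using N_le_norm_x_of[of "[]"] word_prod_x_of[of "[]"] norm_e by simp

lemma norm_x_of_pos: "norm (x_of w) > 0"
proof -
  have "x_of w \<noteq> 0"
    using word_prod_x_of[of w] norm_e by (metis matrix_vector_mult_0_right norm_zero zero_neq_one)
  then show ?thesis by simp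
qed

text \<open>The converse of submultiplicativity, up to a constant. The vector
  \<open>x_of (u @ w)\<close> is contracted almost maximally by \<open>w\<close>, onto
  \<open>x_of u\<close>, and then almost maximally by \<open>u\<close>, so the smaller singular
  values multiply; determinants transfer this to the norms.\<close>

lemma N_append_ge: "N u * N w \<le> \<kappa>\<^sup>2 * N (u @ w)"
proof -
  have "N u * N w \<le> (\<kappa> * D u * norm (x_of u)) * N w"
    using N_le_norm_x_of[of u] N_pos[of w] by (intro mult_right_mono) auto
  also have "\<dots> = \<kappa> * D u * (N w * norm (word_prod A w *v x_of (u @ w)))"
    by (simp add: word_prod_x_of_append)
  also have "\<dots> \<le> \<kappa> * D u * (\<kappa> * D w * norm (x_of (u @ w)))"
    using x_of_in_W[of u] kappa_ge_1 D_pos[of u]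
    by (intro mult_left_mono W_expansion') (auto simp: word_prod_x_of_append)
  also have "\<dots> = \<kappa>\<^sup>2 * (D (u @ w) * norm (x_of (u @ w)))"
    by (simp add: D_append power2_eq_square)
  also have "\<dots> \<le> \<kappa>\<^sup>2 * N (u @ w)"
    by (intro mult_left_mono norm_x_of_le) simp
  finally show ?thesis .
qed

lemma ellipse_memE:
  assumes "y \<in> ellipse w"
  obtains b where "b \<in> ball e \<rho>" "norm b \<le> 2" "norm (x_of w) *\<^sub>R y = matrix_inv (word_prod A w) *v b"
    "word_prod A w *v y = (1 / norm (x_of w)) *\<^sub>R b"
proof -
  obtain b where b: "b \<in> ball e \<rho>" "y = (1 / norm (x_of w)) *\<^sub>R (matrix_inv (word_prod A w) *v b)"
    using assms by (auto simp: ellipse_def)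
  have "norm b \<le> norm e + \<rho>"
    using b(1) norm_triangle_ineq2[of b e] by (simp add: dist_norm norm_minus_commute)
  then show ?thesis
    using b \<rho> norm_e norm_x_of_pos[of w] by (intro that[of b]) (auto simp: matrix_vector_mult_scaleR)
qed

lemma disjoint_ellipses: "disjoint_family_on ellipse {w. length w = n}"
  unfolding disjoint_family_on_def
proof (intro ballI impI)
  fix w v :: "'i list" assume wv: "w \<in> {w. length w = n}" "v \<in> {w. length w = n}" "w \<noteq> v"
  have *: "word_prod A w *v y \<in> V" if "y \<in> ellipse w" for w y
    using that
  proof (rule ellipse_memE)
    fix b assume "b \<in> ball e \<rho>" "word_prod A w *v y = (1 / norm (x_of w)) *\<^sub>R b"
    then show ?thesis
      using ball_e norm_x_of_pos[of w] V_scaleR[of b "1 / norm (x_of w)"] by auto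
  qed
  show "ellipse w \<inter> ellipse v = {}"
    using V_disjoint_word[of w v] wv * by fastforce
qed

text \<open>The defining linear map has determinant 1 / (D |x_of|^2) in modulus, and D |x_of| is at
  most N.\<close>

lemma ellipse_measure:
  shows "ellipse w \<in> lmeasurable"
    and "measure lebesgue (ball e \<rho>) * (D w / (N w)\<^sup>2) \<le> measure lebesgue (ellipse w)"
proof -
  define f where "f = (\<lambda>b. (1 / norm (x_of w)) *\<^sub>R (matrix_inv (word_prod A w) *v b))"
  have lin: "linear f"
    unfolding f_def by (rule linearI) (simp_all add: algebra_simps matrix_vector_mult_scaleR)
  have ball: "ball e \<rho> \<in> lmeasurable"
    by (rule lmeasurable_ball)
  show "ellipse w \<in> lmeasurable"
    using measurable_linear_image[OF lin ball] by (simp add: ellipse_def f_def)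
  let ?n = "norm (x_of w)"
  have n: "?n > 0"
    by (rule norm_x_of_pos)
  have "det (word_prod A w) * det (matrix f)
      = (1 / ?n)\<^sup>2 * (det (word_prod A w) * wedge (matrix_inv (word_prod A w) *v axis 1 1) (matrix_inv (word_prod A w) *v axis 2 1))"
    by (simp add: det_matrix_2 f_def power2_eq_square)
  also have "\<dots> = (1 / ?n)\<^sup>2 * wedge (axis 1 1) (axis 2 1)"
    by (simp flip: wedge_matrix_mult)
  also have "\<dots> = (1 / ?n)\<^sup>2"
    by (simp add: wedge_def axis_def)
  finally have "\<bar>det (word_prod A w) * det (matrix f)\<bar> = (1 / ?n)\<^sup>2"
    by simp
  then have det: "D w * \<bar>det (matrix f)\<bar> = 1 / ?n\<^sup>2"
    by (simp add: D_def abs_mult power_divide)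
  have "D w * ?n \<le> N w"
    by (rule norm_x_of_le)
  then have "(D w * ?n)\<^sup>2 \<le> (N w)\<^sup>2"
    using D_pos[of w] n by (intro power_mono) auto
  then have "D w / (N w)\<^sup>2 \<le> D w / (D w * ?n)\<^sup>2"
    using D_pos[of w] N_pos[of w] n by (intro divide_left_mono mult_pos_pos) auto
  also have "\<dots> = \<bar>det (matrix f)\<bar>"
    using det D_pos[of w] n by (simp add: field_simps power2_eq_square)
  finally have "measure lebesgue (ball e \<rho>) * (D w / (N w)\<^sup>2) \<le> \<bar>det (matrix f)\<bar> * measure lebesgue (ball e \<rho>)"
    by (metis measure_nonneg mult.commute mult_left_mono)
  also have "\<dots> = measure lebesgue (ellipse w)"
    unfolding ellipse_def f_def[symmetric] using measure_linear_image[OF lin ball] by simp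
  finally show "measure lebesgue (ball e \<rho>) * (D w / (N w)\<^sup>2) \<le> measure lebesgue (ellipse w)" .
qed

text \<open>The inverse matrix stretches by at most N / D, and the normalising length
  \<open>norm (x_of w)\<close> is at least N / (\<kappa> D).\<close>

lemma ellipse_norm_le:
  assumes "y \<in> ellipse w"
  shows "norm y \<le> 2 * \<kappa>"
  using assms
proof (rule ellipse_memE)
  fix b assume b: "norm b \<le> 2" "norm (x_of w) *\<^sub>R y = matrix_inv (word_prod A w) *v b"
  have "D w * norm (x_of w) * norm y = D w * norm (norm (x_of w) *\<^sub>R y)"
    by simp
  also have "\<dots> \<le> N w * norm b"
    unfolding b(2) using word_prod_norm_ge[of w "matrix_inv (word_prod A w) *v b"] by simp
  also have "\<dots> \<le> (\<kappa> * D w * norm (x_of w)) * 2"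
    using b(1) N_le_norm_x_of[of w] N_pos[of w] by (intro mult_mono) auto
  finally have "(D w * norm (x_of w)) * norm y \<le> (D w * norm (x_of w)) * (2 * \<kappa>)"
    by (simp add: mult_ac)
  then show ?thesis
    using D_pos[of w] norm_x_of_pos[of w] by (simp add: mult_le_cancel_left_pos)
qed

text \<open>Letters put in front of \<open>w\<close> turn the contracted direction only by the ratio
  of the singular values of \<open>w\<close>. To see this, apply A_w to both vectors:
  \<open>wedge\<close> gets the factor det, \<open>y\<close> becomes a short vector, and
  \<open>x_of (u @ w)\<close> becomes \<open>x_of u\<close>, which lies in \<open>W\<close>.\<close>

lemma ellipse_wedge_x_of_le:
  assumes "y \<in> ellipse w"
  shows "\<bar>wedge y (x_of (u @ w))\<bar> \<le> 2 * \<kappa>\<^sup>2 * (D w / (N w)\<^sup>2) * norm (x_of (u @ w))"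
  using assms
proof (rule ellipse_memE)
  fix b assume b: "norm b \<le> 2" "word_prod A w *v y = (1 / norm (x_of w)) *\<^sub>R b"
  let ?s = "x_of (u @ w)"
  have 1: "N w * norm (x_of u) \<le> \<kappa> * D w * norm ?s"
    using W_expansion'[of w ?s] x_of_in_W[of u] by (simp add: word_prod_x_of_append)
  have 2: "N w / norm (x_of w) \<le> \<kappa> * D w"
    using N_le_norm_x_of[of w] norm_x_of_pos[of w] by (simp add: pos_divide_le_eq)
  have "D w * \<bar>wedge y ?s\<bar> = \<bar>wedge (word_prod A w *v y) (word_prod A w *v ?s)\<bar>"
    by (simp add: wedge_matrix_mult D_def abs_mult)
  also have "\<dots> \<le> norm (word_prod A w *v y) * norm (x_of u)"
    using abs_wedge_le by (simp add: word_prod_x_of_append)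
  also have "\<dots> = norm b * (1 / norm (x_of w)) * norm (x_of u)"
    unfolding b(2) by simp
  finally have 3: "D w * \<bar>wedge y ?s\<bar> \<le> norm b * (1 / norm (x_of w)) * norm (x_of u)" .
  have "D w * ((N w)\<^sup>2 * \<bar>wedge y ?s\<bar>) = (N w)\<^sup>2 * (D w * \<bar>wedge y ?s\<bar>)"
    by (rule mult.left_commute)
  also have "\<dots> \<le> (N w)\<^sup>2 * (norm b * (1 / norm (x_of w)) * norm (x_of u))"
    using 3 by (intro mult_left_mono) auto
  also have "\<dots> = norm b * ((N w / norm (x_of w)) * (N w * norm (x_of u)))"
    by (simp add: power2_eq_square)
  also have "\<dots> \<le> 2 * ((\<kappa> * D w) * (\<kappa> * D w * norm ?s))"
    by (rule mult_mono[OF b(1) mult_mono[OF 2 1]])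
      (use N_pos[of w] D_pos[of w] kappa_ge_1 in \<open>auto intro: divide_nonneg_nonneg less_imp_le\<close>)
  also have "\<dots> = D w * (2 * \<kappa>\<^sup>2 * D w * norm ?s)"
    by (simp add: power2_eq_square)
  finally have "D w * ((N w)\<^sup>2 * \<bar>wedge y ?s\<bar>) \<le> D w * (2 * \<kappa>\<^sup>2 * D w * norm ?s)" .
  then have "(N w)\<^sup>2 * \<bar>wedge y ?s\<bar> \<le> 2 * \<kappa>\<^sup>2 * D w * norm ?s"
    using D_pos[of w] by (rule mult_left_le_imp_le)
  then show ?thesis
    using N_pos[of w] by (simp add: field_simps)
qed

text \<open>Applying the matrix to both vectors turns \<open>x_of w\<close> into the unit vector
  \<open>e\<close> and \<open>z\<close> into a vector of length at most \<open>r\<close>; so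
  \<open>z\<close> makes an angle of order r / N with the contracted direction.\<close>

lemma wedge_x_of_le:
  assumes "norm (word_prod A w *v z) \<le> r"
  shows "\<bar>wedge (x_of w) z\<bar> \<le> \<kappa> * (r / N w) * norm (x_of w)"
proof -
  have "D w * \<bar>wedge (x_of w) z\<bar> = \<bar>wedge e (word_prod A w *v z)\<bar>"
    by (simp add: D_def flip: abs_mult wedge_matrix_mult)
  also have "\<dots> \<le> r"
    using abs_wedge_le[of e "word_prod A w *v z"] norm_e assms by simp
  finally have le: "D w * \<bar>wedge (x_of w) z\<bar> \<le> r" .
  have r: "r \<ge> 0"
    using assms norm_ge_zero order_trans by blast
  have "N w * (D w * \<bar>wedge (x_of w) z\<bar>) \<le> (\<kappa> * D w * norm (x_of w)) * r"
    using le N_le_norm_x_of[of w] N_pos[of w] D_pos[of w] by (intro mult_mono) auto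
  then have "D w * (N w * \<bar>wedge (x_of w) z\<bar>) \<le> D w * (\<kappa> * norm (x_of w) * r)"
    by (simp add: mult_ac)
  then have "N w * \<bar>wedge (x_of w) z\<bar> \<le> \<kappa> * norm (x_of w) * r"
    using D_pos[of w] by simp
  then show ?thesis
    using N_pos[of w] by (simp add: field_simps)
qed

text \<open>The direction \<open>x_of (u @ w)\<close> mediates: it is close to \<open>z\<close>
  because the whole word shortens \<open>z\<close>, and close to the ellipse because
  \<open>w\<close> is a suffix of that word.\<close>

lemma ellipse_near_contracted_direction:
  assumes y: "y \<in> ellipse w" and z: "norm z = 1" and r: "norm (word_prod A (u @ w) *v z) \<le> r"
  shows "\<bar>wedge y z\<bar> \<le> 2 * \<kappa>\<^sup>2 * (r / N (u @ w) + D w / (N w)\<^sup>2)"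
proof -
  let ?s = "x_of (u @ w)"
  have r0: "r \<ge> 0"
    using r norm_ge_zero order_trans by blast
  have "norm ?s * \<bar>wedge y z\<bar> \<le> norm y * \<bar>wedge ?s z\<bar> + norm z * \<bar>wedge y ?s\<bar>"
    by (rule wedge_triangle)
  also have "\<dots> \<le> (2 * \<kappa>) * (\<kappa> * (r / N (u @ w)) * norm ?s) + 1 * (2 * \<kappa>\<^sup>2 * (D w / (N w)\<^sup>2) * norm ?s)"
    using ellipse_norm_le[OF y] wedge_x_of_le[OF r] ellipse_wedge_x_of_le[OF y, of u] z kappa_ge_1
    by (intro add_mono mult_mono) auto
  also have "\<dots> = norm ?s * (2 * \<kappa>\<^sup>2 * (r / N (u @ w) + D w / (N w)\<^sup>2))"
    by (simp add: algebra_simps power2_eq_square)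
  finally show ?thesis
    using norm_x_of_pos[of "u @ w"] by (simp add: mult_le_cancel_left_pos)
qed

lemma measure_ball_pos: "measure lebesgue (ball e \<rho>) > 0"
  using content_ball_pos[of \<rho> e] \<rho> by simp

text \<open>Packing: the ellipses of words of one length are disjoint, have area at least a constant
  times the summands, and lie in a fixed bounded region.\<close>

lemma sum_D_over_N_squared_le:
  "(\<Sum>w | length w = n. D w / (N w)\<^sup>2) \<le> 16 * \<kappa>\<^sup>2 / measure lebesgue (ball e \<rho>)"
proof -
  let ?m = "measure lebesgue (ball e \<rho>)"
  have "?m * (\<Sum>w | length w = n. D w / (N w)\<^sup>2) \<le> (\<Sum>w | length w = n. measure lebesgue (ellipse w))"
    unfolding sum_distrib_left by (intro sum_mono ellipse_measure)
  \<comment> \<open>Any unit vector may serve as axis, since the norm bound alone confines the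
    ellipses to a square of half side 2\<kappa>.\<close>
  also have "\<dots> \<le> 4 * (2 * \<kappa>) * (2 * \<kappa>)"
  proof (rule sum_measure_le_strip)
    fix w y assume "y \<in> ellipse w"
    then show "norm y \<le> 2 * \<kappa> \<and> \<bar>wedge y (axis 1 1)\<bar> \<le> 2 * \<kappa>"
      using ellipse_norm_le[of y w] abs_wedge_le[of y "axis 1 1"] by auto
  qed (use kappa_ge_1 finite_words disjoint_ellipses ellipse_measure in auto)
  finally show ?thesis
    using measure_ball_pos by (simp add: pos_le_divide_eq mult.commute power2_eq_square)
qed

text \<open>The ellipses of all admissible suffixes are disjoint, have area at least of order
  \<beta>1, and lie in one strip about \<open>z\<close> of half width 2 \<kappa>^2 (\<beta>2 +
  \<beta>3). The prefix \<open>u\<close> may vary with \<open>w\<close>, because the strip estimate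
  is uniform in it.\<close>

lemma card_suffixes_le:
  assumes Q: "Q \<subseteq> {w. length w = k}" and z: "norm z = 1" and pos: "0 \<le> \<beta>2" "0 \<le> \<beta>3"
    and ex: "\<And>w. w \<in> Q \<Longrightarrow> \<exists>u r. norm (word_prod A (u @ w) *v z) \<le> r \<and> r / N (u @ w) \<le> \<beta>3"
    and \<beta>1: "\<And>w. w \<in> Q \<Longrightarrow> \<beta>1 \<le> D w / (N w)\<^sup>2"
    and \<beta>2: "\<And>w. w \<in> Q \<Longrightarrow> D w / (N w)\<^sup>2 \<le> \<beta>2"
  shows "measure lebesgue (ball e \<rho>) * (real (card Q) * \<beta>1) \<le> 16 * \<kappa> ^ 3 * (\<beta>2 + \<beta>3)"
proof -
  let ?m = "measure lebesgue (ball e \<rho>)"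
  have fin: "finite Q"
    using Q finite_words finite_subset by blast
  have "?m * (real (card Q) * \<beta>1) = (\<Sum>w\<in>Q. ?m * \<beta>1)"
    by simp
  also have "\<dots> \<le> (\<Sum>w\<in>Q. measure lebesgue (ellipse w))"
  proof (rule sum_mono)
    fix w assume "w \<in> Q"
    then have "?m * \<beta>1 \<le> ?m * (D w / (N w)\<^sup>2)"
      by (intro mult_left_mono \<beta>1) auto
    also have "\<dots> \<le> measure lebesgue (ellipse w)"
      by (rule ellipse_measure)
    finally show "?m * \<beta>1 \<le> measure lebesgue (ellipse w)" .
  qed
  also have "\<dots> \<le> 4 * (2 * \<kappa>) * (2 * \<kappa>\<^sup>2 * (\<beta>3 + \<beta>2))"
  proof (rule sum_measure_le_strip)
    fix w y assume w: "w \<in> Q" "y \<in> ellipse w"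
    obtain u r where ur: "norm (word_prod A (u @ w) *v z) \<le> r" "r / N (u @ w) \<le> \<beta>3"
      using ex[OF w(1)] by blast
    have "\<bar>wedge y z\<bar> \<le> 2 * \<kappa>\<^sup>2 * (r / N (u @ w) + D w / (N w)\<^sup>2)"
      by (rule ellipse_near_contracted_direction[OF w(2) z ur(1)])
    also have "\<dots> \<le> 2 * \<kappa>\<^sup>2 * (\<beta>3 + \<beta>2)"
      using ur(2) \<beta>2[OF w(1)] by (intro mult_left_mono add_mono) auto
    finally show "norm y \<le> 2 * \<kappa> \<and> \<bar>wedge y z\<bar> \<le> 2 * \<kappa>\<^sup>2 * (\<beta>3 + \<beta>2)"
      using ellipse_norm_le[OF w(2)] by simp
  next
    show "disjoint_family_on ellipse Q"
      using disjoint_ellipses Q by (rule disjoint_family_on_mono[rotated])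
  qed (use kappa_ge_1 fin ellipse_measure z pos in auto)
  finally show ?thesis
    by (simp add: power3_eq_cube power2_eq_square algebra_simps)
qed

end

section \<open>Bernoulli expectations over words and concentration\<close>

definition pword :: "'i pmf \<Rightarrow> 'i list \<Rightarrow> real" where
  "pword p w = prod_list (map (pmf p) w)"

text \<open>Expectation over random words as a finite sum, so that conditioning on a prefix is plain
  algebra.\<close>

definition Ew :: "'i::finite pmf \<Rightarrow> nat \<Rightarrow> ('i list \<Rightarrow> real) \<Rightarrow> real" where
  "Ew p n f = (\<Sum>w | length w = n. pword p w * f w)"

lemma pword_simps [simp]: "pword p [] = 1" "pword p (i # w) = pmf p i * pword p w"
  by (simp_all add: pword_def)

lemma pword_nonneg [simp]: "pword p w \<ge> 0"
  by (induction w) simp_all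

lemma sum_words_Suc:
  fixes f :: "'i::finite list \<Rightarrow> 'b::comm_monoid_add"
  shows "(\<Sum>w | length w = Suc n. f w) = (\<Sum>i\<in>UNIV. \<Sum>w | length w = n. f (i # w))"
proof -
  have "(\<Sum>i\<in>UNIV. \<Sum>w | length w = n. f (i # w)) = (\<Sum>(i, w)\<in>UNIV \<times> {w. length w = n}. f (i # w))"
    by (rule sum.cartesian_product)
  also have "\<dots> = (\<Sum>w | length w = Suc n. f w)"
    by (rule sum.reindex_bij_witness[where i = "\<lambda>w. (hd w, tl w)" and j = "\<lambda>(i, w). i # w"])
      (auto simp: length_Suc_conv)
  finally show ?thesis by simp
qed

lemma Ew_0 [simp]: "Ew p 0 f = f []"
  by (simp add: Ew_def)

lemma Ew_Suc: "Ew p (Suc n) f = (\<Sum>i\<in>UNIV. pmf p i * Ew p n (\<lambda>w. f (i # w)))"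
  by (simp add: Ew_def sum_words_Suc sum_distrib_left mult.assoc)

lemma Ew_mono: "(\<And>w. length w = n \<Longrightarrow> f w \<le> g w) \<Longrightarrow> Ew p n f \<le> Ew p n g"
  unfolding Ew_def by (intro sum_mono mult_left_mono) auto

lemma Ew_cong: "(\<And>w. length w = n \<Longrightarrow> f w = g w) \<Longrightarrow> Ew p n f = Ew p n g"
  unfolding Ew_def by (intro sum.cong) auto

lemma Ew_add: "Ew p n (\<lambda>w. f w + g w) = Ew p n f + Ew p n g"
  by (simp add: Ew_def distrib_left sum.distrib)

lemma Ew_diff: "Ew p n (\<lambda>w. f w - g w) = Ew p n f - Ew p n g"
  by (simp add: Ew_def right_diff_distrib sum_subtractf)

lemma Ew_minus: "Ew p n (\<lambda>w. - f w) = - Ew p n f"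
  by (simp add: Ew_def sum_negf)

lemma Ew_cmult: "Ew p n (\<lambda>w. c * f w) = c * Ew p n f"
  by (simp add: Ew_def sum_distrib_left mult.left_commute)

lemma Ew_const: "Ew p n (\<lambda>_. c) = c"
  by (induction n) (simp_all add: Ew_Suc sum_pmf_eq_1 flip: sum_distrib_right)

lemma Ew_append: "Ew p (m + n) f = Ew p m (\<lambda>u. Ew p n (\<lambda>w. f (u @ w)))"
  by (induction m arbitrary: f) (simp_all add: Ew_Suc)

lemma Ew_abs_diff_le:
  assumes "\<And>w. length w = n \<Longrightarrow> \<bar>f w - g w\<bar> \<le> b"
  shows "\<bar>Ew p n f - Ew p n g\<bar> \<le> b"
proof -
  have "- b \<le> f w - g w" "f w - g w \<le> b" if "length w = n" for w
    using assms[OF that] by linarith+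
  then have "Ew p n (\<lambda>w. f w - g w) \<le> Ew p n (\<lambda>_. b)" "Ew p n (\<lambda>_. - b) \<le> Ew p n (\<lambda>w. f w - g w)"
    by (simp_all only: Ew_mono)
  then show ?thesis
    by (simp add: Ew_const Ew_diff abs_le_iff)
qed

section \<open>Concentration for functions with bounded differences\<close>

lemma exp_le_quadratic:
  assumes "\<bar>x\<bar> \<le> (1::real)"
  shows "exp x \<le> 1 + x + x\<^sup>2"
proof (cases "x \<ge> 0")
  case True
  then show ?thesis
    using assms by (intro exp_bound) auto
next
  case False
  \<comment> \<open>For negative \<open>x\<close> the claim amounts to 1 \<le> (1 + x + x^2) exp
    (-x), and the quadratic Taylor polynomial of exp (-x) already suffices for it.\<close>
  have "1 - x + x\<^sup>2 / 2 \<le> exp (- x)"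
    using exp_lower_Taylor_quadratic[of "- x"] False by simp
  moreover have "1 + x + x\<^sup>2 > 0"
  proof -
    have "1 + x + x\<^sup>2 = (x + 1 / 2)\<^sup>2 + 3 / 4"
      by (simp add: power2_eq_square algebra_simps)
    then show ?thesis
      using zero_le_power2[of "x + 1 / 2"] by linarith
  qed
  ultimately have "(1 + x + x\<^sup>2) * (1 - x + x\<^sup>2 / 2) \<le> (1 + x + x\<^sup>2) * exp (- x)"
    by (intro mult_left_mono) auto
  moreover have "(1 + x + x\<^sup>2) * (1 - x + x\<^sup>2 / 2) = 1 + x\<^sup>2 / 2 + x\<^sup>2 * (- x) / 2 + x\<^sup>2 * x\<^sup>2 / 2"
    by (simp add: field_simps power2_eq_square)
  moreover have "\<dots> \<ge> 1"
    using False mult_nonneg_nonneg[of "x\<^sup>2" "- x"] mult_nonneg_nonneg[of "x\<^sup>2" "x\<^sup>2"] zero_le_power2[of x] by linarith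
  ultimately have "1 \<le> (1 + x + x\<^sup>2) * exp (- x)"
    by linarith
  then show ?thesis
    by (simp add: exp_minus field_simps)
qed

text \<open>The exponential moment is bounded by conditioning on the first letter.\<close>

lemma exp_moment_bounded_differences:
  assumes "\<And>u i j w. \<bar>f (u @ i # w) - f (u @ j # w)\<bar> \<le> b" and t: "0 \<le> t" "t * b \<le> 1"
  shows "Ew p n (\<lambda>w. exp (t * (f w - Ew p n f))) \<le> exp (real n * (t * b)\<^sup>2)"
  using assms(1)
proof (induction n arbitrary: f)
  case (Suc n)
  \<comment> \<open>The conditional mean given the first letter. It varies with the letter by at
    most \<open>b\<close>, so it stays within \<open>b\<close> of the overall mean
    \<open>m\<close>.\<close>
  define F where "F i = Ew p n (\<lambda>w. f (i # w))" for i
  define m where "m = Ew p (Suc n) f"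
  have m: "m = (\<Sum>i\<in>UNIV. pmf p i * F i)"
    by (simp add: m_def F_def Ew_Suc)
  have b: "b \<ge> 0"
    using Suc.prems[of "[]" undefined "[]" undefined] by simp
  have FF: "\<bar>F i - F j\<bar> \<le> b" for i j
    unfolding F_def using Suc.prems[of "[]"] by (intro Ew_abs_diff_le) simp
  have Fm: "\<bar>F i - m\<bar> \<le> b" for i
  proof -
    have "F i - m = (\<Sum>j\<in>UNIV. pmf p j * (F i - F j))"
      by (simp add: m right_diff_distrib sum_subtractf sum_pmf_eq_1 flip: sum_distrib_right)
    then have "\<bar>F i - m\<bar> \<le> (\<Sum>j\<in>UNIV. \<bar>pmf p j * (F i - F j)\<bar>)"
      by simp
    also have "\<dots> \<le> (\<Sum>j\<in>UNIV. pmf p j * b)"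
      using FF by (intro sum_mono) (simp add: abs_mult mult_left_mono)
    finally show ?thesis
      by (simp add: sum_pmf_eq_1 flip: sum_distrib_right)
  qed
  have IH: "Ew p n (\<lambda>w. exp (t * (f (i # w) - F i))) \<le> exp (real n * (t * b)\<^sup>2)" for i
    unfolding F_def
  proof (rule Suc.IH)
    show "\<bar>f (i # u @ j # w) - f (i # u @ k # w)\<bar> \<le> b" for u j k w
      using Suc.prems[of "i # u"] by simp
  qed
  have "Ew p (Suc n) (\<lambda>w. exp (t * (f w - m)))
      = (\<Sum>i\<in>UNIV. pmf p i * (exp (t * (F i - m)) * Ew p n (\<lambda>w. exp (t * (f (i # w) - F i)))))"
    by (simp add: Ew_Suc algebra_simps flip: exp_add Ew_cmult)
  also have "\<dots> \<le> (\<Sum>i\<in>UNIV. pmf p i * ((1 + t * (F i - m) + (t * b)\<^sup>2) * exp (real n * (t * b)\<^sup>2)))"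
  proof (intro sum_mono mult_left_mono mult_mono)
    fix i
    have abs: "\<bar>t * (F i - m)\<bar> \<le> t * b"
      using Fm t by (simp add: abs_mult mult_left_mono)
    then have "exp (t * (F i - m)) \<le> 1 + t * (F i - m) + (t * (F i - m))\<^sup>2"
      using t by (intro exp_le_quadratic) linarith
    also have "(t * (F i - m))\<^sup>2 \<le> (t * b)\<^sup>2"
      using abs power_mono[of "\<bar>t * (F i - m)\<bar>" "t * b" 2] by simp
    finally show le: "exp (t * (F i - m)) \<le> 1 + t * (F i - m) + (t * b)\<^sup>2"
      by simp
    then show "0 \<le> 1 + t * (F i - m) + (t * b)\<^sup>2"
      using exp_ge_zero order_trans by blast
    show "0 \<le> Ew p n (\<lambda>w. exp (t * (f (i # w) - F i)))"
      unfolding Ew_def by (intro sum_nonneg mult_nonneg_nonneg) auto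
  qed (use IH in auto)
  also have "\<dots> = ((\<Sum>i\<in>UNIV. pmf p i) * (1 + (t * b)\<^sup>2) + t * ((\<Sum>i\<in>UNIV. pmf p i * F i) - (\<Sum>i\<in>UNIV. pmf p i) * m)) * exp (real n * (t * b)\<^sup>2)"
    by (simp add: sum_distrib_left sum_distrib_right sum.distrib sum_subtractf algebra_simps)
  \<comment> \<open>The linear term averages to zero, as \<open>m\<close> is the mean of
    \<open>F\<close>.\<close>
  also have "\<dots> = (1 + (t * b)\<^sup>2) * exp (real n * (t * b)\<^sup>2)"
    by (simp add: sum_pmf_eq_1 m)
  also have "\<dots> \<le> exp ((t * b)\<^sup>2) * exp (real n * (t * b)\<^sup>2)"
    using exp_ge_add_one_self by (intro mult_right_mono) auto
  also have "\<dots> = exp (real (Suc n) * (t * b)\<^sup>2)"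
    by (simp add: algebra_simps flip: exp_add)
  finally show ?case
    unfolding m_def .
qed simp

text \<open>Chernoff's method. The choice of \<open>t\<close> makes t b \<le> 1, as the moment bound
  requires, and t b^2 \<le> \<epsilon> / 2, so that the moment uses up at most half of the exponent.
  Deviations of words of length m \<le> n are measured on the scale n, which permits a union bound
  over m.\<close>

lemma upper_deviation_bounded_differences:
  assumes bd: "\<And>u i j w. \<bar>f (u @ i # w) - f (u @ j # w)\<bar> \<le> b" and "b > 0" "\<epsilon> > 0"
  defines "t \<equiv> min (1 / b) (\<epsilon> / (2 * b\<^sup>2))"
  assumes "m \<le> n"
  shows "Ew p m (\<lambda>w. of_bool (\<epsilon> * real n \<le> f w - Ew p m f)) \<le> exp (- (t * \<epsilon> / 2) * real n)"
proof -
  have t: "t > 0" "t * b \<le> 1" "t * b\<^sup>2 \<le> \<epsilon> / 2"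
  proof -
    show "t > 0"
      using assms by (simp add: t_def)
    have "t \<le> 1 / b" "t \<le> \<epsilon> / (2 * b\<^sup>2)"
      by (simp_all add: t_def)
    then show "t * b \<le> 1" "t * b\<^sup>2 \<le> \<epsilon> / 2"
      using \<open>b > 0\<close> by (simp_all add: field_simps)
  qed
  have "Ew p m (\<lambda>w. of_bool (\<epsilon> * real n \<le> f w - Ew p m f))
      \<le> Ew p m (\<lambda>w. exp (- (t * (\<epsilon> * real n))) * exp (t * (f w - Ew p m f)))"
  proof (rule Ew_mono)
    fix w
    have "1 \<le> exp (t * (f w - Ew p m f) - t * (\<epsilon> * real n))" if "\<epsilon> * real n \<le> f w - Ew p m f"
      using that t(1) by (simp add: mult_left_mono)
    then show "of_bool (\<epsilon> * real n \<le> f w - Ew p m f) \<le> exp (- (t * (\<epsilon> * real n))) * exp (t * (f w - Ew p m f))"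
      by (auto simp flip: exp_add)
  qed
  also have "\<dots> \<le> exp (- (t * (\<epsilon> * real n))) * exp (real m * (t * b)\<^sup>2)"
    unfolding Ew_cmult using t by (intro mult_left_mono exp_moment_bounded_differences bd) auto
  also have "\<dots> \<le> exp (- (t * \<epsilon> / 2) * real n)"
  proof -
    have "real m * (t * b)\<^sup>2 = real m * t * (t * b\<^sup>2)"
      by (simp add: power2_eq_square)
    also have "\<dots> \<le> real n * t * (\<epsilon> / 2)"
      using t \<open>m \<le> n\<close> by (intro mult_mono) auto
    finally show ?thesis
      by (simp add: algebra_simps flip: exp_add)
  qed
  finally show ?thesis .
qed

section \<open>Bernoulli measure: cylinders and integration letter by letter\<close>

definition prepend :: "'i list \<Rightarrow> (nat \<Rightarrow> 'i) \<Rightarrow> nat \<Rightarrow> 'i" where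
  "prepend u \<eta> = foldr case_nat u \<eta>"

lemma prepend_simps [simp]: "prepend [] \<eta> = \<eta>" "prepend (i # u) \<eta> = case_nat i (prepend u \<eta>)"
  by (simp_all add: prepend_def)

abbreviation prefix_of :: "(nat \<Rightarrow> 'i) \<Rightarrow> nat \<Rightarrow> 'i list" where
  "prefix_of \<omega> n \<equiv> map \<omega> [0..<n]"

lemma prefix_of_case_nat [simp]: "prefix_of (case_nat i \<omega>) (Suc n) = i # prefix_of \<omega> n"
  by (simp add: upt_conv_Cons map_Suc_upt[symmetric] del: upt_Suc)

lemma prefix_of_prepend: "prefix_of (prepend u \<eta>) (length u + n) = u @ prefix_of \<eta> n"
  by (induction u) (simp_all del: upt_Suc)

lemma space_bernoulli [simp]: "space (bernoulli_measure p) = UNIV"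
  by (simp add: bernoulli_measure_def space_PiM)

lemma prob_space_bernoulli: "prob_space (bernoulli_measure p)"
  unfolding bernoulli_measure_def by (intro prob_space_PiM) (rule prob_space_measure_pmf)

lemma measurable_coordinate [measurable]: "(\<lambda>\<omega>. \<omega> n) \<in> bernoulli_measure p \<rightarrow>\<^sub>M count_space UNIV"
proof -
  have "(\<lambda>\<omega>. \<omega> n) \<in> (\<Pi>\<^sub>M i\<in>UNIV. measure_pmf p) \<rightarrow>\<^sub>M measure_pmf p"
    by (rule measurable_component_singleton) simp
  then show ?thesis
    unfolding bernoulli_measure_def measurable_cong_sets[OF refl sets_measure_pmf_count_space] .
qed

lemma measurable_prefix_of [measurable]:
  "(\<lambda>\<omega>. prefix_of \<omega> n) \<in> bernoulli_measure (p :: 'i::finite pmf) \<rightarrow>\<^sub>M count_space UNIV"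
proof -
  have single: "{\<omega>. prefix_of \<omega> n = w} \<in> sets (bernoulli_measure p)" for w
  proof (cases "length w = n")
    case True
    have "{\<omega>. prefix_of \<omega> n = w} = {\<omega> \<in> space (bernoulli_measure p). \<forall>i\<in>{..<n}. \<omega> i = w ! i}"
      using True by (auto simp: list_eq_iff_nth_eq)
    also have "\<dots> \<in> sets (bernoulli_measure p)"
    proof (rule sets.sets_Collect_finite_All)
      fix i
      have "(\<lambda>\<omega>. \<omega> i) -` {w ! i} \<inter> space (bernoulli_measure p) \<in> sets (bernoulli_measure p)"
        by (rule measurable_sets[OF measurable_coordinate]) simp
      then show "{\<omega> \<in> space (bernoulli_measure p). \<omega> i = w ! i} \<in> sets (bernoulli_measure p)"
        by (simp add: vimage_def)
    qed auto
    finally show ?thesis .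
  next
    case False
    then have "{\<omega>. prefix_of \<omega> n = w} = {}"
      by auto
    then show ?thesis by simp
  qed
  show ?thesis
  proof (rule measurableI)
    fix X :: "'i list set"
    have "(\<lambda>\<omega>. prefix_of \<omega> n) -` X \<inter> space (bernoulli_measure p)
        = (\<Union>w\<in>X \<inter> {w. length w = n}. {\<omega>. prefix_of \<omega> n = w})"
      by auto
    also have "\<dots> \<in> sets (bernoulli_measure p)"
      by (intro sets.finite_UN single finite_Int disjI2 finite_words)
    finally show "(\<lambda>\<omega>. prefix_of \<omega> n) -` X \<inter> space (bernoulli_measure p) \<in> sets (bernoulli_measure p)" .
  qed simp
qed

lemma measurable_case_nat_bernoulli [measurable]:
  "case_nat i \<in> bernoulli_measure p \<rightarrow>\<^sub>M bernoulli_measure p"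
  unfolding bernoulli_measure_def
proof (rule measurable_PiM_single')
  fix n
  show "(\<lambda>\<omega>. case n of 0 \<Rightarrow> i | Suc n \<Rightarrow> \<omega> n) \<in> (\<Pi>\<^sub>M i\<in>UNIV. measure_pmf p) \<rightarrow>\<^sub>M measure_pmf p"
  proof (cases n)
    case 0
    then show ?thesis by simp
  next
    case (Suc m)
    have "(\<lambda>\<omega>. \<omega> m) \<in> (\<Pi>\<^sub>M i\<in>UNIV. measure_pmf p) \<rightarrow>\<^sub>M measure_pmf p"
      by (rule measurable_component_singleton) simp
    then show ?thesis
      unfolding Suc nat.case .
  qed
qed (auto simp: space_PiM)

lemma measurable_prepend [measurable]:
  "prepend u \<in> bernoulli_measure p \<rightarrow>\<^sub>M bernoulli_measure p"
proof (induction u)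
  case Nil
  have "prepend [] = (\<lambda>\<eta>. \<eta>)"
    by (rule ext) simp
  then show ?case
    by simp
next
  case (Cons i u)
  have "prepend (i # u) = (\<lambda>\<eta>. case_nat i (prepend u \<eta>))"
    by (rule ext) simp
  then show ?case
    using measurable_compose[OF Cons measurable_case_nat_bernoulli] by simp
qed

text \<open>The product measure is the image of letter law times itself under prefixing a letter;
  the rest is Fubini.\<close>

lemma nn_integral_bernoulli_case_nat:
  fixes p :: "'i::finite pmf"
  assumes F [measurable]: "F \<in> borel_measurable (bernoulli_measure p)"
  shows "(\<integral>\<^sup>+\<omega>. F \<omega> \<partial>bernoulli_measure p)
    = (\<Sum>i\<in>UNIV. ennreal (pmf p i) * (\<integral>\<^sup>+\<eta>. F (case_nat i \<eta>) \<partial>bernoulli_measure p))"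
proof -
  interpret sequence_space "measure_pmf p"
    by unfold_locales
  interpret B: prob_space "bernoulli_measure p"
    by (rule prob_space_bernoulli)
  have S: "S = bernoulli_measure p"
    by (simp add: bernoulli_measure_def)
  have meas: "(\<lambda>(s, \<omega>). case_nat s \<omega>) \<in> measure_pmf p \<Otimes>\<^sub>M S \<rightarrow>\<^sub>M S"
    by measurable
  have F': "F \<in> borel_measurable S"
    using F by (simp add: S)
  have "(\<integral>\<^sup>+\<omega>. F \<omega> \<partial>S) = (\<integral>\<^sup>+\<omega>. F \<omega> \<partial>distr (measure_pmf p \<Otimes>\<^sub>M S) S (\<lambda>(s, \<omega>). case_nat s \<omega>))"
    by (simp only: PiM_iter)
  also have "\<dots> = (\<integral>\<^sup>+x. F ((\<lambda>(s, \<omega>). case_nat s \<omega>) x) \<partial>(measure_pmf p \<Otimes>\<^sub>M S))"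
    using F' by (intro nn_integral_distr[OF meas]) simp
  also have "\<dots> = (\<integral>\<^sup>+i. \<integral>\<^sup>+\<eta>. F (case_nat i \<eta>) \<partial>S \<partial>measure_pmf p)"
    unfolding S using measurable_compose[OF meas F', unfolded S]
    by (subst B.nn_integral_fst[symmetric]) simp_all
  \<comment> \<open>The sum over the support extends to all letters, since the others have weight
    zero.\<close>
  also have "\<dots> = (\<Sum>i\<in>UNIV. (\<integral>\<^sup>+\<eta>. F (case_nat i \<eta>) \<partial>S) * ennreal (pmf p i))"
    by (subst nn_integral_measure_pmf_finite) (auto simp: finite_subset[OF subset_UNIV]
        intro!: sum.mono_neutral_left simp: set_pmf_iff)
  finally show ?thesis
    by (simp add: S mult.commute)
qed

lemma nn_integral_bernoulli_prepend:
  fixes p :: "'i::finite pmf"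
  assumes "F \<in> borel_measurable (bernoulli_measure p)"
  shows "(\<integral>\<^sup>+\<omega>. F \<omega> \<partial>bernoulli_measure p)
    = (\<Sum>u | length u = n. ennreal (pword p u) * (\<integral>\<^sup>+\<eta>. F (prepend u \<eta>) \<partial>bernoulli_measure p))"
  using assms
proof (induction n arbitrary: F)
  case (Suc n)
  have "(\<lambda>\<eta>. F (case_nat i \<eta>)) \<in> borel_measurable (bernoulli_measure p)" for i
    by (rule measurable_compose[OF measurable_case_nat_bernoulli Suc.prems])
  then show ?case
    by (simp add: nn_integral_bernoulli_case_nat[OF Suc.prems] Suc.IH sum_words_Suc sum_distrib_left
        ennreal_mult mult.assoc)
qed simp

lemma emeasure_prefix_event:
  fixes p :: "'i::finite pmf"
  shows "emeasure (bernoulli_measure p) {\<omega>. P (prefix_of \<omega> n)} = ennreal (Ew p n (\<lambda>w. of_bool (P w)))"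
proof -
  interpret B: prob_space "bernoulli_measure p"
    by (rule prob_space_bernoulli)
  have [measurable]: "{\<omega>. P (prefix_of \<omega> n)} \<in> sets (bernoulli_measure p)"
  proof -
    have "{\<omega> \<in> space (bernoulli_measure p). P (prefix_of \<omega> n)} \<in> sets (bernoulli_measure p)"
      by measurable
    then show ?thesis by simp
  qed
  have "emeasure (bernoulli_measure p) {\<omega>. P (prefix_of \<omega> n)}
    = (\<integral>\<^sup>+\<omega>. indicator {\<omega>. P (prefix_of \<omega> n)} \<omega> \<partial>bernoulli_measure p)"
    by simp
  also have "\<dots> = (\<Sum>u | length u = n. ennreal (pword p u) *
      (\<integral>\<^sup>+\<eta>. indicator {\<omega>. P (prefix_of \<omega> n)} (prepend u \<eta>) \<partial>bernoulli_measure p))"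
    by (rule nn_integral_bernoulli_prepend) simp
  also have "\<dots> = (\<Sum>u | length u = n. ennreal (pword p u) * ennreal (of_bool (P u)))"
  proof (intro sum.cong refl)
    fix u :: "'i list" assume "u \<in> {u. length u = n}"
    then have "prefix_of (prepend u \<eta>) n = u" for \<eta>
      using prefix_of_prepend[of u \<eta> 0] by simp
    then show "ennreal (pword p u) * (\<integral>\<^sup>+\<eta>. indicator {\<omega>. P (prefix_of \<omega> n)} (prepend u \<eta>) \<partial>bernoulli_measure p)
        = ennreal (pword p u) * ennreal (of_bool (P u))"
      using B.emeasure_space_1 by (cases "P u") (simp_all add: indicator_def)
  qed
  also have "\<dots> = ennreal (Ew p n (\<lambda>w. of_bool (P w)))"
    unfolding Ew_def by (simp add: sum_ennreal flip: ennreal_mult)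
  finally show ?thesis .
qed

section \<open>Almost additive functions of words\<close>

definition almost_additive :: "real \<Rightarrow> ('i list \<Rightarrow> real) \<Rightarrow> bool" where
  "almost_additive c f \<longleftrightarrow> (\<forall>u w. \<bar>f (u @ w) - (f u + f w)\<bar> \<le> c)"

text \<open>A growth rate taken as a limit of expectations; for the logarithms of the singular
  values it is minus a Lyapunov exponent.\<close>

definition mean_rate :: "'i::finite pmf \<Rightarrow> ('i list \<Rightarrow> real) \<Rightarrow> real" where
  "mean_rate p f = lim (\<lambda>n. Ew p n f / real n)"

lemma almost_additiveD: "almost_additive c f \<Longrightarrow> \<bar>f (u @ w) - (f u + f w)\<bar> \<le> c"
  by (simp add: almost_additive_def)

lemma almost_additive_minus: "almost_additive c f \<Longrightarrow> almost_additive c (\<lambda>w. - f w)"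
  by (simp add: almost_additive_def abs_le_iff algebra_simps)

lemma Ew_almost_additive:
  assumes "almost_additive c f"
  shows "\<bar>Ew p (m + n) f - (Ew p m f + Ew p n f)\<bar> \<le> c"
proof -
  have "\<bar>Ew p m (\<lambda>u. Ew p n (\<lambda>w. f (u @ w))) - Ew p m (\<lambda>u. Ew p n (\<lambda>w. f u + f w))\<bar> \<le> c"
    using almost_additiveD[OF assms] by (intro Ew_abs_diff_le)
  then show ?thesis
    by (simp add: Ew_append Ew_add Ew_const)
qed

text \<open>Comparing the averages over \<open>m\<close>, \<open>n\<close> and \<open>m n\<close> letters shows that they form a Cauchy
  sequence with explicit rate.\<close>

lemma mean_rate_bound:
  assumes "almost_additive c f"
  shows "\<bar>Ew p n f - real n * mean_rate p f\<bar> \<le> c"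
proof -
  define a where "a n = Ew p n f" for n
  have add: "\<bar>a (m + n) - (a m + a n)\<bar> \<le> c" for m n
    unfolding a_def by (rule Ew_almost_additive[OF assms])
  have c: "c \<ge> 0"
    using add[of 0 0] by linarith
  have mult: "\<bar>a (k * n) - real k * a n\<bar> \<le> (real k + 1) * c" for k n
  proof (induction k)
    case (Suc k)
    then show ?case
      using add[of n "k * n"] by (simp add: algebra_simps abs_le_iff)
  qed (use add[of 0 0] in auto)
  have cross: "\<bar>a n / real n - a m / real m\<bar> \<le> 2 * c / real n + 2 * c / real m" if "n > 0" "m > 0" for m n
  proof -
    have "\<bar>real m * a n - real n * a m\<bar> \<le> (real m + 1) * c + (real n + 1) * c"
      using mult[of m n] mult[of n m] by (simp add: mult.commute[of n m] abs_le_iff)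
    also have "\<dots> \<le> 2 * c * real m + 2 * c * real n"
    proof -
      have "1 * c \<le> real m * c" "1 * c \<le> real n * c"
        using that c by (intro mult_right_mono; simp)+
      then show ?thesis by (simp add: algebra_simps)
    qed
    finally have "\<bar>real m * a n - real n * a m\<bar> / (real m * real n) \<le> (2 * c * real m + 2 * c * real n) / (real m * real n)"
      using that by (intro divide_right_mono) auto
    moreover have "\<bar>real m * a n - real n * a m\<bar> / (real m * real n) = \<bar>a n / real n - a m / real m\<bar>"
    proof -
      have "a n / real n - a m / real m = (real m * a n - real n * a m) / (real m * real n)"
        using that by (simp add: field_simps)
      then show ?thesis
        by (simp add: abs_divide)
    qed
    moreover have "(2 * c * real m + 2 * c * real n) / (real m * real n) = 2 * c / real n + 2 * c / real m"
      using that by (simp add: field_simps)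
    ultimately show ?thesis by simp
  qed
  have "Cauchy (\<lambda>n. a n / real n)"
  proof (rule metric_CauchyI)
    fix e :: real assume e: "e > 0"
    obtain M where M: "4 * c / e < real M"
      using reals_Archimedean2 by blast
    have "dist (a m / real m) (a n / real n) < e" if "m \<ge> Suc M" "n \<ge> Suc M" for m n
    proof -
      have bound: "2 * c / real k < e / 2" if "k \<ge> Suc M" for k
      proof -
        have "4 * c / e < real k"
          using M that by linarith
        then show ?thesis
          using e that by (simp add: field_simps)
      qed
      show ?thesis
        using cross[of m n] bound[OF that(1)] bound[OF that(2)] that by (simp add: dist_real_def)
    qed
    then show "\<exists>M. \<forall>m\<ge>M. \<forall>n\<ge>M. dist (a m / real m) (a n / real n) < e"
      by blast
  qed
  then have lim: "(\<lambda>n. a n / real n) \<longlonglongrightarrow> mean_rate p f"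
    unfolding mean_rate_def a_def by (simp add: Cauchy_convergent_iff convergent_LIMSEQ_iff)
  show ?thesis
  proof (cases "n = 0")
    case True
    then show ?thesis
      using add[of 0 0] by (simp add: a_def)
  next
    case False
    \<comment> \<open>Along the multiples of \<open>n\<close> the error is at most c + c / (k + 1),
      so exactly \<open>c\<close> survives in the limit.\<close>
    have "(\<lambda>k. \<bar>a n - real n * (a (Suc k * n) / real (Suc k * n))\<bar>) \<longlonglongrightarrow> \<bar>a n - real n * mean_rate p f\<bar>"
    proof (intro tendsto_intros filterlim_compose[OF lim])
      show "filterlim (\<lambda>k. Suc k * n) at_top sequentially"
        using False by (intro filterlim_subseq strict_monoI) simp
    qed
    moreover have "\<bar>a n - real n * (a (Suc k * n) / real (Suc k * n))\<bar> \<le> c + c / real (Suc k)" for k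
    proof -
      have "a n - real n * (a (Suc k * n) / real (Suc k * n)) = (real (Suc k) * a n - a (Suc k * n)) / real (Suc k)"
      proof -
        have "x - q * (y / (s * q)) = (s * x - y) / s" if "s \<noteq> 0" "q \<noteq> 0" for x y s q :: real
          using that by (simp add: field_simps)
        from this[of "real (Suc k)" "real n"] show ?thesis
          unfolding of_nat_mult using False by simp
      qed
      also have "\<bar>\<dots>\<bar> \<le> (real (Suc k) + 1) * c / real (Suc k)"
        using mult[of "Suc k" n] by (simp add: abs_divide abs_minus_commute divide_right_mono)
      also have "\<dots> = c + c / real (Suc k)"
        by (simp add: field_simps)
      finally show ?thesis .
    qed
    moreover have "(\<lambda>k. c + c / real (Suc k)) \<longlonglongrightarrow> c + 0"
      by (intro tendsto_intros LIMSEQ_Suc lim_const_over_n)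
    ultimately show ?thesis
      unfolding a_def[symmetric] by (intro LIMSEQ_le[of _ _ "\<lambda>k. c + c / real (Suc k)" c]) auto
  qed
qed

lemma mean_rate_eqI:
  assumes "almost_additive c f" "\<And>n. \<bar>Ew p n f - real n * r\<bar> \<le> C"
  shows "mean_rate p f = r"
proof (rule ccontr)
  assume "mean_rate p f \<noteq> r"
  then have pos: "\<bar>mean_rate p f - r\<bar> > 0"
    by simp
  obtain n where "(C + c) / \<bar>mean_rate p f - r\<bar> < real n"
    using reals_Archimedean2 by blast
  then have "C + c < real n * \<bar>mean_rate p f - r\<bar>"
    using pos by (simp add: pos_divide_less_eq)
  also have "\<dots> = \<bar>real n * mean_rate p f - real n * r\<bar>"
    by (simp add: abs_mult flip: right_diff_distrib)
  also have "\<dots> \<le> C + c"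
    using assms(2)[of n] mean_rate_bound[OF assms(1), of p n] by linarith
  finally show False by simp
qed

lemma mean_rate_minus:
  assumes "almost_additive c f"
  shows "mean_rate p (\<lambda>w. - f w) = - mean_rate p f"
proof (rule mean_rate_eqI[OF almost_additive_minus[OF assms]])
  show "\<bar>Ew p n (\<lambda>w. - f w) - real n * - mean_rate p f\<bar> \<le> c" for n
    using mean_rate_bound[OF assms, of p n] by (simp add: Ew_minus)
qed

lemma almost_additive_bounded_differences:
  fixes f :: "'i::finite list \<Rightarrow> real"
  assumes "almost_additive c f"
  shows "\<exists>b>0. \<forall>u i j w. \<bar>f (u @ i # w) - f (u @ j # w)\<bar> \<le> b"
proof -
  define K where "K = (\<Sum>i\<in>UNIV. \<bar>f [i]\<bar>)"
  have K: "\<bar>f [i]\<bar> \<le> K" for i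
    unfolding K_def by (rule member_le_sum) auto
  have c: "c \<ge> 0"
    using almost_additiveD[OF assms, of "[]" "[]"] by linarith
  \<comment> \<open>Cutting both words before and after the changed letter costs 4c, and the two
    single letters at most 2K; the 1 makes the bound positive.\<close>
  have "\<bar>f (u @ i # w) - f (u @ j # w)\<bar> \<le> 4 * c + 2 * K + 1" for u i j w
    using almost_additiveD[OF assms, of u "i # w"] almost_additiveD[OF assms, of u "j # w"]
      almost_additiveD[OF assms, of "[i]" w] almost_additiveD[OF assms, of "[j]" w] K[of i] K[of j]
    by simp
  moreover have "4 * c + 2 * K + 1 > 0"
    using c K[of undefined] by linarith
  ultimately show ?thesis by blast
qed

text \<open>Borel-Cantelli over n, with a union over the n + 1 lengths m \<le> n. Half of \<epsilon>
  goes to the deviation from the expectation, half to the bounded gap between expectation and m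
  times the rate. Uniformity in m is needed because pairs of codings may split anywhere.\<close>

lemma upper_deviation_almost_additive:
  fixes f :: "'i::finite list \<Rightarrow> real"
  assumes f: "almost_additive c f" and "\<epsilon> > 0"
  shows "AE \<omega> in bernoulli_measure p. \<forall>\<^sub>F n in sequentially. \<forall>m\<le>n.
    f (prefix_of \<omega> m) - real m * mean_rate p f \<le> \<epsilon> * real n"
proof -
  interpret B: prob_space "bernoulli_measure p"
    by (rule prob_space_bernoulli)
  obtain b where b: "b > 0" "\<And>u i j w. \<bar>f (u @ i # w) - f (u @ j # w)\<bar> \<le> b"
    using almost_additive_bounded_differences[OF f] by blast
  \<comment> \<open>The rate t \<epsilon> / 2 of the deviation bound, with \<epsilon> / 2 in place
    of \<epsilon>.\<close>
  define \<delta> where "\<delta> = min (1 / b) ((\<epsilon> / 2) / (2 * b\<^sup>2)) * (\<epsilon> / 2) / 2"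
  have \<delta>: "\<delta> > 0"
    using b \<open>\<epsilon> > 0\<close> by (simp add: \<delta>_def)
  define X where "X n m = {\<omega>. \<epsilon> / 2 * real n \<le> f (prefix_of \<omega> m) - Ew p m f}" for n m
  define Y where "Y n = (\<Union>m\<in>{..n}. X n m)" for n
  have X [measurable]: "X n m \<in> sets (bernoulli_measure p)" for n m
  proof -
    have "{\<omega> \<in> space (bernoulli_measure p). \<epsilon> / 2 * real n \<le> f (prefix_of \<omega> m) - Ew p m f} \<in> sets (bernoulli_measure p)"
      by measurable
    then show ?thesis by (simp add: X_def)
  qed
  have Y [measurable]: "Y n \<in> sets (bernoulli_measure p)" for n
    unfolding Y_def by measurable
  have "measure (bernoulli_measure p) (X n m) \<le> exp (- \<delta> * real n)" if "m \<le> n" for n m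
  proof -
    have "emeasure (bernoulli_measure p) (X n m) \<le> ennreal (exp (- \<delta> * real n))"
      unfolding X_def emeasure_prefix_event[where P = "\<lambda>w. \<epsilon> / 2 * real n \<le> f w - Ew p m f"]
      using upper_deviation_bounded_differences[where f = f and p = p and \<epsilon> = "\<epsilon> / 2", OF b(2,1) _ that] \<open>\<epsilon> > 0\<close>
      by (intro ennreal_leI) (simp add: \<delta>_def)
    then show ?thesis
      unfolding B.emeasure_eq_measure by simp
  qed
  then have Y_le: "measure (bernoulli_measure p) (Y n) \<le> real (Suc n) * exp (- \<delta>) ^ n" for n
  proof -
    have "measure (bernoulli_measure p) (Y n) \<le> (\<Sum>m\<in>{..n}. measure (bernoulli_measure p) (X n m))"
      unfolding Y_def by (rule B.finite_measure_subadditive_finite) auto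
    also have "\<dots> \<le> (\<Sum>m\<in>{..n}. exp (- \<delta> * real n))"
      using \<open>\<And>n m. m \<le> n \<Longrightarrow> _\<close> by (intro sum_mono) auto
    finally show ?thesis
      by (simp add: mult.commute flip: exp_of_nat_mult)
  qed
  have "summable (\<lambda>n. real (Suc n) * exp (- \<delta>) ^ n)"
    using geometric_deriv_sums[of "exp (- \<delta>)"] \<delta> by (simp add: sums_iff)
  then have "summable (\<lambda>n. measure (bernoulli_measure p) (Y n))"
    by (rule summable_comparison_test'[where N = 0]) (use Y_le in \<open>simp del: of_nat_Suc\<close>)
  then have ev: "AE \<omega> in bernoulli_measure p. \<forall>\<^sub>F n in sequentially. \<omega> \<in> space (bernoulli_measure p) - Y n"
    by (intro borel_cantelli_AE1) (auto simp: B.emeasure_eq_measure)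
  have large: "\<forall>\<^sub>F n in sequentially. c \<le> \<epsilon> / 2 * real n"
  proof -
    obtain n0 where n0: "c / (\<epsilon> / 2) < real n0"
      using reals_Archimedean2 by blast
    have "c \<le> \<epsilon> / 2 * real n" if "n \<ge> n0" for n
    proof -
      have "c \<le> \<epsilon> / 2 * real n0"
        using n0 \<open>\<epsilon> > 0\<close> by (simp add: pos_divide_less_eq mult.commute)
      also have "\<dots> \<le> \<epsilon> / 2 * real n"
        using that \<open>\<epsilon> > 0\<close> by (intro mult_left_mono) auto
      finally show ?thesis .
    qed
    then show ?thesis
      unfolding eventually_sequentially by blast
  qed
  from ev show ?thesis
  proof eventually_elim
    case (elim \<omega>)
    from large elim show ?case
    proof (eventually_elim, intro allI impI)
      fix n m assume "c \<le> \<epsilon> / 2 * real n" "\<omega> \<in> space (bernoulli_measure p) - Y n" "m \<le> n"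
      then have "f (prefix_of \<omega> m) - Ew p m f \<le> \<epsilon> / 2 * real n"
        by (auto simp: Y_def X_def not_le intro: less_imp_le)
      then show "f (prefix_of \<omega> m) - real m * mean_rate p f \<le> \<epsilon> * real n"
        using mean_rate_bound[OF f, of p m] \<open>c \<le> \<epsilon> / 2 * real n\<close> by (simp add: algebra_simps)
    qed
  qed
qed

lemma deviation_almost_additive:
  fixes f :: "'i::finite list \<Rightarrow> real"
  assumes f: "almost_additive c f" and "\<epsilon> > 0"
  shows "AE \<omega> in bernoulli_measure p. \<forall>\<^sub>F n in sequentially. \<forall>m\<le>n.
    \<bar>f (prefix_of \<omega> m) - real m * mean_rate p f\<bar> \<le> \<epsilon> * real n"
  using upper_deviation_almost_additive[OF f \<open>\<epsilon> > 0\<close>, of p]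
    upper_deviation_almost_additive[OF almost_additive_minus[OF f] \<open>\<epsilon> > 0\<close>, of p]
proof eventually_elim
  case (elim \<omega>)
  then show ?case
    by eventually_elim (auto simp: abs_le_iff mean_rate_minus[OF f])
qed

lemma AE_tendsto_mean_rate:
  fixes f :: "'i::finite list \<Rightarrow> real"
  assumes f: "almost_additive c f"
  shows "AE \<omega> in bernoulli_measure p. (\<lambda>n. f (prefix_of \<omega> n) / real n) \<longlonglongrightarrow> mean_rate p f"
proof -
  have "AE \<omega> in bernoulli_measure p. \<forall>k. \<forall>\<^sub>F n in sequentially. \<forall>m\<le>n.
      \<bar>f (prefix_of \<omega> m) - real m * mean_rate p f\<bar> \<le> 1 / real (Suc k) * real n"
    unfolding AE_all_countable by (intro allI deviation_almost_additive[OF f]) simp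
  then show ?thesis
  proof eventually_elim
    case (elim \<omega>)
    show ?case
    proof (rule tendstoI)
      fix e :: real assume "e > 0"
      then obtain k where k: "1 / real (Suc k) < e"
        using nat_approx_posE by blast
      from elim[rule_format, of k] eventually_gt_at_top[of 0]
      show "\<forall>\<^sub>F n in sequentially. dist (f (prefix_of \<omega> n) / real n) (mean_rate p f) < e"
      proof eventually_elim
        case (elim n)
        have "\<bar>f (prefix_of \<omega> n) - real n * mean_rate p f\<bar> < e * real n"
          using elim(1)[rule_format, of n] mult_strict_right_mono[OF k, of "real n"] elim(2) by simp
        moreover have "f (prefix_of \<omega> n) / real n - mean_rate p f = (f (prefix_of \<omega> n) - real n * mean_rate p f) / real n"
          using elim(2) by (simp add: field_simps)
        ultimately show ?case
          using elim(2) by (simp add: dist_real_def abs_divide pos_divide_less_eq)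
      qed
    qed
  qed
qed

section \<open>Lyapunov exponents and the counting estimate\<close>

lemma additive_sum_list: "almost_additive 0 (\<lambda>w. sum_list (map g w))"
  by (simp add: almost_additive_def)

lemma mean_rate_sum_list:
  "mean_rate p (\<lambda>w. sum_list (map g w)) = (\<Sum>i\<in>UNIV. pmf p i * g i)"
proof -
  have "Ew p 1 (\<lambda>w. sum_list (map g w)) = (\<Sum>i\<in>UNIV. pmf p i * g i)"
    by (simp add: Ew_Suc One_nat_def del: One_nat_def[symmetric])
  then show ?thesis
    using mean_rate_bound[OF additive_sum_list, of p 1 g] by simp
qed

text \<open>The description is well defined: the limit exists almost surely, and on a probability
  space two almost sure constants coincide.\<close>

lemma the_exponent_eq:
  fixes f :: "'i::finite list \<Rightarrow> real"
  assumes "almost_additive c f"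
  shows "(THE x. AE \<omega> in bernoulli_measure p. (\<lambda>n. f (prefix_of \<omega> n) / real n) \<longlonglongrightarrow> - x) = - mean_rate p f"
proof (rule the_equality)
  show "AE \<omega> in bernoulli_measure p. (\<lambda>n. f (prefix_of \<omega> n) / real n) \<longlonglongrightarrow> - (- mean_rate p f)"
    using AE_tendsto_mean_rate[OF assms] by simp
next
  interpret B: prob_space "bernoulli_measure p"
    by (rule prob_space_bernoulli)
  fix x assume "AE \<omega> in bernoulli_measure p. (\<lambda>n. f (prefix_of \<omega> n) / real n) \<longlonglongrightarrow> - x"
  with AE_tendsto_mean_rate[OF assms, of p]
  have "AE \<omega> in bernoulli_measure p. mean_rate p f = - x"
    by eventually_elim (rule LIMSEQ_unique)
  then show "x = - mean_rate p f"
    by simp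
qed

lemma nonpos_if_multiples_bounded:
  assumes "\<And>n. real n * x \<le> C"
  shows "x \<le> (0 :: real)"
proof (rule ccontr)
  assume "\<not> ?thesis"
  then obtain n where "C < real n * x"
    using reals_Archimedean3[of x] by auto
  with assms[of n] show False by simp
qed

lemma mean_rate_mono:
  assumes "almost_additive c f" "almost_additive c' g" "\<And>w. f w \<le> g w"
  shows "mean_rate p f \<le> mean_rate p g"
proof -
  have "real n * (mean_rate p f - mean_rate p g) \<le> c + c'" for n
  proof -
    have "Ew p n f \<le> Ew p n g"
      using assms(3) by (rule Ew_mono)
    then show ?thesis
      using mean_rate_bound[OF assms(1), of p n] mean_rate_bound[OF assms(2), of p n]
      by (simp add: right_diff_distrib)
  qed
  then show ?thesis
    using nonpos_if_multiples_bounded by fastforce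
qed

lemma almost_additive_cmult: "almost_additive c f \<Longrightarrow> almost_additive (\<bar>a\<bar> * c) (\<lambda>w. a * f w)"
  unfolding almost_additive_def by (simp add: abs_mult mult_left_mono flip: distrib_left right_diff_distrib)

lemma mean_rate_cmult:
  assumes "almost_additive c f"
  shows "mean_rate p (\<lambda>w. a * f w) = a * mean_rate p f"
proof (rule mean_rate_eqI[OF almost_additive_cmult[OF assms]])
  show "\<bar>Ew p n (\<lambda>w. a * f w) - real n * (a * mean_rate p f)\<bar> \<le> \<bar>a\<bar> * c" for n
  proof -
    have "Ew p n (\<lambda>w. a * f w) - real n * (a * mean_rate p f) = a * (Ew p n f - real n * mean_rate p f)"
      by (simp add: Ew_cmult algebra_simps)
    then show ?thesis
      using mean_rate_bound[OF assms, of p n] by (simp add: abs_mult mult_left_mono)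
  qed
qed

text \<open>Logarithms are taken letter by letter: since ln 0 = 0, the logarithm of
  \<open>pword\<close> would not be additive on words with a letter of probability zero.\<close>

definition log_pword :: "'i::finite pmf \<Rightarrow> 'i list \<Rightarrow> real" where
  "log_pword p w = sum_list (map (\<lambda>i. ln (pmf p i)) w)"

lemma log_pword_append: "log_pword p (u @ w) = log_pword p u + log_pword p w"
  by (simp add: log_pword_def)

lemma additive_log_pword: "almost_additive 0 (log_pword p)"
  unfolding log_pword_def by (rule additive_sum_list)

lemma mean_rate_log_pword: "mean_rate p (log_pword p) = - bernoulli_entropy p"
  unfolding log_pword_def by (simp add: mean_rate_sum_list bernoulli_entropy_def)

lemma pword_eq_exp: "pword p w \<noteq> 0 \<Longrightarrow> pword p w = exp (log_pword p w)"
  by (induction w) (simp_all add: log_pword_def exp_add pmf_pos)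

lemma pword_le_exp: "pword p w \<le> exp (log_pword p w)"
  using pword_eq_exp[of p w] by (cases "pword p w = 0") auto

text \<open>Nonnegativity of the relative entropy of the word distribution with respect to the
  weights q / K of total mass at most 1, from ln x \<le> x - 1.\<close>

lemma gibbs_inequality_words:
  assumes q: "\<And>w. q w > 0" and K: "(\<Sum>w | length w = n. q w) \<le> K"
  shows "Ew p n (\<lambda>w. ln (q w)) - Ew p n (log_pword p) \<le> ln K"
proof -
  have "(\<Sum>w | length w = n. q w) > 0"
    using q by (intro sum_pos) (auto intro: exI[of _ "replicate n undefined"])
  then have "K > 0"
    using K by linarith
  have "Ew p n (\<lambda>w. ln (q w) - log_pword p w - ln K) \<le> (\<Sum>w | length w = n. q w / K - pword p w)"
    unfolding Ew_def
  proof (rule sum_mono)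
    fix w
    show "pword p w * (ln (q w) - log_pword p w - ln K) \<le> q w / K - pword p w"
    proof (cases "pword p w = 0")
      case False
      then have pos: "pword p w > 0"
        using pword_nonneg[of p w] by linarith
      have "ln (pword p w) = log_pword p w"
        using pword_eq_exp[OF False] by (metis ln_exp)
      then have "ln (q w) - log_pword p w - ln K = ln (q w / K / pword p w)"
        using q[of w] \<open>K > 0\<close> pos by (simp add: ln_div ln_mult)
      also have "\<dots> \<le> q w / K / pword p w - 1"
        using q[of w] \<open>K > 0\<close> pos by (intro ln_le_minus_one) simp
      finally have "pword p w * (ln (q w) - log_pword p w - ln K) \<le> pword p w * (q w / K / pword p w - 1)"
        using pos by (intro mult_left_mono) auto
      also have "\<dots> = q w / K - pword p w"
        using pos by (simp add: field_simps)
      finally show ?thesis .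
    qed (use q[of w] \<open>K > 0\<close> in simp)
  qed
  also have "\<dots> \<le> 0"
  proof -
    have "(\<Sum>w | length w = n. pword p w) = 1"
      using Ew_const[of p n 1] by (simp add: Ew_def)
    then show ?thesis
      using K \<open>K > 0\<close> by (simp add: sum_subtractf flip: sum_divide_distrib)
  qed
  finally show ?thesis
    by (simp add: Ew_diff Ew_const)
qed

section \<open>Singular values of word products as almost additive functions\<close>

context projective_ifs
begin

lemma N_nonzero [simp]: "N w \<noteq> 0" and D_nonzero [simp]: "D w \<noteq> 0"
  using N_pos[of w] D_pos[of w] by auto

lemma almost_additive_ln_N: "almost_additive (ln (\<kappa>\<^sup>2)) (\<lambda>w. ln (N w))"
  unfolding almost_additive_def
proof (intro allI)
  fix u w
  have "ln (N (u @ w)) \<le> ln (N u * N w)"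
    using N_append_le N_pos by (subst ln_le_cancel_iff) auto
  moreover have "ln (N u * N w) \<le> ln (\<kappa>\<^sup>2 * N (u @ w))"
    using N_append_ge N_pos kappa_ge_1 by (subst ln_le_cancel_iff) auto
  ultimately show "\<bar>ln (N (u @ w)) - (ln (N u) + ln (N w))\<bar> \<le> ln (\<kappa>\<^sup>2)"
    using N_pos kappa_ge_1 ln_ge_zero[of "\<kappa>\<^sup>2"] by (simp add: ln_mult)
qed

lemma almost_additive_ln_D: "almost_additive 0 (\<lambda>w. ln (D w))"
  using D_pos by (simp add: almost_additive_def D_append ln_mult)

lemma alpha1_word_prod: "alpha1 (word_prod A w) = N w"
  by (simp add: alpha1_eq_onorm N_def)

lemma alpha2_word_prod: "alpha2 (word_prod A w) = D w / N w"
  using alpha1_mult_alpha2[of "word_prod A w"] N_pos[of w]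
  by (simp add: alpha1_word_prod D_def field_simps)

end

text \<open>\<open>bunched\<close> is the 1-bunched condition multiplied by the larger singular
  value; in this form it passes from letters to words.\<close>

locale bunched_bernoulli_ifs = projective_ifs A V W e \<kappa> \<rho>
  for A :: "'i::finite \<Rightarrow> real^2^2" and V W :: "(real^2) set" and e :: "real^2" and \<kappa> \<rho> :: real +
  fixes p :: "'i pmf"
  assumes contracting: "\<And>i. onorm ((*v) (A i)) < 1"
    and bunched: "\<And>i. onorm ((*v) (A i)) ^ 3 \<le> \<bar>det (A i)\<bar>"
begin

definition \<gamma> :: real where "\<gamma> = - mean_rate p (\<lambda>w. ln (N w))"
text \<open>The sum of both Lyapunov exponents; \<gamma> is the smaller one, so the larger is d -
  \<gamma>.\<close>

definition d :: real where "d = - mean_rate p (\<lambda>w. ln (D w))"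
definition h :: real where "h = bernoulli_entropy p"

lemma lyapunov_s_eq: "lyapunov_s A p = \<gamma>"
  unfolding lyapunov_s_def \<gamma>_def alpha1_word_prod by (rule the_exponent_eq[OF almost_additive_ln_N])

lemma almost_additive_ln_alpha2: "almost_additive (ln (\<kappa>\<^sup>2)) (\<lambda>w. ln (D w / N w))"
proof -
  have "ln (D w / N w) = ln (D w) - ln (N w)" for w
    using D_pos N_pos by (simp add: ln_div)
  moreover have "\<bar>a1 + a2 - n - (a1 - n1 + (a2 - n2))\<bar> = \<bar>n - (n1 + n2)\<bar>" for a1 a2 n n1 n2 :: real
    by simp
  ultimately show ?thesis
    using almost_additive_ln_N D_pos by (simp add: almost_additive_def D_append ln_mult)
qed

lemma lyapunov_ss_eq: "lyapunov_ss A p = d - \<gamma>"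
proof -
  have "lyapunov_ss A p = - mean_rate p (\<lambda>w. ln (D w / N w))"
    unfolding lyapunov_ss_def alpha2_word_prod by (rule the_exponent_eq[OF almost_additive_ln_alpha2])
  moreover have "mean_rate p (\<lambda>w. ln (D w / N w)) = - d + \<gamma>"
  proof (rule mean_rate_eqI[OF almost_additive_ln_alpha2])
    fix n
    have "Ew p n (\<lambda>w. ln (D w / N w)) = Ew p n (\<lambda>w. ln (D w)) - Ew p n (\<lambda>w. ln (N w))"
      unfolding Ew_diff[symmetric] using D_pos N_pos by (intro Ew_cong) (simp add: ln_div)
    then show "\<bar>Ew p n (\<lambda>w. ln (D w / N w)) - real n * (- d + \<gamma>)\<bar> \<le> ln (\<kappa>\<^sup>2)"
      using mean_rate_bound[OF almost_additive_ln_N, of p n] mean_rate_bound[OF almost_additive_ln_D, of p n]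
      by (simp add: d_def \<gamma>_def algebra_simps)
  qed
  ultimately show ?thesis by simp
qed

lemma \<gamma>_pos: "\<gamma> > 0"
proof -
  define k where "k = Max (range (\<lambda>i. onorm ((*v) (A i))))"
  have k: "k < 1" "onorm ((*v) (A i)) \<le> k" for i
    unfolding k_def using contracting by (auto simp: Max_less_iff)
  have k0: "k > 0"
    using k(2)[of undefined] onorm_pos_if_invertible[OF invertible, of undefined] by linarith
  have "N w \<le> k ^ length w" for w
  proof (induction w)
    case (Cons i w)
    have "N (i # w) \<le> N [i] * N w"
      using N_append_le[of "[i]" w] by simp
    also have "\<dots> \<le> k * k ^ length w"
      using k(2)[of i] Cons k0 N_pos[of w] by (intro mult_mono) (auto simp: N_def)
    finally show ?case by simp
  qed simp
  then have "ln (N w) \<le> sum_list (map (\<lambda>_. ln k) w)" for w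
    using N_pos[of w] k0 by (simp add: sum_list_triv flip: ln_realpow)
  then have "mean_rate p (\<lambda>w. ln (N w)) \<le> mean_rate p (\<lambda>w. sum_list (map (\<lambda>_. ln k) w))"
    by (rule mean_rate_mono[OF almost_additive_ln_N additive_sum_list])
  also have "\<dots> = ln k"
    by (simp add: mean_rate_sum_list sum_pmf_eq_1 flip: sum_distrib_right)
  also have "\<dots> < 0"
    using k(1) k0 by simp
  finally show ?thesis
    by (simp add: \<gamma>_def)
qed

lemma two_\<gamma>_le_d: "2 * \<gamma> \<le> d"
proof -
  have "ln (D w) \<le> 2 * ln (N w)" for w
  proof -
    have "ln (D w) \<le> ln ((N w)\<^sup>2)"
      using D_le_N_squared[of w] D_pos[of w] N_pos[of w] by (subst ln_le_cancel_iff) auto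
    then show ?thesis
      using N_pos[of w] by (simp add: ln_realpow)
  qed
  then have "mean_rate p (\<lambda>w. ln (D w)) \<le> mean_rate p (\<lambda>w. 2 * ln (N w))"
    by (rule mean_rate_mono[OF almost_additive_ln_D almost_additive_cmult[OF almost_additive_ln_N]])
  then show ?thesis
    unfolding mean_rate_cmult[OF almost_additive_ln_N] by (simp add: d_def \<gamma>_def)
qed

text \<open>The norm is submultiplicative and the determinant multiplicative, so the cubic
  inequality for letters holds for all words. In terms of exponents it says chi_ss \<le> 2
  chi_s.\<close>

lemma d_le_three_\<gamma>: "d \<le> 3 * \<gamma>"
proof -
  have cube: "N w ^ 3 \<le> D w" for w
  proof (induction w)
    case (Cons i w)
    have "N (i # w) ^ 3 \<le> (N [i] * N w) ^ 3"
      using N_append_le[of "[i]" w] N_pos[of "i # w"] by (intro power_mono) auto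
    also have "\<dots> \<le> D [i] * D w"
      unfolding power_mult_distrib using Cons bunched[of i] D_pos[of "[i]"] N_pos[of w]
      by (intro mult_mono) (auto simp: N_def D_def)
    finally show ?case
      using D_append[of "[i]" w] by simp
  qed simp
  have "3 * ln (N w) \<le> ln (D w)" for w
  proof -
    have "ln (N w ^ 3) \<le> ln (D w)"
      using cube[of w] D_pos[of w] N_pos[of w] by (subst ln_le_cancel_iff) auto
    then show ?thesis
      using N_pos[of w] by (simp add: ln_realpow)
  qed
  then have "mean_rate p (\<lambda>w. 3 * ln (N w)) \<le> mean_rate p (\<lambda>w. ln (D w))"
    by (rule mean_rate_mono[OF almost_additive_cmult[OF almost_additive_ln_N] almost_additive_ln_D])
  then show ?thesis
    unfolding mean_rate_cmult[OF almost_additive_ln_N] by (simp add: d_def \<gamma>_def)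
qed

text \<open>Gibbs' inequality with the weights \<open>D w / (N w)\<^sup>2\<close>: their sums are
  bounded uniformly in n by packing, and their logarithms have rate -(d - 2\<gamma>).\<close>

lemma h_le_d_minus: "h \<le> d - 2 * \<gamma>"
proof -
  define K where "K = 16 * \<kappa>\<^sup>2 / measure lebesgue (ball e \<rho>)"
  have "real n * (h - (d - 2 * \<gamma>)) \<le> ln K + 2 * ln (\<kappa>\<^sup>2)" for n
  proof -
    have "Ew p n (\<lambda>w. ln (D w / (N w)\<^sup>2)) - Ew p n (log_pword p) \<le> ln K"
      unfolding K_def using D_pos N_pos by (intro gibbs_inequality_words sum_D_over_N_squared_le) simp
    moreover have "Ew p n (\<lambda>w. ln (D w / (N w)\<^sup>2)) = Ew p n (\<lambda>w. ln (D w)) - 2 * Ew p n (\<lambda>w. ln (N w))"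
      unfolding Ew_diff[symmetric] Ew_cmult[symmetric] using D_pos N_pos
      by (intro Ew_cong) (simp add: ln_div ln_realpow)
    ultimately show ?thesis
      using mean_rate_bound[OF almost_additive_ln_N, of p n] mean_rate_bound[OF almost_additive_ln_D, of p n]
        mean_rate_bound[OF additive_log_pword[of p], of p n]
      by (simp add: d_def \<gamma>_def h_def mean_rate_log_pword algebra_simps)
  qed
  then show ?thesis
    using nonpos_if_multiples_bounded by fastforce
qed

lemma h_le_\<gamma>: "h \<le> \<gamma>"
  using h_le_d_minus d_le_three_\<gamma> by linarith

text \<open>As h - \<gamma> \<le> 0 and d - \<gamma> \<ge> \<gamma>, the third entry of the minimum
  is at least 1 + (h - \<gamma>) / \<gamma> = h / \<gamma>.\<close>

lemma lyapunov_dim_eq: "lyapunov_dim A p = h / \<gamma>" and h_over_\<gamma>_le_1: "h / \<gamma> \<le> 1"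
proof -
  show le1: "h / \<gamma> \<le> 1"
    using h_le_\<gamma> \<gamma>_pos by simp
  have "(h - \<gamma>) * (d - \<gamma>) \<le> (h - \<gamma>) * \<gamma>"
    using h_le_\<gamma> two_\<gamma>_le_d by (intro mult_left_mono_neg) auto
  then have "(h - \<gamma>) / \<gamma> \<le> (h - \<gamma>) / (d - \<gamma>)"
    using \<gamma>_pos two_\<gamma>_le_d by (simp add: frac_le_eq divide_le_eq pos_le_divide_eq mult.commute)
  then have "h / \<gamma> \<le> 1 + (h - \<gamma>) / (d - \<gamma>)"
    using \<gamma>_pos by (simp add: diff_divide_distrib)
  then show "lyapunov_dim A p = h / \<gamma>"
    unfolding lyapunov_dim_def lyapunov_s_eq lyapunov_ss_eq h_def[symmetric] using le1
    by (intro Min_eqI) auto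
qed

text \<open>The error is proportional to the scale \<open>n\<close>, not to the length of the word,
  and every prefix is controlled. Hence subtracting the estimates of two prefixes yields estimates
  for suffixes.\<close>

definition good :: "real \<Rightarrow> nat \<Rightarrow> 'i list \<Rightarrow> bool" where
  "good \<epsilon> n u \<longleftrightarrow> (\<forall>m\<le>length u.
     \<bar>log_pword p (take m u) + real m * h\<bar> \<le> \<epsilon> * real n \<and>
     \<bar>ln (N (take m u)) + real m * \<gamma>\<bar> \<le> \<epsilon> * real n \<and>
     \<bar>ln (D (take m u)) + real m * d\<bar> \<le> \<epsilon> * real n)"

lemma goodD:
  assumes "good \<epsilon> n u"
  shows "\<bar>log_pword p u + real (length u) * h\<bar> \<le> \<epsilon> * real n"
    and "\<bar>ln (N u) + real (length u) * \<gamma>\<bar> \<le> \<epsilon> * real n"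
    and "\<bar>ln (D u) + real (length u) * d\<bar> \<le> \<epsilon> * real n"
  using assms[unfolded good_def, rule_format, of "length u"] by auto

lemma good_take: "good \<epsilon> n u \<Longrightarrow> good \<epsilon> n (take m u)"
  unfolding good_def by (auto simp: min_def)

lemma good_prefix: "good \<epsilon> n (u @ w) \<Longrightarrow> good \<epsilon> n u"
  using good_take[of \<epsilon> n "u @ w" "length u"] by simp

lemma AE_good:
  assumes "\<epsilon> > 0"
  shows "AE \<omega> in bernoulli_measure p. \<forall>\<^sub>F n in sequentially. good \<epsilon> n (prefix_of \<omega> n)"
  using deviation_almost_additive[OF additive_log_pword assms, of p p]
    deviation_almost_additive[OF almost_additive_ln_N assms, of p]
    deviation_almost_additive[OF almost_additive_ln_D assms, of p]
proof eventually_elim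
  case (elim \<omega>)
  then show ?case
  proof eventually_elim
    case (elim n)
    have "take m (prefix_of \<omega> n) = prefix_of \<omega> m" if "m \<le> n" for m
      using that by (simp add: take_map)
    then show ?case
      using elim by (simp add: good_def mean_rate_log_pword \<gamma>_def d_def h_def)
  qed
qed

lemma pword_good_le: "good \<epsilon> n u \<Longrightarrow> pword p u \<le> exp (\<epsilon> * real n - real (length u) * h)"
  using goodD(1)[of \<epsilon> n u] pword_le_exp[of p u] by (smt (verit) exp_le_cancel_iff)

definition hits :: "real \<Rightarrow> nat \<Rightarrow> real^2 \<Rightarrow> 'i list \<Rightarrow> bool" where
  "hits \<epsilon> n z u \<longleftrightarrow> good \<epsilon> n u \<and> norm (word_prod A u *v z) < exp (- (real n * \<gamma>))"

text \<open>A word shortens \<open>z\<close> at most by its smaller singular value, which is about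
  exp (-m (d - \<gamma>)) \<ge> exp (-2 m \<gamma>). Reaching exp (-n \<gamma>) therefore forces n
  \<le> 2m up to errors: one \<epsilon> n each from \<open>N\<close>, \<open>D\<close> and the
  constant \<open>c\<close>.\<close>

lemma length_hits:
  assumes u: "hits \<epsilon> n z u" and c: "c > 0" "c \<le> norm z" and large: "ln (1 / c) \<le> \<epsilon> * real n"
  shows "(real n - 2 * real (length u)) * \<gamma> \<le> 3 * \<epsilon> * real n"
proof -
  let ?m = "real (length u)"
  note g = goodD[of \<epsilon> n u]
  have gd: "good \<epsilon> n u" and r: "norm (word_prod A u *v z) < exp (- (real n * \<gamma>))"
    using u by (auto simp: hits_def)
  have "D u * c \<le> D u * norm z"
    using c D_pos[of u] by simp
  also have "\<dots> \<le> N u * norm (word_prod A u *v z)"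
    by (rule word_prod_norm_ge)
  also have "\<dots> \<le> N u * exp (- (real n * \<gamma>))"
    using r N_pos[of u] by simp
  finally have "ln (D u * c) \<le> ln (N u * exp (- (real n * \<gamma>)))"
    using D_pos[of u] N_pos[of u] c by (subst ln_le_cancel_iff) auto
  then have "ln (D u) + ln c \<le> ln (N u) - real n * \<gamma>"
    using D_pos[of u] N_pos[of u] c by (simp add: ln_mult)
  then have "real n * \<gamma> \<le> ?m * (d - \<gamma>) + 3 * \<epsilon> * real n"
    using g(2,3)[OF gd] large c by (simp add: ln_div algebra_simps)
  also have "?m * (d - \<gamma>) \<le> ?m * (2 * \<gamma>)"
    using d_le_three_\<gamma> by (intro mult_left_mono) auto
  finally show ?thesis
    by (simp add: algebra_simps)
qed

text \<open>Every suffix ellipse has area about exp (-s), and a hit confines it to a strip about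
  \<open>z\<close> of width about exp (-s). So only the error terms are left: 12 \<epsilon> n is the
  gap between the bounds with +6E and -6E, and \<kappa>^7 collects \<kappa>^3 from the strip and
  \<kappa>^4 from the squared norm of the suffix.\<close>

lemma card_hit_suffixes_le:
  assumes c: "0 < c" "c \<le> norm z" and k: "k \<le> m" "k \<le> n - m" "m < n" and "\<epsilon> \<ge> 0"
  defines "Q \<equiv> {w. length w = k \<and> (\<exists>u. length u = m - k \<and> hits \<epsilon> n z (u @ w))}"
  shows "real (card Q) \<le> 16 * \<kappa> ^ 7 * (1 + 1 / c) / measure lebesgue (ball e \<rho>) * exp (12 * \<epsilon> * real n)"
proof -
  define s where "s = real k * (d - 2 * \<gamma>)"
  define E where "E = \<epsilon> * real n"
  define m0 where "m0 = measure lebesgue (ball e \<rho>)"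
  have E0: "E \<ge> 0"
    using \<open>\<epsilon> \<ge> 0\<close> by (simp add: E_def)
  have m0: "m0 > 0"
    unfolding m0_def by (rule measure_ball_pos)
  have z: "norm z > 0"
    using c by linarith
  \<comment> \<open>Here bunching and k \<le> n - m enter: the angle allowed by a hit, about exp
    (-(n - m) \<gamma>), does not exceed the angular width exp (-s) of the ellipses.\<close>
  have s_le: "s \<le> (real n - real m) * \<gamma>"
  proof -
    have "s \<le> real k * \<gamma>"
      unfolding s_def using d_le_three_\<gamma> by (intro mult_left_mono) auto
    also have "\<dots> \<le> (real n - real m) * \<gamma>"
      using k \<gamma>_pos by (intro mult_right_mono) auto
    finally show ?thesis .
  qed
  \<comment> \<open>Estimates for \<open>w\<close> are differences of those for \<open>u @ w\<close>
    and \<open>u\<close>: 2E for ln D and 4E for 2 ln N.\<close>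
  have bounds: "exp (- s - 6 * E) / \<kappa> ^ 4 \<le> D w / (N w)\<^sup>2" "D w / (N w)\<^sup>2 \<le> exp (- s + 6 * E)"
    if "w \<in> Q" for w
  proof -
    obtain u where u: "length w = k" "length u = m - k" "good \<epsilon> n (u @ w)"
      using \<open>w \<in> Q\<close> by (auto simp: Q_def hits_def)
    have len: "real (length (u @ w)) = real m" "real (length u) = real m - real k"
      using u k by auto
    note g1 = goodD[OF u(3), unfolded len] and g2 = goodD[OF good_prefix[OF u(3)], unfolded len]
    have N1: "ln (N (u @ w)) \<le> ln (N u) + ln (N w)" "ln (N u) + ln (N w) \<le> 2 * ln \<kappa> + ln (N (u @ w))"
    proof -
      have "ln (N (u @ w)) \<le> ln (N u * N w)"
        using N_append_le N_pos by (subst ln_le_cancel_iff) auto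
      then show "ln (N (u @ w)) \<le> ln (N u) + ln (N w)"
        using N_pos[of u] N_pos[of w] by (simp add: ln_mult)
      show "ln (N u) + ln (N w) \<le> 2 * ln \<kappa> + ln (N (u @ w))"
        using almost_additiveD[OF almost_additive_ln_N, of u w] kappa_ge_1 by (simp add: ln_realpow)
    qed
    have D1: "ln (D (u @ w)) = ln (D u) + ln (D w)"
      using D_pos by (simp add: D_append ln_mult)
    have eq: "D w / (N w)\<^sup>2 = exp (ln (D w) - 2 * ln (N w))"
      using D_pos[of w] N_pos[of w] by (simp add: exp_diff exp_double)
    have "ln (D w) - 2 * ln (N w) \<le> - s + 6 * E"
      using g1 g2 N1 D1 by (simp add: s_def E_def algebra_simps)
    then show "D w / (N w)\<^sup>2 \<le> exp (- s + 6 * E)"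
      unfolding eq by simp
    have "- s - 6 * E - 4 * ln \<kappa> \<le> ln (D w) - 2 * ln (N w)"
      using g1 g2 N1 D1 by (simp add: s_def E_def algebra_simps)
    then have "exp (- s - 6 * E - 4 * ln \<kappa>) \<le> D w / (N w)\<^sup>2"
      unfolding eq by simp
    moreover have "exp (4 * ln \<kappa>) = \<kappa> ^ 4"
      using kappa_ge_1 by (simp add: exp_of_nat_mult[of 4, simplified])
    ultimately show "exp (- s - 6 * E) / \<kappa> ^ 4 \<le> D w / (N w)\<^sup>2"
      by (simp add: exp_diff[of "- s - 6 * E"])
  qed
  have "m0 * (card Q * (exp (- s - 6 * E) / \<kappa> ^ 4))
    \<le> 16 * \<kappa> ^ 3 * (exp (- s + 6 * E) + exp (- s + 6 * E) / c)"
    unfolding m0_def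
  proof (rule card_suffixes_le[where k = k])
    show "Q \<subseteq> {w. length w = k}"
      by (auto simp: Q_def)
    show "norm ((1 / norm z) *\<^sub>R z) = 1"
      using z by simp
    fix w assume "w \<in> Q"
    then obtain u where u: "length w = k" "length u = m - k" "hits \<epsilon> n z (u @ w)"
      by (auto simp: Q_def)
    have gd: "good \<epsilon> n (u @ w)" and r: "norm (word_prod A (u @ w) *v z) < exp (- (real n * \<gamma>))"
      using u(3) by (auto simp: hits_def)
    have len: "real (length (u @ w)) = real m"
      using u k by simp
    have Nge: "exp (- (real m * \<gamma>) - E) \<le> N (u @ w)"
    proof -
      have "- (real m * \<gamma>) - E \<le> ln (N (u @ w))"
        using goodD(2)[OF gd, unfolded len] by (simp add: E_def)
      then have "exp (- (real m * \<gamma>) - E) \<le> exp (ln (N (u @ w)))"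
        by simp
      then show ?thesis
        using N_pos[of "u @ w"] by simp
    qed
    have "exp (- (real n * \<gamma>)) / norm z / N (u @ w) \<le> exp (- (real n * \<gamma>)) / c / exp (- (real m * \<gamma>) - E)"
      using c Nge by (intro frac_le divide_left_mono) auto
    also have "\<dots> = exp (- (real n * \<gamma>) - (- (real m * \<gamma>) - E)) / c"
      by (simp add: exp_diff)
    also have "\<dots> \<le> exp (- s + 6 * E) / c"
    proof -
      have "- (real n * \<gamma>) - (- (real m * \<gamma>) - E) \<le> - s + 6 * E"
        using s_le E0 by (simp add: algebra_simps)
      then show ?thesis
        using c by (intro divide_right_mono) auto
    qed
    finally show "\<exists>u r. norm (word_prod A (u @ w) *v (1 / norm z) *\<^sub>R z) \<le> r \<and> r / N (u @ w) \<le> exp (- s + 6 * E) / c"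
      using r z by (intro exI[of _ u] exI[of _ "exp (- (real n * \<gamma>)) / norm z"])
        (auto simp: matrix_vector_mult_scaleR divide_right_mono)
  qed (use bounds c in auto)
  then have "real (card Q) * (m0 * exp (- s - 6 * E) / \<kappa> ^ 4) \<le> 16 * \<kappa> ^ 3 * (1 + 1 / c) * exp (- s + 6 * E)"
    by (simp add: algebra_simps)
  then have "real (card Q) \<le> 16 * \<kappa> ^ 3 * (1 + 1 / c) * exp (- s + 6 * E) / (m0 * exp (- s - 6 * E) / \<kappa> ^ 4)"
    using m0 kappa_ge_1 by (subst pos_le_divide_eq) auto
  also have "\<dots> = 16 * (\<kappa> ^ 3 * \<kappa> ^ 4) * (1 + 1 / c) / m0 * (exp (- s + 6 * E) / exp (- s - 6 * E))"
    by simp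
  also have "\<dots> = 16 * \<kappa> ^ 7 * (1 + 1 / c) / m0 * exp (12 * E)"
    by (simp flip: power_add exp_diff)
  finally show ?thesis
    by (simp add: m0_def E_def mult.assoc)
qed

definition hit_const :: "real \<Rightarrow> real" where
  "hit_const c = 16 * \<kappa> ^ 7 * (1 + 1 / c) / measure lebesgue (ball e \<rho>)"

lemma hit_const_pos: "c > 0 \<Longrightarrow> hit_const c > 0"
  unfolding hit_const_def using measure_ball_pos kappa_ge_1
  by (intro divide_pos_pos mult_pos_pos zero_less_power add_pos_pos) auto

text \<open>Words whose image of \<open>z\<close> is short contract a direction close to \<open>z\<close>. Only few suffixes of length
  \<open>k = min m (n - m)\<close> do so, and bunching makes \<open>k\<close> almost equal to \<open>n - m\<close> whenever there are
  any such words.\<close>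

lemma Ew_hits_le:
  assumes c: "0 < c" "c \<le> norm z" and "m < n" and large: "ln (1 / c) \<le> \<epsilon> * real n" and "\<epsilon> > 0"
  shows "Ew p m (\<lambda>u. of_bool (hits \<epsilon> n z u)) \<le> hit_const c * exp (17 * \<epsilon> * real n - real (n - m) * h)"
proof (cases "\<exists>u. length u = m \<and> hits \<epsilon> n z u")
  case False
  then have "Ew p m (\<lambda>u. of_bool (hits \<epsilon> n z u)) = Ew p m (\<lambda>_. 0)"
    by (intro Ew_cong) auto
  then show ?thesis
    using hit_const_pos[OF c(1)] by (simp add: Ew_const)
next
  case True
  define k where "k = min m (n - m)"
  define E where "E = \<epsilon> * real n"
  define Q where "Q = {w. length w = k \<and> (\<exists>u. length u = m - k \<and> hits \<epsilon> n z (u @ w))}"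
  have k: "k \<le> m" "k \<le> n - m"
    by (simp_all add: k_def)
  have E0: "E \<ge> 0"
    using \<open>\<epsilon> > 0\<close> by (simp add: E_def)
  \<comment> \<open>If k = m < n - m, the missing (n - 2m) h is at most (n - 2m) \<gamma>, which the
    existence of a hit bounds by 3E.\<close>
  have kh: "real (n - m) * h - 3 * E \<le> real k * h"
  proof (cases "n - m \<le> m")
    case True
    then show ?thesis
      using E0 by (simp add: k_def)
  next
    case False
    then have km: "k = m" "real n - 2 * real m \<ge> 0"
      by (auto simp: k_def)
    have "(real n - 2 * real m) * h \<le> (real n - 2 * real m) * \<gamma>"
      using km h_le_\<gamma> by (intro mult_left_mono) auto
    also have "\<dots> \<le> 3 * E"
      using True length_hits[OF _ c large] by (auto simp: E_def mult.assoc)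
    finally show ?thesis
      using km \<open>m < n\<close> by (simp add: of_nat_diff algebra_simps)
  qed
  have "Ew p m (\<lambda>u. of_bool (hits \<epsilon> n z u)) = Ew p ((m - k) + k) (\<lambda>u. of_bool (hits \<epsilon> n z u))"
    using k by simp
  also have "\<dots> = Ew p (m - k) (\<lambda>u. Ew p k (\<lambda>w. of_bool (hits \<epsilon> n z (u @ w))))"
    by (rule Ew_append)
  \<comment> \<open>Each admissible suffix has probability at most exp (2E - k h), again by
    subtracting two prefix estimates. With 12E from the count and 3E from \<open>kh\<close> the
    total error becomes 17E.\<close>
  also have "\<dots> \<le> Ew p (m - k) (\<lambda>u. real (card Q) * exp (2 * E - real k * h))"
  proof (rule Ew_mono)
    fix u :: "'i list" assume u: "length u = m - k"
    have "Ew p k (\<lambda>w. of_bool (hits \<epsilon> n z (u @ w))) \<le> (\<Sum>w | length w = k. exp (2 * E - real k * h) * of_bool (w \<in> Q))"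
      unfolding Ew_def
    proof (rule sum_mono)
      fix w :: "'i list" assume w: "w \<in> {w. length w = k}"
      show "pword p w * of_bool (hits \<epsilon> n z (u @ w)) \<le> exp (2 * E - real k * h) * of_bool (w \<in> Q)"
      proof (cases "hits \<epsilon> n z (u @ w)")
        case True
        then have gd: "good \<epsilon> n (u @ w)" and "w \<in> Q"
          using u w by (auto simp: hits_def Q_def)
        have len: "real (length (u @ w)) = real m" "real (length u) = real m - real k"
          using u w k by auto
        have "log_pword p w \<le> 2 * E - real k * h"
          using goodD(1)[OF gd, unfolded len] goodD(1)[OF good_prefix[OF gd], unfolded len]
          by (simp add: log_pword_append E_def algebra_simps)
        then have "exp (log_pword p w) \<le> exp (2 * E - real k * h)"
          by simp
        with pword_le_exp[of p w] have "pword p w \<le> exp (2 * E - real k * h)"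
          by (rule order_trans)
        then show ?thesis
          using True \<open>w \<in> Q\<close> by simp
      qed simp
    qed
    also have "\<dots> = exp (2 * E - real k * h) * real (card Q)"
    proof -
      have "{w. length w = k} \<inter> Q = Q"
        by (auto simp: Q_def)
      then show ?thesis
        by (simp flip: sum_distrib_left)
    qed
    finally show "Ew p k (\<lambda>w. of_bool (hits \<epsilon> n z (u @ w))) \<le> real (card Q) * exp (2 * E - real k * h)"
      by (simp add: mult.commute)
  qed
  also have "\<dots> = real (card Q) * exp (2 * E - real k * h)"
    by (rule Ew_const)
  also have "\<dots> \<le> (hit_const c * exp (12 * E)) * exp (2 * E - real k * h)"
    using card_hit_suffixes_le[OF c k \<open>m < n\<close>, of \<epsilon>] \<open>\<epsilon> > 0\<close>
    by (intro mult_right_mono) (simp_all add: Q_def hit_const_def E_def mult.assoc)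
  also have "\<dots> = hit_const c * exp (14 * E - real k * h)"
    by (simp add: mult.assoc flip: exp_add)
  also have "\<dots> \<le> hit_const c * exp (17 * E - real (n - m) * h)"
    using kh hit_const_pos[OF c(1)] by (intro mult_left_mono) auto
  finally show ?thesis
    by (simp add: E_def mult.assoc)
qed

end

section \<open>Local dimensions\<close>

definition local_quotient :: "'a::metric_space measure \<Rightarrow> 'a \<Rightarrow> real \<Rightarrow> ereal" where
  "local_quotient m x r = (if measure m (ball x r) = 0 then \<infinity> else ereal (ln (measure m (ball x r)) / ln r))"

lemma lower_local_dim_eq: "lower_local_dim m x = Liminf (at_right 0) (local_quotient m x)"
  unfolding lower_local_dim_def local_quotient_def ..

context
  fixes m :: "'a::metric_space measure"
  assumes fin: "finite_measure m" and sets_m [simp]: "sets m = sets borel"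
begin

lemma measure_ball_mono: "r \<le> s \<Longrightarrow> measure m (ball x r) \<le> measure m (ball x s)"
  by (intro finite_measure.finite_measure_mono[OF fin] subset_ball) auto

lemma measure_ball_shrink:
  assumes "r > 0"
  shows "(\<lambda>j. measure m (ball x (r - r / real (Suc (Suc j))))) \<longlonglongrightarrow> measure m (ball x r)"
proof -
  have "(\<Union>j. ball x (r - r / real (Suc (Suc j)))) = ball x r"
  proof (intro equalityI subsetI)
    fix y assume "y \<in> ball x r"
    then have "1 - dist x y / r > 0"
      using assms by simp
    then obtain j where "1 / real (Suc j) < 1 - dist x y / r"
      using nat_approx_posE by blast
    moreover have "1 / real (Suc (Suc j)) \<le> 1 / real (Suc j)"
      by (intro divide_left_mono) auto
    ultimately have "r * (1 / real (Suc (Suc j))) < r * (1 - dist x y / r)"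
      using assms by (intro mult_strict_left_mono) auto
    then have "dist x y < r - r / real (Suc (Suc j))"
      using assms by (simp add: right_diff_distrib)
    then show "y \<in> (\<Union>j. ball x (r - r / real (Suc (Suc j))))"
      by auto
  next
    fix y assume "y \<in> (\<Union>j. ball x (r - r / real (Suc (Suc j))))"
    then obtain j where "dist x y < r - r / real (Suc (Suc j))"
      by auto
    moreover have "r / real (Suc (Suc j)) > 0"
      using assms by simp
    ultimately show "y \<in> ball x r"
      by simp
  qed
  then have union: "measure m (\<Union>j. ball x (r - r / real (Suc (Suc j)))) = measure m (ball x r)"
    by (rule arg_cong)
  have "incseq (\<lambda>j. ball x (r - r / real (Suc (Suc j))))"
    using assms by (intro incseq_SucI subset_ball diff_left_mono divide_left_mono) auto
  moreover have "range (\<lambda>j. ball x (r - r / real (Suc (Suc j)))) \<subseteq> sets m"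
    by auto
  ultimately show ?thesis
    unfolding union[symmetric] by (intro finite_measure.finite_Lim_measure_incseq[OF fin])
qed

text \<open>Lower semicontinuity: if the ball about \<open>x\<close> has measure above
  \<open>a\<close>, so has a slightly smaller concentric one, and this lies in all balls of the
  original radius with nearby centre.\<close>

lemma borel_measurable_measure_ball: "(\<lambda>x. measure m (ball x r)) \<in> borel_measurable borel"
proof (cases "r > 0")
  case True
  have "open {x. a < measure m (ball x r)}" for a
    unfolding open_contains_ball
  proof
    fix x assume "x \<in> {x. a < measure m (ball x r)}"
    then have "\<forall>\<^sub>F j in sequentially. a < measure m (ball x (r - r / real (Suc (Suc j))))"
      using order_tendstoD(1)[OF measure_ball_shrink[OF True]] by auto
    then obtain j where j: "a < measure m (ball x (r - r / real (Suc (Suc j))))"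
      by (auto simp: eventually_sequentially)
    have "y \<in> {x. a < measure m (ball x r)}" if "y \<in> ball x (r / real (Suc (Suc j)))" for y
    proof -
      have "ball x (r - r / real (Suc (Suc j))) \<subseteq> ball y r"
      proof
        fix v assume v: "v \<in> ball x (r - r / real (Suc (Suc j)))"
        have "dist y v \<le> dist x y + dist x v"
          by (metis dist_commute dist_triangle)
        then show "v \<in> ball y r"
          using that v by simp
      qed
      then have "measure m (ball x (r - r / real (Suc (Suc j)))) \<le> measure m (ball y r)"
        by (intro finite_measure.finite_measure_mono[OF fin]) auto
      then show ?thesis
        using j by simp
    qed
    then show "\<exists>e>0. ball x e \<subseteq> {x. a < measure m (ball x r)}"
      using True by (intro exI[of _ "r / real (Suc (Suc j))"]) auto
  qed
  then show ?thesis
    by (simp add: borel_measurable_iff_greater)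
next
  case False
  then have "measure m (ball x r) = 0" for x :: 'a
    by (simp add: ball_empty)
  then show ?thesis by (simp only: measurable_const space_borel UNIV_I)
qed

lemma borel_measurable_local_quotient: "(\<lambda>x. local_quotient m x r) \<in> borel_measurable borel"
  using borel_measurable_measure_ball[measurable] unfolding local_quotient_def by measurable

text \<open>By continuity of the measure from below, the infimum over all radii in an interval is attained
  along rational radii.\<close>

lemma INF_local_quotient_Rats:
  assumes "0 < r" "r < b" "b \<le> 1"
  shows "(INF s\<in>\<rat> \<inter> {0<..<b}. local_quotient m x s) \<le> local_quotient m x r"
proof (cases "measure m (ball x r) = 0")
  case False
  define lo where "lo j = r - r / real (Suc (Suc j))" for j
  have lo: "0 \<le> lo j" "lo j < r" for j
    using assms(1) by (auto simp: lo_def field_simps)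
  have "\<exists>s. s \<in> \<rat> \<and> lo j < s \<and> s < r" for j
    using Rats_dense_in_real[OF lo(2)] by blast
  then obtain s where s: "\<And>j. s j \<in> \<rat>" "\<And>j. lo j < s j" "\<And>j. s j < r"
    by metis
  have "(\<lambda>j. r - r / real (Suc (Suc j))) \<longlonglongrightarrow> r - 0"
    by (intro tendsto_intros LIMSEQ_Suc lim_const_over_n)
  then have "s \<longlonglongrightarrow> r"
    using s(2,3) by (intro tendsto_sandwich[of lo s sequentially "\<lambda>_. r" r])
      (auto simp: lo_def[abs_def] intro!: always_eventually less_imp_le)
  moreover have "(\<lambda>j. measure m (ball x (s j))) \<longlonglongrightarrow> measure m (ball x r)"
  proof (rule tendsto_sandwich[where f = "\<lambda>j. measure m (ball x (lo j))" and h = "\<lambda>_. measure m (ball x r)"])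
    show "(\<lambda>j. measure m (ball x (lo j))) \<longlonglongrightarrow> measure m (ball x r)"
      using measure_ball_shrink[OF assms(1)] by (simp add: lo_def)
  qed (use s in \<open>auto intro!: always_eventually measure_ball_mono intro: less_imp_le\<close>)
  \<comment> \<open>Radii stay below b \<le> 1, hence ln r is nonzero and the quotient is continuous
    there.\<close>
  ultimately have "(\<lambda>j. ln (measure m (ball x (s j))) / ln (s j)) \<longlonglongrightarrow> ln (measure m (ball x r)) / ln r"
    using False assms by (intro tendsto_intros) auto
  then have "(\<lambda>j. ereal (ln (measure m (ball x (s j))) / ln (s j))) \<longlonglongrightarrow> ereal (ln (measure m (ball x r)) / ln r)"
    by (simp add: lim_ereal)
  moreover have "\<forall>\<^sub>F j in sequentially. measure m (ball x (s j)) \<noteq> 0"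
    using \<open>(\<lambda>j. measure m (ball x (s j))) \<longlonglongrightarrow> measure m (ball x r)\<close> False by (rule tendsto_imp_eventually_ne)
  then have "\<forall>\<^sub>F j in sequentially. (INF s\<in>\<rat> \<inter> {0<..<b}. local_quotient m x s) \<le> ereal (ln (measure m (ball x (s j))) / ln (s j))"
  proof eventually_elim
    case (elim j)
    have "s j \<in> \<rat> \<inter> {0<..<b}"
      using s[of j] lo(1)[of j] assms by auto
    then have "(INF s\<in>\<rat> \<inter> {0<..<b}. local_quotient m x s) \<le> local_quotient m x (s j)"
      by (rule INF_lower)
    then show ?case
      using elim by (simp add: local_quotient_def)
  qed
  ultimately have "(INF s\<in>\<rat> \<inter> {0<..<b}. local_quotient m x s) \<le> ereal (ln (measure m (ball x r)) / ln r)"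
    by (rule tendsto_lowerbound) simp
  then show ?thesis
    using False by (simp add: local_quotient_def)
qed (simp add: local_quotient_def)

text \<open>Countably many radii make the lower local dimension measurable, which the evaluation of
  its essential supremum requires.\<close>

lemma lower_local_dim_countable:
  "lower_local_dim m x = (SUP k. INF s\<in>\<rat> \<inter> {0<..<1 / real (Suc k)}. local_quotient m x s)"
proof (rule antisym)
  show "lower_local_dim m x \<le> (SUP k. INF s\<in>\<rat> \<inter> {0<..<1 / real (Suc k)}. local_quotient m x s)"
    unfolding lower_local_dim_eq Liminf_def
  proof (rule SUP_least)
    fix P assume "P \<in> {P. eventually P (at_right (0 :: real))}"
    then obtain b where b: "b > 0" "\<And>r. 0 < r \<Longrightarrow> r < b \<Longrightarrow> P r"
      by (auto simp: eventually_at_right_field)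
    obtain k where k: "1 / real (Suc k) < b"
      using nat_approx_posE[OF b(1)] by blast
    have "(INF r\<in>Collect P. local_quotient m x r) \<le> (INF s\<in>\<rat> \<inter> {0<..<1 / real (Suc k)}. local_quotient m x s)"
      using b(2) k by (intro INF_superset_mono) auto
    also have "\<dots> \<le> (SUP k. INF s\<in>\<rat> \<inter> {0<..<1 / real (Suc k)}. local_quotient m x s)"
      by (rule SUP_upper) simp
    finally show "(INF r\<in>Collect P. local_quotient m x r) \<le> (SUP k. INF s\<in>\<rat> \<inter> {0<..<1 / real (Suc k)}. local_quotient m x s)" .
  qed
next
  show "(SUP k. INF s\<in>\<rat> \<inter> {0<..<1 / real (Suc k)}. local_quotient m x s) \<le> lower_local_dim m x"
    unfolding lower_local_dim_eq
  proof (intro SUP_least Liminf_bounded)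
    fix k
    show "\<forall>\<^sub>F r in at_right 0. (INF s\<in>\<rat> \<inter> {0<..<1 / real (Suc k)}. local_quotient m x s) \<le> local_quotient m x r"
      unfolding eventually_at_right_field
      by (intro exI[of _ "1 / real (Suc k)"]) (auto intro!: INF_local_quotient_Rats)
  qed
qed

lemma borel_measurable_lower_local_dim: "lower_local_dim m \<in> borel_measurable borel"
proof -
  have "(\<lambda>x. SUP k. INF s\<in>\<rat> \<inter> {0<..<1 / real (Suc k)}. local_quotient m x s) \<in> borel_measurable borel"
    by (intro borel_measurable_SUP borel_measurable_INF borel_measurable_local_quotient countable_Int1 countable_rat) simp
  moreover have "lower_local_dim m = (\<lambda>x. SUP k. INF s\<in>\<rat> \<inter> {0<..<1 / real (Suc k)}. local_quotient m x s)"
    by (rule ext) (rule lower_local_dim_countable)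
  ultimately show ?thesis
    by simp
qed

end

text \<open>Geometric radii suffice: every small \<open>r\<close> lies between two consecutive ones,
  and the loss of one step, \<gamma> on the logarithmic scale, is negligible against -ln r.\<close>

lemma lower_local_dim_geI:
  fixes m :: "'a::metric_space measure"
  assumes "prob_space m" and sets: "sets m = sets borel" and "\<gamma> > 0"
    and bound: "\<And>\<epsilon>. \<epsilon> > 0 \<Longrightarrow> \<forall>\<^sub>F n in sequentially.
      measure m (ball x (exp (- (real n * \<gamma>)))) \<le> exp (\<epsilon> * real n - real n * h)"
  shows "lower_local_dim m x \<ge> ereal (h / \<gamma>)"
  unfolding lower_local_dim_eq le_Liminf_iff
proof (intro allI impI)
  interpret M: prob_space m by fact
  fix y' :: ereal assume y': "y' < ereal (h / \<gamma>)"
  obtain y where y: "0 \<le> y \<or> y' < 0" "y' \<le> ereal y" "0 \<le> y \<Longrightarrow> y < h / \<gamma>"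
  proof (cases y')
    case (real r)
    then show ?thesis
      using y' that[of r] by (cases "0 \<le> r") auto
  qed (use y' that[of "-1"] in auto)
  show "\<forall>\<^sub>F r in at_right 0. y' < local_quotient m x r"
  \<comment> \<open>For a negative target, nonnegativity of the quotient is enough. The other case
    then has 0 \<le> y \<gamma> < h, which makes the exponent \<open>g\<close> positive.\<close>
  proof (cases "y' < 0")
    case True
    have "\<forall>\<^sub>F r in at_right (0::real). r < 1"
      by (simp add: eventually_at_right_field) (use zero_less_one in blast)
    moreover have "\<forall>\<^sub>F r in at_right (0::real). 0 < r"
      by (rule eventually_at_right_less)
    ultimately show ?thesis
    proof eventually_elim
      case (elim r)
      have "ln r < 0"
        using elim by simp
      moreover have "ln (measure m (ball x r)) \<le> 0" if "measure m (ball x r) \<noteq> 0"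
        using that measure_nonneg[of m "ball x r"] by (simp add: less_le)
      ultimately have "0 \<le> local_quotient m x r"
        by (auto simp: local_quotient_def intro: divide_nonpos_neg)
      then show ?case
        using True by simp
    qed
  next
    case False
    then have y0: "0 \<le> y" "y < h / \<gamma>"
      using y by auto
    \<comment> \<open>Half of the available gap, so that g = h - \<epsilon> is still above y
      \<gamma>.\<close>
    define \<epsilon> where "\<epsilon> = (h - y * \<gamma>) / 2"
    define g where "g = h - \<epsilon>"
    have "y * \<gamma> < h"
      using y0(2) \<open>\<gamma> > 0\<close> by (simp add: pos_less_divide_eq)
    have \<epsilon>: "\<epsilon> > 0" "y * \<gamma> < g" "g > 0"
    proof -
      have "0 \<le> y * \<gamma>"
        using y0(1) \<open>\<gamma> > 0\<close> by (intro mult_nonneg_nonneg) auto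
      moreover have "(h - a) / 2 > 0 \<and> a < h - (h - a) / 2 \<and> h - (h - a) / 2 > 0" if "0 \<le> a" "a < h" for a
        using that by (simp add: field_simps)
      ultimately show "\<epsilon> > 0" "y * \<gamma> < g" "g > 0"
        using \<open>y * \<gamma> < h\<close> unfolding \<epsilon>_def g_def by blast+
    qed
    obtain n0 where n0: "\<And>n. n \<ge> n0 \<Longrightarrow> measure m (ball x (exp (- (real n * \<gamma>)))) \<le> exp (\<epsilon> * real n - real n * h)"
      using bound[OF \<epsilon>(1)] by (auto simp: eventually_sequentially)
    \<comment> \<open>The first term makes the index of the next larger geometric radius at least
      \<open>n0\<close>; the second is the solution of y l \<gamma> = g (l - \<gamma>) for
      \<open>l\<close>, beyond which the lost step is absorbed.\<close>
    define L where "L = max ((real n0 + 1) * \<gamma>) (\<gamma> * g / (g - y * \<gamma>))"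
    have "\<forall>\<^sub>F r in at_right (0::real). r < exp (- L)"
      by (simp add: eventually_at_right_field) (use exp_gt_zero in blast)
    moreover have "\<forall>\<^sub>F r in at_right (0::real). 0 < r"
      by (rule eventually_at_right_less)
    ultimately show ?thesis
    proof eventually_elim
      case (elim r)
      define l where "l = - ln r"
      have r: "r = exp (- l)"
        using elim by (simp add: l_def)
      then have "l > L"
        using elim by simp
      then have l: "l > (real n0 + 1) * \<gamma>" "l > \<gamma> * g / (g - y * \<gamma>)"
        by (auto simp: L_def)
      have "(real n0 + 1) * \<gamma> > 0"
        using \<open>\<gamma> > 0\<close> by (intro mult_pos_pos) auto
      then have "l > 0"
        using l(1) by linarith
      define n where "n = nat \<lfloor>l / \<gamma>\<rfloor>"
      have "0 \<le> l / \<gamma>"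
        using \<open>l > 0\<close> \<open>\<gamma> > 0\<close> by simp
      then have "real n \<le> l / \<gamma>" "l / \<gamma> < real n + 1"
        unfolding n_def by linarith+
      then have n: "real n * \<gamma> \<le> l" "l < (real n + 1) * \<gamma>"
        using \<open>\<gamma> > 0\<close> by (simp_all add: pos_le_divide_eq pos_divide_less_eq)
      have "(real n0 + 1) * \<gamma> < (real n + 1) * \<gamma>"
        using l(1) n(2) by linarith
      then have "n0 \<le> n"
        using \<open>\<gamma> > 0\<close> by simp
      show ?case
      proof (cases "measure m (ball x r) = 0")
        case True
        then show ?thesis
          using y' by (auto simp: local_quotient_def)
      next
        case nz: False
        then have pos: "measure m (ball x r) > 0"
          using measure_nonneg[of m "ball x r"] by linarith
        have "measure m (ball x r) \<le> measure m (ball x (exp (- (real n * \<gamma>))))"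
          using n(1) by (intro M.finite_measure_mono subset_ball) (auto simp: r sets)
        also have "\<dots> \<le> exp (- (g * real n))"
          using n0[OF \<open>n0 \<le> n\<close>] by (simp add: g_def algebra_simps)
        finally have "ln (measure m (ball x r)) \<le> ln (exp (- (g * real n)))"
          using pos by (subst ln_le_cancel_iff) auto
        then have ln_le: "g * real n \<le> - ln (measure m (ball x r))"
          by simp
        have "\<gamma> * g < l * (g - y * \<gamma>)"
          using l(2) \<epsilon>(2) by (simp add: pos_divide_less_eq)
        then have "y * l * \<gamma> < g * (l - \<gamma>)"
          by (simp add: algebra_simps)
        also have "\<dots> \<le> g * (real n * \<gamma>)"
          using n(2) \<epsilon>(3) by (intro mult_left_mono) (auto simp: algebra_simps)
        finally have "y * l < g * real n"
          using \<open>\<gamma> > 0\<close> by (simp add: mult.assoc[symmetric])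
        then have "y * l < - ln (measure m (ball x r))"
          using ln_le by linarith
        then have "y < - ln (measure m (ball x r)) / l"
          by (simp only: pos_less_divide_eq[OF \<open>l > 0\<close>])
        also have "\<dots> = ln (measure m (ball x r)) / ln r"
          by (simp add: l_def)
        finally show ?thesis
          using nz y(2) by (simp add: local_quotient_def le_less_trans)
      qed
    qed
  qed
qed

text \<open>A limit inferior is bounded above by its values along any one sequence of radii tending
  to 0.\<close>

lemma lower_local_dim_leI:
  fixes m :: "'a::metric_space measure"
  assumes "\<gamma> > 0"
    and r: "\<And>n. r n > 0" "(\<lambda>n. ln (r n) / real n) \<longlonglongrightarrow> - \<gamma>"
    and q: "(\<lambda>n. q n / real n) \<longlonglongrightarrow> - h" "\<And>n. exp (q n) \<le> measure m (ball x (r n))"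
  shows "lower_local_dim m x \<le> ereal (h / \<gamma>)"
proof (rule ccontr)
  assume "\<not> ?thesis"
  then have "ereal (h / \<gamma>) < lower_local_dim m x"
    by simp
  then obtain y where y: "ereal (h / \<gamma>) < y" "y < lower_local_dim m x"
    using dense by blast
  have bot: "filterlim (\<lambda>n. (ln (r n) / real n) * real n) at_bot sequentially"
    using \<open>\<gamma> > 0\<close> by (intro filterlim_tendsto_neg_mult_at_bot[OF r(2)] filterlim_real_sequentially) simp
  moreover have "\<forall>\<^sub>F n in sequentially. (ln (r n) / real n) * real n = ln (r n)"
    using eventually_gt_at_top[of 0] by eventually_elim simp
  ultimately have ln_bot: "filterlim (\<lambda>n. ln (r n)) at_bot sequentially"
    by (rule filterlim_cong[THEN iffD1, rotated -1, OF _ refl refl])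
  then have "(\<lambda>n. exp (ln (r n))) \<longlonglongrightarrow> 0"
    by (rule filterlim_compose[OF exp_at_bot])
  moreover have "r n \<noteq> 0" for n
    using r(1)[of n] by simp
  ultimately have "filterlim r (at_right 0) sequentially"
    using r(1) by (simp add: filterlim_at)
  moreover have "\<forall>\<^sub>F s in at_right 0. y < local_quotient m x s"
    using y(2) unfolding lower_local_dim_eq by (rule less_LiminfD)
  ultimately have "\<forall>\<^sub>F n in sequentially. y < local_quotient m x (r n)"
    by (rule eventually_compose_filterlim[rotated])
  moreover have "\<forall>\<^sub>F n in sequentially. ln (r n) < 0"
    using ln_bot unfolding filterlim_at_bot_dense by blast
  moreover have "\<forall>\<^sub>F n in sequentially. n > (0::nat)"
    by (rule eventually_gt_at_top)
  ultimately have "\<forall>\<^sub>F n in sequentially. y \<le> ereal ((q n / real n) / (ln (r n) / real n))"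
  proof eventually_elim
    case (elim n)
    have "exp (q n) \<le> measure m (ball x (r n))"
      by (rule q(2))
    then have pos: "measure m (ball x (r n)) > 0"
      using exp_gt_zero less_le_trans by blast
    have "q n \<le> ln (measure m (ball x (r n)))"
      using q(2)[of n] pos by (simp add: ln_ge_iff)
    then have "ln (measure m (ball x (r n))) / ln (r n) \<le> q n / ln (r n)"
      using elim(2) by (intro divide_right_mono_neg) auto
    moreover have "y < ereal (ln (measure m (ball x (r n))) / ln (r n))"
      using elim(1) pos by (simp add: local_quotient_def)
    ultimately have "y < ereal (q n / ln (r n))"
      using less_le_trans by fastforce
    then show ?case
      using elim(3) by simp
  qed
  moreover have "(\<lambda>n. ereal ((q n / real n) / (ln (r n) / real n))) \<longlonglongrightarrow> ereal (- h / - \<gamma>)"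
    using \<open>\<gamma> > 0\<close> by (simp only: lim_ereal) (intro tendsto_intros q(1) r(2), simp)
  ultimately have "y \<le> ereal (- h / - \<gamma>)"
    by (intro tendsto_lowerbound) auto
  with y(1) show False
    by simp
qed

section \<open>The coding map and the correlation integral\<close>

locale contracting_affine_ifs =
  fixes A :: "'i::finite \<Rightarrow> real^2^2" and t :: "'i \<Rightarrow> real^2"
  assumes contracting: "\<And>i. onorm ((*v) (A i)) < 1"
begin

abbreviation "f \<equiv> affine_ifs A t"
abbreviation "cod \<equiv> natural_projection f"

definition k :: real where "k = Max (range (\<lambda>i. onorm ((*v) (A i))))"

lemma k_bounds: "0 \<le> k" "k < 1" and onorm_le_k: "onorm ((*v) (A i)) \<le> k"
proof -
  show le: "onorm ((*v) (A i)) \<le> k" for i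
    unfolding k_def by (rule Max_ge) auto
  show "k < 1"
    unfolding k_def using contracting by (subst Max_less_iff) auto
  show "0 \<le> k"
    using le[of undefined] onorm_pos_le[OF bounded_linear_matrix, of "A undefined"] by linarith
qed

lemma norm_word_prod_le: "norm (word_prod A w *v x) \<le> k ^ length w * norm x"
proof (induction w)
  case (Cons i w)
  have "norm (A i *v (word_prod A w *v x)) \<le> k * norm (word_prod A w *v x)"
    using norm_matrix_mult_le[of "A i" "word_prod A w *v x"] onorm_le_k[of i]
    by (meson mult_right_mono norm_ge_zero order_trans)
  also have "\<dots> \<le> k * (k ^ length w * norm x)"
    using Cons k_bounds by (intro mult_left_mono) auto
  finally show ?case
    by (simp add: matrix_vector_mul_assoc mult.assoc)
qed simp

lemma foldr_affine: "foldr f w x = word_prod A w *v x + foldr f w 0"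
proof (induction w)
  case (Cons i w)
  have "foldr f (i # w) y = A i *v foldr f w y + t i" for y
    by (simp add: affine_ifs_def)
  then show ?case
    by (simp only: Cons.IH[symmetric] word_prod_Cons matrix_vector_mul_assoc[symmetric] matrix_vector_right_distrib[symmetric]
        add.assoc[symmetric])
qed simp

lemma foldr_diff: "foldr f w x - foldr f w y = word_prod A w *v (x - y)"
  by (subst foldr_affine, subst (2) foldr_affine) (simp add: matrix_vector_mult_diff_distrib)

text \<open>Consecutive approximations differ by the word product applied to one translation, which
  decays geometrically; so \<open>lim\<close> in the coding map is a genuine limit.\<close>

lemma foldr_prefix_tendsto: "(\<lambda>n. foldr f (prefix_of \<omega> (Suc n)) 0) \<longlonglongrightarrow> cod \<omega>"
proof -
  define X where "X n = foldr f (prefix_of \<omega> (Suc n)) 0" for n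
  define T where "T = Max (range (\<lambda>i. norm (t i)))"
  have T: "norm (t i) \<le> T" for i
    unfolding T_def by (rule Max_ge) auto
  have step: "norm (X (Suc n) - X n) \<le> k ^ Suc n * T" for n
  proof -
    have "X (Suc n) - X n = foldr f (prefix_of \<omega> (Suc n)) (f (\<omega> (Suc n)) 0) - foldr f (prefix_of \<omega> (Suc n)) 0"
      by (simp add: X_def)
    also have "\<dots> = word_prod A (prefix_of \<omega> (Suc n)) *v t (\<omega> (Suc n))"
      unfolding foldr_diff by (simp add: affine_ifs_def)
    also have "norm \<dots> \<le> k ^ Suc n * norm (t (\<omega> (Suc n)))"
      using norm_word_prod_le[of "prefix_of \<omega> (Suc n)"] by (metis diff_zero length_map length_upt)
    also have "\<dots> \<le> k ^ Suc n * T"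
      using T k_bounds by (intro mult_left_mono) auto
    finally show ?thesis .
  qed
  have "summable (\<lambda>n. k ^ n * (k * T))"
    using k_bounds by (intro summable_mult2 summable_geometric) simp
  then have "summable (\<lambda>n. norm (X (Suc n) - X n))"
    by (rule summable_comparison_test'[where N = 0]) (use step in \<open>simp add: mult_ac\<close>)
  then have "summable (\<lambda>n. X (Suc n) - X n)"
    by (rule summable_norm_cancel)
  then have "(\<lambda>n. \<Sum>j<n. X (Suc j) - X j) \<longlonglongrightarrow> (\<Sum>j. X (Suc j) - X j)"
    by (rule summable_LIMSEQ)
  then have "(\<lambda>n. X 0 + (X n - X 0)) \<longlonglongrightarrow> X 0 + (\<Sum>j. X (Suc j) - X j)"
    unfolding sum_lessThan_telescope by (intro tendsto_intros)
  then have "convergent X"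
    by (auto simp: convergent_def)
  then have "X \<longlonglongrightarrow> lim X"
    by (simp add: convergent_LIMSEQ_iff)
  then show ?thesis
    by (simp only: X_def[abs_def] natural_projection_def)
qed

lemma cod_case_nat: "cod (case_nat i \<omega>) = f i (cod \<omega>)"
proof (rule LIMSEQ_unique)
  show "(\<lambda>n. foldr f (prefix_of (case_nat i \<omega>) (Suc (Suc n))) 0) \<longlonglongrightarrow> cod (case_nat i \<omega>)"
    by (rule LIMSEQ_Suc[OF foldr_prefix_tendsto])
  have "(\<lambda>n. f i (foldr f (prefix_of \<omega> (Suc n)) 0)) \<longlonglongrightarrow> f i (cod \<omega>)"
    unfolding affine_ifs_def[of A t i]
    by (intro tendsto_add tendsto_const bounded_linear.tendsto[OF bounded_linear_matrix] foldr_prefix_tendsto)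
  then show "(\<lambda>n. foldr f (prefix_of (case_nat i \<omega>) (Suc (Suc n))) 0) \<longlonglongrightarrow> f i (cod \<omega>)"
    by (simp only: prefix_of_case_nat foldr.simps comp_def)
qed

lemma cod_prepend: "cod (prepend u \<eta>) - cod (prepend u \<eta>') = word_prod A u *v (cod \<eta> - cod \<eta>')"
proof -
  have "cod (prepend u \<eta>) = foldr f u (cod \<eta>)" for \<eta>
    by (induction u) (simp_all add: cod_case_nat)
  then show ?thesis
    by (simp add: foldr_diff)
qed

lemma borel_measurable_cod [measurable]: "cod \<in> borel_measurable (bernoulli_measure p)"
proof (rule borel_measurable_LIMSEQ_metric)
  show "(\<lambda>\<omega>. foldr f (prefix_of \<omega> (Suc n)) 0) \<in> borel_measurable (bernoulli_measure p)" for n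
    by (rule measurable_compose[OF measurable_prefix_of]) simp
  show "(\<lambda>n. foldr f (prefix_of \<omega> (Suc n)) 0) \<longlonglongrightarrow> cod \<omega>" for \<omega>
    by (rule foldr_prefix_tendsto)
qed

text \<open>The coding starts at 0, which may lie outside \<open>U\<close>; starting at
  \<open>x\<close> gives the same limit by contraction, and these approximations remain in
  \<open>U\<close>.\<close>

lemma cod_in_closure:
  assumes "x \<in> U" and U: "\<And>i. f i ` closure U \<subseteq> U"
  shows "cod \<omega> \<in> closure U"
proof -
  have "foldr f w x \<in> U" for w
  proof (induction w)
    case (Cons i w)
    then have "foldr f w x \<in> closure U"
      using closure_subset by blast
    then show ?case
      using U[of i] by auto
  qed (use assms in simp)
  moreover have "(\<lambda>n. foldr f (prefix_of \<omega> (Suc n)) x) \<longlonglongrightarrow> cod \<omega>"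
  proof -
    have "(\<lambda>n. k ^ n) \<longlonglongrightarrow> 0"
      using k_bounds by (intro LIMSEQ_power_zero) simp
    then have lim: "(\<lambda>n. k ^ Suc n * norm x) \<longlonglongrightarrow> 0"
      by (intro tendsto_mult_left_zero LIMSEQ_Suc)
    have bound: "norm (word_prod A (prefix_of \<omega> (Suc n)) *v x) \<le> k ^ Suc n * norm x" for n
    proof -
      have "length (prefix_of \<omega> (Suc n)) = Suc n"
        by simp
      then show ?thesis
        using norm_word_prod_le[of "prefix_of \<omega> (Suc n)" x] by (simp only:)
    qed
    have "(\<lambda>n. word_prod A (prefix_of \<omega> (Suc n)) *v x) \<longlonglongrightarrow> 0"
      by (rule Lim_null_comparison[OF always_eventually lim]) (intro allI bound)
    then have "(\<lambda>n. word_prod A (prefix_of \<omega> (Suc n)) *v x + foldr f (prefix_of \<omega> (Suc n)) 0) \<longlonglongrightarrow> 0 + cod \<omega>"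
      by (intro tendsto_add foldr_prefix_tendsto)
    then show ?thesis
      by (simp only: foldr_affine[of _ x] add_0)
  qed
  ultimately show ?thesis
    unfolding closure_sequential by (intro exI[of _ "\<lambda>n. foldr f (prefix_of \<omega> (Suc n)) x"] conjI allI)
qed

text \<open>The first letter decides in which of the disjoint compact sets f_i (closure U) the coded
  point lies; these have positive mutual distances.\<close>

lemma strong_separation_cod:
  assumes "strong_separation f"
  obtains c R where "0 < c" "0 \<le> R" "\<And>\<eta> \<eta>'. \<eta> 0 \<noteq> \<eta>' 0 \<Longrightarrow> c \<le> norm (cod \<eta> - cod \<eta>')"
    "\<And>\<eta> \<eta>'. norm (cod \<eta> - cod \<eta>') \<le> R"
proof -
  obtain U where U: "U \<noteq> {}" "bounded U" "open U" "\<And>i. f i ` closure U \<subseteq> U"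
    "\<And>i j. i \<noteq> j \<Longrightarrow> f i ` closure U \<inter> f j ` closure U = {}"
    using assms by (auto simp: strong_separation_def)
  then obtain x where "x \<in> U"
    by blast
  then have cl: "cod \<omega> \<in> closure U" for \<omega>
    using cod_in_closure U(4) by blast
  have cont: "continuous_on (closure U) (f i)" for i
    unfolding affine_ifs_def[abs_def]
    by (intro continuous_on_add continuous_on_const linear_continuous_on bounded_linear_matrix)
  have comp: "compact (f i ` closure U)" for i
    using U(2) cont by (intro compact_continuous_image) (simp_all add: compact_closure)
  have "\<exists>d>0. i \<noteq> j \<longrightarrow> (\<forall>x\<in>f i ` closure U. \<forall>y\<in>f j ` closure U. d \<le> dist x y)" for i j
  proof (cases "i = j")
    case False
    then show ?thesis
      using separate_compact_closed[OF comp compact_imp_closed[OF comp] U(5)[OF False]] by blast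
  qed (auto intro: exI[of _ 1])
  then obtain \<delta> where \<delta>: "\<And>i j. \<delta> i j > (0 :: real)"
    "\<And>i j x y. i \<noteq> j \<Longrightarrow> x \<in> f i ` closure U \<Longrightarrow> y \<in> f j ` closure U \<Longrightarrow> \<delta> i j \<le> dist x y"
    by metis
  define c where "c = Min (range (\<lambda>(i, j). \<delta> i j))"
  have "c > 0"
    unfolding c_def using \<delta>(1) by (subst Min_gr_iff) auto
  moreover have "c \<le> norm (cod \<eta> - cod \<eta>')" if "\<eta> 0 \<noteq> \<eta>' 0" for \<eta> \<eta>'
  proof -
    have first: "cod \<omega> \<in> f (\<omega> 0) ` closure U" for \<omega>
    proof -
      have "\<omega> = case_nat (\<omega> 0) (\<lambda>n. \<omega> (Suc n))"
        by (rule ext) (simp split: nat.split)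
      then have "cod \<omega> = f (\<omega> 0) (cod (\<lambda>n. \<omega> (Suc n)))"
        using cod_case_nat[of "\<omega> 0" "\<lambda>n. \<omega> (Suc n)"] by simp
      then show ?thesis
        using cl by blast
    qed
    have "c \<le> \<delta> (\<eta> 0) (\<eta>' 0)"
      unfolding c_def by (rule Min_le) (auto intro: image_eqI[of _ _ "(\<eta> 0, \<eta>' 0)"])
    also have "\<dots> \<le> dist (cod \<eta>) (cod \<eta>')"
      by (rule \<delta>(2)[OF that first[of \<eta>] first[of \<eta>']])
    finally show ?thesis
      by (simp add: dist_norm)
  qed
  moreover obtain R where R: "\<And>x y. x \<in> closure U \<Longrightarrow> y \<in> closure U \<Longrightarrow> dist x y \<le> R"
    using bounded_closure[OF U(2)] unfolding bounded_two_points by blast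
  moreover have "norm (cod \<eta> - cod \<eta>') \<le> R" for \<eta> \<eta>'
    using R[OF cl cl] by (simp add: dist_norm)
  moreover have "0 \<le> R"
    using R[OF cl cl] zero_le_dist order_trans by blast
  ultimately show ?thesis
    using that by blast
qed

end

text \<open>All that the dimension argument uses about the translations: differences of coded points
  with a common prefix, separation at the first letter, and boundedness.\<close>

locale coded_bernoulli_ifs = bunched_bernoulli_ifs A V W e \<kappa> \<rho> p
  for A :: "'i::finite \<Rightarrow> real^2^2" and V W :: "(real^2) set" and e :: "real^2" and \<kappa> \<rho> :: real and p :: "'i pmf" +
  fixes cod :: "(nat \<Rightarrow> 'i) \<Rightarrow> real^2" and c R :: real
  assumes cod_measurable [measurable]: "cod \<in> borel_measurable (bernoulli_measure p)"
    and cod_prepend: "\<And>u \<eta> \<eta>'. cod (prepend u \<eta>) - cod (prepend u \<eta>') = word_prod A u *v (cod \<eta> - cod \<eta>')"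
    and c_pos: "c > 0" and R_nonneg: "R \<ge> 0"
    and cod_separated: "\<And>\<eta> \<eta>'. \<eta> 0 \<noteq> \<eta>' 0 \<Longrightarrow> c \<le> norm (cod \<eta> - cod \<eta>')"
    and cod_bounded: "\<And>\<eta> \<eta>'. norm (cod \<eta> - cod \<eta>') \<le> R"
begin

abbreviation "\<nu> \<equiv> bernoulli_measure p"
definition \<mu> :: "(real^2) measure" where "\<mu> = distr \<nu> borel cod"

text \<open>Both sequences are cut after m letters. Only equal prefixes contribute, with weight
  \<open>pword p u\<close> squared, and a bound of the sum uniform in the two tails survives
  integration over them.\<close>

lemma nn_integral_diagonal_words_le:
  fixes F :: "(nat \<Rightarrow> 'i) \<times> (nat \<Rightarrow> 'i) \<Rightarrow> ennreal"
  assumes F: "F \<in> borel_measurable (\<nu> \<Otimes>\<^sub>M \<nu>)"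
    and off: "\<And>u v \<eta> \<eta>'. length u = m \<Longrightarrow> length v = m \<Longrightarrow> u \<noteq> v \<Longrightarrow> F (prepend u \<eta>, prepend v \<eta>') = 0"
    and diag: "\<And>\<eta> \<eta>'. (\<Sum>u | length u = m. ennreal (pword p u) * (ennreal (pword p u) * F (prepend u \<eta>, prepend u \<eta>'))) \<le> B"
  shows "(\<integral>\<^sup>+\<omega>. \<integral>\<^sup>+\<omega>'. F (\<omega>, \<omega>') \<partial>\<nu> \<partial>\<nu>) \<le> B"
proof -
  interpret B: prob_space \<nu>
    by (rule prob_space_bernoulli)
  interpret pair_prob_space \<nu> \<nu> ..
  have Fu: "(\<lambda>x. F (prepend u (fst x), prepend u (snd x))) \<in> borel_measurable (\<nu> \<Otimes>\<^sub>M \<nu>)" for u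
    by (rule measurable_compose[OF _ F]) measurable
  have Fu2: "(\<lambda>\<eta>'. F (prepend u \<eta>, prepend u \<eta>')) \<in> borel_measurable \<nu>" for u \<eta>
    using measurable_compose[OF measurable_Pair1'[of \<eta> \<nu> \<nu>] Fu[of u]] by simp
  have Fu1: "(\<lambda>\<eta>. \<integral>\<^sup>+\<eta>'. F (prepend u \<eta>, prepend u \<eta>') \<partial>\<nu>) \<in> borel_measurable \<nu>" for u
    using B.borel_measurable_nn_integral_fst[OF Fu[of u]] by simp
  have mult: "(\<lambda>\<eta>. b * (b * G \<eta>)) \<in> borel_measurable \<nu>" if "G \<in> borel_measurable \<nu>" for b :: ennreal and G
    using that[measurable] by measurable
  have cmult: "(\<integral>\<^sup>+\<eta>. b * (b * G \<eta>) \<partial>\<nu>) = b * (b * (\<integral>\<^sup>+\<eta>. G \<eta> \<partial>\<nu>))"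
    if G [measurable]: "G \<in> borel_measurable \<nu>" for b :: ennreal and G
  proof -
    have "(\<lambda>\<eta>. b * G \<eta>) \<in> borel_measurable \<nu>"
      by measurable
    then show ?thesis
      by (simp add: nn_integral_cmult G)
  qed
  have inner: "(\<integral>\<^sup>+\<omega>'. F (prepend u \<eta>, \<omega>') \<partial>\<nu>) = ennreal (pword p u) * (\<integral>\<^sup>+\<eta>'. F (prepend u \<eta>, prepend u \<eta>') \<partial>\<nu>)"
    if "length u = m" for u \<eta>
  proof -
    have "(\<lambda>\<omega>'. F (prepend u \<eta>, \<omega>')) \<in> borel_measurable \<nu>"
      using measurable_compose[OF measurable_Pair1'[of "prepend u \<eta>" \<nu> \<nu>] F] by simp
    then have "(\<integral>\<^sup>+\<omega>'. F (prepend u \<eta>, \<omega>') \<partial>\<nu>)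
        = (\<Sum>v | length v = m. ennreal (pword p v) * (\<integral>\<^sup>+\<eta>'. F (prepend u \<eta>, prepend v \<eta>') \<partial>\<nu>))"
      by (rule nn_integral_bernoulli_prepend)
    also have "\<dots> = (\<Sum>v\<in>{u}. ennreal (pword p v) * (\<integral>\<^sup>+\<eta>'. F (prepend u \<eta>, prepend v \<eta>') \<partial>\<nu>))"
      using that by (intro sum.mono_neutral_right) (auto simp: off)
    finally show ?thesis by simp
  qed
  have "(\<integral>\<^sup>+\<omega>. \<integral>\<^sup>+\<omega>'. F (\<omega>, \<omega>') \<partial>\<nu> \<partial>\<nu>)
      = (\<Sum>u | length u = m. ennreal (pword p u) * (\<integral>\<^sup>+\<eta>. \<integral>\<^sup>+\<omega>'. F (prepend u \<eta>, \<omega>') \<partial>\<nu> \<partial>\<nu>))"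
    by (rule nn_integral_bernoulli_prepend) (rule B.borel_measurable_nn_integral_fst[OF F])
  also have "\<dots> = (\<Sum>u | length u = m. ennreal (pword p u) * (\<integral>\<^sup>+\<eta>. ennreal (pword p u) * (\<integral>\<^sup>+\<eta>'. F (prepend u \<eta>, prepend u \<eta>') \<partial>\<nu>) \<partial>\<nu>))"
    by (intro sum.cong refl arg_cong2[where f = "(*)"] nn_integral_cong inner) simp
  also have "\<dots> = (\<Sum>u | length u = m. \<integral>\<^sup>+\<eta>. \<integral>\<^sup>+\<eta>'. ennreal (pword p u) * (ennreal (pword p u) * F (prepend u \<eta>, prepend u \<eta>')) \<partial>\<nu> \<partial>\<nu>)"
    by (intro sum.cong refl) (simp only: cmult[OF Fu2] cmult[OF Fu1] nn_integral_cmult[OF Fu1])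
  also have "\<dots> = (\<integral>\<^sup>+\<eta>. (\<Sum>u | length u = m. \<integral>\<^sup>+\<eta>'. ennreal (pword p u) * (ennreal (pword p u) * F (prepend u \<eta>, prepend u \<eta>')) \<partial>\<nu>) \<partial>\<nu>)"
    by (intro nn_integral_sum[symmetric]) (simp only: cmult[OF Fu2] mult[OF Fu1])
  also have "\<dots> = (\<integral>\<^sup>+\<eta>. \<integral>\<^sup>+\<eta>'. (\<Sum>u | length u = m. ennreal (pword p u) * (ennreal (pword p u) * F (prepend u \<eta>, prepend u \<eta>'))) \<partial>\<nu> \<partial>\<nu>)"
    by (intro nn_integral_cong nn_integral_sum[symmetric] mult Fu2)
  also have "\<dots> \<le> (\<integral>\<^sup>+\<eta>. \<integral>\<^sup>+\<eta>'. B \<partial>\<nu> \<partial>\<nu>)"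
    by (intro nn_integral_mono diag)
  also have "\<dots> = B"
    by (simp add: B.emeasure_space_1[simplified])
  finally show ?thesis .
qed

text \<open>Pairs whose codings first differ at index m, counted from 0. Equality of two random
  words is written as a quantification over all values, so that measurability reduces to comparisons
  with fixed words.\<close>

definition split_at :: "real \<Rightarrow> nat \<Rightarrow> nat \<Rightarrow> ((nat \<Rightarrow> 'i) \<times> (nat \<Rightarrow> 'i)) set" where
  "split_at \<epsilon> n m = {x. (\<forall>w. prefix_of (fst x) m = w \<longrightarrow> prefix_of (snd x) m = w) \<and> good \<epsilon> n (prefix_of (fst x) m) \<and>
     (\<forall>i. fst x m = i \<longrightarrow> snd x m \<noteq> i) \<and> norm (cod (fst x) - cod (snd x)) < exp (- (real n * \<gamma>))}"

definition same_prefix :: "real \<Rightarrow> nat \<Rightarrow> ((nat \<Rightarrow> 'i) \<times> (nat \<Rightarrow> 'i)) set" where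
  "same_prefix \<epsilon> n = {x. (\<forall>w. prefix_of (fst x) n = w \<longrightarrow> prefix_of (snd x) n = w) \<and> good \<epsilon> n (prefix_of (fst x) n)}"

lemma split_at_iff: "(\<omega>, \<omega>') \<in> split_at \<epsilon> n m \<longleftrightarrow> prefix_of \<omega>' m = prefix_of \<omega> m \<and>
    good \<epsilon> n (prefix_of \<omega> m) \<and> \<omega> m \<noteq> \<omega>' m \<and> norm (cod \<omega> - cod \<omega>') < exp (- (real n * \<gamma>))"
  unfolding split_at_def mem_Collect_eq fst_conv snd_conv by metis

lemma same_prefix_iff: "(\<omega>, \<omega>') \<in> same_prefix \<epsilon> n \<longleftrightarrow> prefix_of \<omega>' n = prefix_of \<omega> n \<and> good \<epsilon> n (prefix_of \<omega> n)"
  unfolding same_prefix_def mem_Collect_eq fst_conv snd_conv by metis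

lemma measurable_pair_prefix [measurable]:
  "(\<lambda>x. prefix_of (fst x) m) \<in> \<nu> \<Otimes>\<^sub>M \<nu> \<rightarrow>\<^sub>M count_space UNIV"
  "(\<lambda>x. prefix_of (snd x) m) \<in> \<nu> \<Otimes>\<^sub>M \<nu> \<rightarrow>\<^sub>M count_space UNIV"
  "(\<lambda>x. fst x m) \<in> \<nu> \<Otimes>\<^sub>M \<nu> \<rightarrow>\<^sub>M count_space UNIV"
  "(\<lambda>x. snd x m) \<in> \<nu> \<Otimes>\<^sub>M \<nu> \<rightarrow>\<^sub>M count_space UNIV"
  using measurable_compose[OF measurable_fst measurable_prefix_of] measurable_compose[OF measurable_snd measurable_prefix_of]
    measurable_compose[OF measurable_fst measurable_coordinate] measurable_compose[OF measurable_snd measurable_coordinate]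
  by auto

lemma measurable_pair_cod [measurable]:
  "(\<lambda>x. cod (fst x)) \<in> borel_measurable (\<nu> \<Otimes>\<^sub>M \<nu>)" "(\<lambda>x. cod (snd x)) \<in> borel_measurable (\<nu> \<Otimes>\<^sub>M \<nu>)"
  using measurable_compose[OF measurable_fst cod_measurable] measurable_compose[OF measurable_snd cod_measurable] by auto

lemma space_pair_\<nu>: "space (\<nu> \<Otimes>\<^sub>M \<nu>) = UNIV"
  by (simp add: space_pair_measure)

lemma sets_split_at [measurable]: "split_at \<epsilon> n m \<in> sets (\<nu> \<Otimes>\<^sub>M \<nu>)"
proof -
  have "{x \<in> space (\<nu> \<Otimes>\<^sub>M \<nu>). (\<forall>w. prefix_of (fst x) m = w \<longrightarrow> prefix_of (snd x) m = w) \<and> good \<epsilon> n (prefix_of (fst x) m) \<and>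
     (\<forall>i. fst x m = i \<longrightarrow> snd x m \<noteq> i) \<and> norm (cod (fst x) - cod (snd x)) < exp (- (real n * \<gamma>))} \<in> sets (\<nu> \<Otimes>\<^sub>M \<nu>)"
    by measurable
  then show ?thesis
    by (simp add: split_at_def space_pair_\<nu>)
qed

lemma sets_same_prefix [measurable]: "same_prefix \<epsilon> n \<in> sets (\<nu> \<Otimes>\<^sub>M \<nu>)"
proof -
  have "{x \<in> space (\<nu> \<Otimes>\<^sub>M \<nu>). (\<forall>w. prefix_of (fst x) n = w \<longrightarrow> prefix_of (snd x) n = w) \<and> good \<epsilon> n (prefix_of (fst x) n)} \<in> sets (\<nu> \<Otimes>\<^sub>M \<nu>)"
    by measurable
  then show ?thesis
    by (simp add: same_prefix_def space_pair_\<nu>)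
qed

lemma prefix_of_prepend_length [simp]: "prefix_of (prepend u \<eta>) (length u) = u"
  using prefix_of_prepend[of u \<eta> 0] by simp

lemma prepend_length: "prepend u \<eta> (length u) = \<eta> 0"
  by (induction u) simp_all

text \<open>For fixed tails with different first letters, the event says that the common prefix hits
  z = cod \<eta> - cod \<eta>', and |z| \<ge> c by separation. The m-dependence cancels between the
  two weights of the prefix.\<close>

lemma nn_integral_split_at_le:
  assumes "m < n" and large: "ln (1 / c) \<le> \<epsilon> * real n" and "\<epsilon> > 0"
  shows "(\<integral>\<^sup>+\<omega>. \<integral>\<^sup>+\<omega>'. indicator (split_at \<epsilon> n m) (\<omega>, \<omega>') \<partial>\<nu> \<partial>\<nu>)
    \<le> ennreal (hit_const c * exp (18 * \<epsilon> * real n - real n * h))"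
proof (rule nn_integral_diagonal_words_le[where m = m])
  show "indicator (split_at \<epsilon> n m) \<in> borel_measurable (\<nu> \<Otimes>\<^sub>M \<nu>)"
    by measurable
  show "indicator (split_at \<epsilon> n m) (prepend u \<eta>, prepend v \<eta>') = (0 :: ennreal)"
    if "length u = m" "length v = m" "u \<noteq> v" for u v \<eta> \<eta>'
  proof -
    have "(prepend u \<eta>, prepend v \<eta>') \<notin> split_at \<epsilon> n m"
      unfolding split_at_iff using that prefix_of_prepend_length by metis
    then show ?thesis by simp
  qed
  fix \<eta> \<eta>'
  let ?z = "cod \<eta> - cod \<eta>'"
  let ?I = "\<lambda>u. indicator (split_at \<epsilon> n m) (prepend u \<eta>, prepend u \<eta>') :: real"
  show "(\<Sum>u | length u = m. ennreal (pword p u) * (ennreal (pword p u) * indicator (split_at \<epsilon> n m) (prepend u \<eta>, prepend u \<eta>')))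
    \<le> ennreal (hit_const c * exp (18 * \<epsilon> * real n - real n * h))"
  proof (cases "\<eta> 0 = \<eta>' 0")
    case True
    have "indicator (split_at \<epsilon> n m) (prepend u \<eta>, prepend u \<eta>') = (0 :: ennreal)" if "length u = m" for u
    proof -
      have "(prepend u \<eta>, prepend u \<eta>') \<notin> split_at \<epsilon> n m"
        unfolding split_at_iff using that True prepend_length by metis
      then show ?thesis by simp
    qed
    then show ?thesis
      by simp
  next
    case False
    have "?I u = of_bool (hits \<epsilon> n ?z u)" if "length u = m" for u
    proof -
      have "(prepend u \<eta>, prepend u \<eta>') \<in> split_at \<epsilon> n m \<longleftrightarrow> hits \<epsilon> n ?z u"
        unfolding split_at_iff hits_def cod_prepend using that False prepend_length prefix_of_prepend_length by metis
      then show ?thesis by (simp add: indicator_def)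
    qed
    then have "(\<Sum>u | length u = m. pword p u * (pword p u * ?I u))
        = (\<Sum>u | length u = m. pword p u * (pword p u * of_bool (hits \<epsilon> n ?z u)))"
      by simp
    \<comment> \<open>One weight is bounded through goodness by exp (\<epsilon> n - m h); the other
      stays inside the expectation, which \<open>Ew_hits_le\<close> bounds.\<close>
    also have "\<dots> \<le> (\<Sum>u | length u = m. exp (\<epsilon> * real n - real m * h) * (pword p u * of_bool (hits \<epsilon> n ?z u)))"
    proof (rule sum_mono)
      fix u :: "'i list" assume u: "u \<in> {u. length u = m}"
      show "pword p u * (pword p u * of_bool (hits \<epsilon> n ?z u)) \<le> exp (\<epsilon> * real n - real m * h) * (pword p u * of_bool (hits \<epsilon> n ?z u))"
        using u pword_good_le[of \<epsilon> n u] by (cases "hits \<epsilon> n ?z u") (auto simp: hits_def intro!: mult_right_mono)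
    qed
    also have "\<dots> = exp (\<epsilon> * real n - real m * h) * Ew p m (\<lambda>u. of_bool (hits \<epsilon> n ?z u))"
      by (simp only: Ew_def sum_distrib_left)
    also have "\<dots> \<le> exp (\<epsilon> * real n - real m * h) * (hit_const c * exp (17 * \<epsilon> * real n - real (n - m) * h))"
      using Ew_hits_le[OF c_pos cod_separated[of \<eta> \<eta>', OF False] assms] by (intro mult_left_mono) auto
    also have "\<dots> = hit_const c * (exp (\<epsilon> * real n - real m * h) * exp (17 * \<epsilon> * real n - real (n - m) * h))"
      by simp
    also have "exp (\<epsilon> * real n - real m * h) * exp (17 * \<epsilon> * real n - real (n - m) * h) = exp (18 * \<epsilon> * real n - real n * h)"
      unfolding exp_add[symmetric] using \<open>m < n\<close> by (simp add: of_nat_diff algebra_simps)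
    finally have le: "(\<Sum>u | length u = m. pword p u * (pword p u * ?I u)) \<le> hit_const c * exp (18 * \<epsilon> * real n - real n * h)" .
    have "(\<Sum>u | length u = m. ennreal (pword p u) * (ennreal (pword p u) * indicator (split_at \<epsilon> n m) (prepend u \<eta>, prepend u \<eta>')))
        = (\<Sum>u | length u = m. ennreal (pword p u * (pword p u * ?I u)))"
      by (intro sum.cong refl) (simp add: ennreal_mult ennreal_indicator)
    also have "\<dots> = ennreal (\<Sum>u | length u = m. pword p u * (pword p u * ?I u))"
      by (intro sum_ennreal) auto
    finally show ?thesis
      using le by (simp add: ennreal_leI)
  qed
qed

text \<open>Covers the pairs that do not split before n. An error of \<epsilon> n would do; 18
  matches the bound for the splitting pairs.\<close>

lemma nn_integral_same_prefix_le:
  assumes "\<epsilon> > 0"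
  shows "(\<integral>\<^sup>+\<omega>. \<integral>\<^sup>+\<omega>'. indicator (same_prefix \<epsilon> n) (\<omega>, \<omega>') \<partial>\<nu> \<partial>\<nu>)
    \<le> ennreal (exp (18 * \<epsilon> * real n - real n * h))"
proof (rule nn_integral_diagonal_words_le[where m = n])
  show "indicator (same_prefix \<epsilon> n) \<in> borel_measurable (\<nu> \<Otimes>\<^sub>M \<nu>)"
    by measurable
  show "indicator (same_prefix \<epsilon> n) (prepend u \<eta>, prepend v \<eta>') = (0 :: ennreal)"
    if "length u = n" "length v = n" "u \<noteq> v" for u v \<eta> \<eta>'
  proof -
    have "(prepend u \<eta>, prepend v \<eta>') \<notin> same_prefix \<epsilon> n"
      unfolding same_prefix_iff using that prefix_of_prepend_length by metis
    then show ?thesis by simp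
  qed
  fix \<eta> \<eta>'
  have "(\<Sum>u | length u = n. ennreal (pword p u) * (ennreal (pword p u) * indicator (same_prefix \<epsilon> n) (prepend u \<eta>, prepend u \<eta>')))
      \<le> (\<Sum>u | length u = n. ennreal (pword p u * exp (18 * \<epsilon> * real n - real n * h)))"
  proof (rule sum_mono)
    fix u :: "'i list" assume u: "u \<in> {u. length u = n}"
    show "ennreal (pword p u) * (ennreal (pword p u) * indicator (same_prefix \<epsilon> n) (prepend u \<eta>, prepend u \<eta>'))
        \<le> ennreal (pword p u * exp (18 * \<epsilon> * real n - real n * h))"
    proof (cases "good \<epsilon> n u")
      case True
      have "\<epsilon> * real n - real n * h \<le> 18 * \<epsilon> * real n - real n * h"
        using assms by simp
      then have "pword p u \<le> exp (18 * \<epsilon> * real n - real n * h)"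
        using pword_good_le[OF True] u by (smt (verit) exp_le_cancel_iff mem_Collect_eq)
      then have "pword p u * pword p u \<le> pword p u * exp (18 * \<epsilon> * real n - real n * h)"
        by (intro mult_left_mono) auto
      then show ?thesis
        by (simp add: indicator_def ennreal_leI flip: ennreal_mult)
    next
      case False
      then have "(prepend u \<eta>, prepend u \<eta>') \<notin> same_prefix \<epsilon> n"
        unfolding same_prefix_iff using u prefix_of_prepend_length by (metis mem_Collect_eq)
      then show ?thesis
        by simp
    qed
  qed
  also have "\<dots> = ennreal (Ew p n (\<lambda>_. exp (18 * \<epsilon> * real n - real n * h)))"
    unfolding Ew_def by (intro sum_ennreal) auto
  finally show "(\<Sum>u | length u = n. ennreal (pword p u) * (ennreal (pword p u) * indicator (same_prefix \<epsilon> n) (prepend u \<eta>, prepend u \<eta>')))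
      \<le> ennreal (exp (18 * \<epsilon> * real n - real n * h))"
    by (simp add: Ew_const)
qed

section \<open>From the correlation integral to the local dimension\<close>

lemma prob_space_\<mu>: "prob_space \<mu>" and sets_\<mu> [simp]: "sets \<mu> = sets borel"
  unfolding \<mu>_def by (intro prob_space.prob_space_distr prob_space_bernoulli cod_measurable) simp

lemma measure_\<mu>_ball: "measure \<mu> (ball x r) = measure \<nu> {\<omega>'. norm (x - cod \<omega>') < r}"
proof -
  have "measure \<mu> (ball x r) = measure \<nu> (cod -` ball x r \<inter> space \<nu>)"
    unfolding \<mu>_def by (rule measure_distr) auto
  also have "cod -` ball x r \<inter> space \<nu> = {\<omega>'. norm (x - cod \<omega>') < r}"
    by (auto simp: dist_norm)
  finally show ?thesis .
qed

definition small_ball :: "nat \<Rightarrow> (nat \<Rightarrow> 'i) \<Rightarrow> ennreal" where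
  "small_ball n \<omega> = (\<integral>\<^sup>+\<omega>'. indicator {x. norm (cod (fst x) - cod (snd x)) < exp (- (real n * \<gamma>))} (\<omega>, \<omega>') \<partial>\<nu>)"

lemma sets_close [measurable]: "{x. norm (cod (fst x) - cod (snd x)) < (r :: real)} \<in> sets (\<nu> \<Otimes>\<^sub>M \<nu>)"
proof -
  have "{x \<in> space (\<nu> \<Otimes>\<^sub>M \<nu>). norm (cod (fst x) - cod (snd x)) < r} \<in> sets (\<nu> \<Otimes>\<^sub>M \<nu>)"
    by measurable
  then show ?thesis
    by (simp add: space_pair_\<nu>)
qed

lemma small_ball_eq: "small_ball n \<omega> = ennreal (measure \<mu> (ball (cod \<omega>) (exp (- (real n * \<gamma>)))))"
proof -
  interpret B: prob_space \<nu>
    by (rule prob_space_bernoulli)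
  let ?S = "{\<omega>'. norm (cod \<omega> - cod \<omega>') < exp (- (real n * \<gamma>))}"
  have "{\<omega>' \<in> space \<nu>. norm (cod \<omega> - cod \<omega>') < exp (- (real n * \<gamma>))} \<in> sets \<nu>"
    by measurable
  then have "?S \<in> sets \<nu>"
    by simp
  have "small_ball n \<omega> = (\<integral>\<^sup>+\<omega>'. indicator ?S \<omega>' \<partial>\<nu>)"
    unfolding small_ball_def by (intro nn_integral_cong) (simp add: indicator_def)
  also have "\<dots> = emeasure \<nu> ?S"
    using \<open>?S \<in> sets \<nu>\<close> by simp
  finally show ?thesis
    by (simp add: measure_\<mu>_ball B.emeasure_eq_measure)
qed

lemma borel_measurable_small_ball [measurable]: "small_ball n \<in> borel_measurable \<nu>"
proof -
  interpret B: prob_space \<nu>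
    by (rule prob_space_bernoulli)
  show ?thesis
    unfolding small_ball_def[abs_def] by (rule B.borel_measurable_nn_integral_fst) measurable
qed

lemma sets_good_prefix [measurable]: "{\<omega>. good \<epsilon> n (prefix_of \<omega> n)} \<in> sets \<nu>"
proof -
  have "{\<omega> \<in> space \<nu>. good \<epsilon> n (prefix_of \<omega> n)} \<in> sets \<nu>"
    by measurable
  then show ?thesis by simp
qed

text \<open>A close pair either splits first at some m < n or agrees on n letters; this gives n + 1
  terms of the same exponential order.\<close>

lemma nn_integral_small_ball_le:
  assumes large: "ln (1 / c) \<le> \<epsilon> * real n" and "\<epsilon> > 0"
  shows "(\<integral>\<^sup>+\<omega>. small_ball n \<omega> * indicator {\<omega>. good \<epsilon> n (prefix_of \<omega> n)} \<omega> \<partial>\<nu>)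
    \<le> ennreal ((real n * hit_const c + 1) * exp (18 * \<epsilon> * real n - real n * h))"
proof -
  interpret B: prob_space \<nu>
    by (rule prob_space_bernoulli)
  let ?G = "{\<omega>. good \<epsilon> n (prefix_of \<omega> n)}"
  let ?S = "{x. norm (cod (fst x) - cod (snd x)) < exp (- (real n * \<gamma>))}"
  define F :: "(nat \<Rightarrow> 'i) \<times> (nat \<Rightarrow> 'i) \<Rightarrow> ennreal" where
    "F x = (\<Sum>m<n. indicator (split_at \<epsilon> n m) x) + indicator (same_prefix \<epsilon> n) x" for x
  have F_ge: "indicator ?S (\<omega>, \<omega>') * indicator ?G \<omega> \<le> F (\<omega>, \<omega>')" for \<omega> \<omega>'
  proof (cases "(\<omega>, \<omega>') \<in> ?S \<and> \<omega> \<in> ?G")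
    case True
    show ?thesis
    proof (cases "\<exists>m<n. \<omega> m \<noteq> \<omega>' m")
      case True
      \<comment> \<open>The first disagreement; minimality provides the common prefix.\<close>
      define m where "m = (LEAST m. m < n \<and> \<omega> m \<noteq> \<omega>' m)"
      have m: "m < n" "\<omega> m \<noteq> \<omega>' m"
        using LeastI_ex[OF True] by (auto simp: m_def)
      have before: "\<omega> j = \<omega>' j" if "j < m" for j
        using not_less_Least[of j "\<lambda>m. m < n \<and> \<omega> m \<noteq> \<omega>' m"] that m(1) by (auto simp: m_def)
      have "good \<epsilon> n (take m (prefix_of \<omega> n))"
        using \<open>(\<omega>, \<omega>') \<in> ?S \<and> \<omega> \<in> ?G\<close> by (intro good_take) simp
      moreover have "take m (prefix_of \<omega> n) = prefix_of \<omega> m"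
        using m(1) by (simp add: take_map)
      ultimately have "(\<omega>, \<omega>') \<in> split_at \<epsilon> n m"
        using \<open>(\<omega>, \<omega>') \<in> ?S \<and> \<omega> \<in> ?G\<close> m(2) before by (simp add: split_at_iff)
      then have "1 \<le> indicator (split_at \<epsilon> n m) (\<omega>, \<omega>') + (0 :: ennreal)"
        by simp
      also have "\<dots> \<le> F (\<omega>, \<omega>')"
        unfolding F_def using m(1) by (intro add_mono member_le_sum) auto
      finally show ?thesis
        using \<open>(\<omega>, \<omega>') \<in> ?S \<and> \<omega> \<in> ?G\<close> by simp
    next
      case False
      then have "(\<omega>, \<omega>') \<in> same_prefix \<epsilon> n"
        using \<open>(\<omega>, \<omega>') \<in> ?S \<and> \<omega> \<in> ?G\<close> by (simp add: same_prefix_iff)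
      then have "0 + 1 \<le> F (\<omega>, \<omega>')"
        unfolding F_def by (intro add_mono) auto
      then show ?thesis
        using \<open>(\<omega>, \<omega>') \<in> ?S \<and> \<omega> \<in> ?G\<close> by simp
    qed
  qed auto
  have slice: "(\<lambda>\<omega>'. indicator X (\<omega>, \<omega>')) \<in> borel_measurable \<nu>" if "X \<in> sets (\<nu> \<Otimes>\<^sub>M \<nu>)" for X \<omega>
    using measurable_compose[OF measurable_Pair1'[of \<omega> \<nu> \<nu>] borel_measurable_indicator[OF that]] by simp
  have outer: "(\<lambda>\<omega>. \<integral>\<^sup>+\<omega>'. indicator X (\<omega>, \<omega>') \<partial>\<nu>) \<in> borel_measurable \<nu>" if "X \<in> sets (\<nu> \<Otimes>\<^sub>M \<nu>)" for X
    by (rule B.borel_measurable_nn_integral_fst[OF borel_measurable_indicator[OF that]])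
  have "(\<integral>\<^sup>+\<omega>. small_ball n \<omega> * indicator ?G \<omega> \<partial>\<nu>) = (\<integral>\<^sup>+\<omega>. \<integral>\<^sup>+\<omega>'. indicator ?S (\<omega>, \<omega>') * indicator ?G \<omega> \<partial>\<nu> \<partial>\<nu>)"
    unfolding small_ball_def by (intro nn_integral_cong nn_integral_multc[symmetric] slice sets_close)
  also have "\<dots> \<le> (\<integral>\<^sup>+\<omega>. \<integral>\<^sup>+\<omega>'. F (\<omega>, \<omega>') \<partial>\<nu> \<partial>\<nu>)"
    by (intro nn_integral_mono F_ge)
  also have "\<dots> = (\<integral>\<^sup>+\<omega>. (\<Sum>m<n. \<integral>\<^sup>+\<omega>'. indicator (split_at \<epsilon> n m) (\<omega>, \<omega>') \<partial>\<nu>) + (\<integral>\<^sup>+\<omega>'. indicator (same_prefix \<epsilon> n) (\<omega>, \<omega>') \<partial>\<nu>) \<partial>\<nu>)"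
    unfolding F_def
    by (intro nn_integral_cong) (simp add: nn_integral_add nn_integral_sum slice)
  also have "\<dots> = (\<Sum>m<n. \<integral>\<^sup>+\<omega>. \<integral>\<^sup>+\<omega>'. indicator (split_at \<epsilon> n m) (\<omega>, \<omega>') \<partial>\<nu> \<partial>\<nu>) + (\<integral>\<^sup>+\<omega>. \<integral>\<^sup>+\<omega>'. indicator (same_prefix \<epsilon> n) (\<omega>, \<omega>') \<partial>\<nu> \<partial>\<nu>)"
    by (simp add: nn_integral_add nn_integral_sum outer)
  also have "\<dots> \<le> (\<Sum>m<n. ennreal (hit_const c * exp (18 * \<epsilon> * real n - real n * h))) + ennreal (exp (18 * \<epsilon> * real n - real n * h))"
    using assms by (intro add_mono sum_mono nn_integral_split_at_le nn_integral_same_prefix_le) auto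
  also have "\<dots> = ennreal (real n * (hit_const c * exp (18 * \<epsilon> * real n - real n * h))) + ennreal (exp (18 * \<epsilon> * real n - real n * h))"
    using hit_const_pos[OF c_pos] by (simp add: ennreal_of_nat_eq_real_of_nat flip: ennreal_mult)
  also have "\<dots> = ennreal (real n * (hit_const c * exp (18 * \<epsilon> * real n - real n * h)) + exp (18 * \<epsilon> * real n - real n * h))"
    using hit_const_pos[OF c_pos] by (intro ennreal_plus[symmetric]) auto
  finally show ?thesis
    by (simp add: algebra_simps)
qed

text \<open>Markov's inequality at level exp (20 \<epsilon> n - n h): the surplus of 2 \<epsilon> n
  over the 18 \<epsilon> n of the integral bound outweighs the linear factor and makes the
  exceptional probabilities summable.\<close>

lemma AE_small_ball_le:
  assumes "\<epsilon> > 0"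
  shows "AE \<omega> in \<nu>. \<forall>\<^sub>F n in sequentially.
    measure \<mu> (ball (cod \<omega>) (exp (- (real n * \<gamma>)))) \<le> exp (20 * \<epsilon> * real n - real n * h)"
proof -
  interpret B: prob_space \<nu>
    by (rule prob_space_bernoulli)
  define \<tau> where "\<tau> n = exp (real n * h - 20 * \<epsilon> * real n)" for n
  define Z where "Z n = {\<omega> \<in> {\<omega>. good \<epsilon> n (prefix_of \<omega> n)}. 1 \<le> ennreal (\<tau> n) * small_ball n \<omega>}" for n
  have Z [measurable]: "Z n \<in> sets \<nu>" for n
  proof -
    have "{\<omega> \<in> space \<nu>. good \<epsilon> n (prefix_of \<omega> n) \<and> 1 \<le> ennreal (\<tau> n) * small_ball n \<omega>} \<in> sets \<nu>"
      by measurable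
    then show ?thesis
      by (simp add: Z_def)
  qed
  have large: "\<forall>\<^sub>F n in sequentially. ln (1 / c) \<le> \<epsilon> * real n"
  proof -
    have "filterlim (\<lambda>n. \<epsilon> * real n) at_top sequentially"
      using assms by (intro filterlim_tendsto_pos_mult_at_top[OF tendsto_const] filterlim_real_sequentially) auto
    then show ?thesis
      unfolding filterlim_at_top by blast
  qed
  have Z_le: "measure \<nu> (Z n) \<le> (hit_const c + 1) * (real (Suc n) * exp (- 2 * \<epsilon>) ^ n)" if "ln (1 / c) \<le> \<epsilon> * real n" for n
  proof -
    have "emeasure \<nu> (Z n) \<le> ennreal (\<tau> n) * (\<integral>\<^sup>+\<omega>. small_ball n \<omega> * indicator {\<omega>. good \<epsilon> n (prefix_of \<omega> n)} \<omega> \<partial>\<nu>)"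
      unfolding Z_def by (rule nn_integral_Markov_inequality[OF _ sets_good_prefix]) measurable
    also have "\<dots> \<le> ennreal (\<tau> n) * ennreal ((real n * hit_const c + 1) * exp (18 * \<epsilon> * real n - real n * h))"
      by (intro mult_left_mono nn_integral_small_ball_le that assms) simp
    also have "\<dots> = ennreal (\<tau> n * ((real n * hit_const c + 1) * exp (18 * \<epsilon> * real n - real n * h)))"
      using hit_const_pos[OF c_pos] by (intro ennreal_mult[symmetric]) (auto simp: \<tau>_def)
    also have "\<tau> n * ((real n * hit_const c + 1) * exp (18 * \<epsilon> * real n - real n * h))
        = (real n * hit_const c + 1) * exp (- 2 * \<epsilon>) ^ n"
      by (simp add: \<tau>_def algebra_simps flip: exp_add exp_of_nat_mult)
    finally have "measure \<nu> (Z n) \<le> (real n * hit_const c + 1) * exp (- 2 * \<epsilon>) ^ n"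
      using hit_const_pos[OF c_pos] by (simp add: B.emeasure_eq_measure)
    also have "\<dots> \<le> ((hit_const c + 1) * real (Suc n)) * exp (- 2 * \<epsilon>) ^ n"
      using hit_const_pos[OF c_pos] by (intro mult_right_mono) (auto simp: algebra_simps)
    finally show ?thesis
      by (simp only: mult.assoc)
  qed
  have "summable (\<lambda>n. (hit_const c + 1) * (real (Suc n) * exp (- 2 * \<epsilon>) ^ n))"
    using geometric_deriv_sums[of "exp (- 2 * \<epsilon>)"] assms by (intro summable_mult) (simp add: sums_iff)
  moreover have "\<forall>\<^sub>F n in sequentially. norm (measure \<nu> (Z n)) \<le> (hit_const c + 1) * (real (Suc n) * exp (- 2 * \<epsilon>) ^ n)"
    using large by eventually_elim (use Z_le in \<open>simp del: of_nat_Suc\<close>)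
  ultimately have "summable (\<lambda>n. measure \<nu> (Z n))"
    by (rule summable_comparison_test_ev[rotated])
  then have "AE \<omega> in \<nu>. \<forall>\<^sub>F n in sequentially. \<omega> \<in> space \<nu> - Z n"
    by (intro borel_cantelli_AE1) (auto simp: B.emeasure_eq_measure)
  with AE_good[OF assms] show ?thesis
  proof eventually_elim
    case (elim \<omega>)
    then show ?case
    proof eventually_elim
      case (elim n)
      then have "ennreal (\<tau> n) * small_ball n \<omega> < 1"
        by (auto simp: Z_def)
      then have "\<tau> n * measure \<mu> (ball (cod \<omega>) (exp (- (real n * \<gamma>)))) < 1"
        by (simp add: small_ball_eq \<tau>_def flip: ennreal_mult)
      then have "measure \<mu> (ball (cod \<omega>) (exp (- (real n * \<gamma>)))) < 1 / \<tau> n"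
        by (simp add: \<tau>_def field_simps)
      also have "1 / \<tau> n = exp (20 * \<epsilon> * real n - real n * h)"
        by (simp add: \<tau>_def exp_diff)
      finally show ?case
        by simp
    qed
  qed
qed

lemma AE_pword_nonzero: "AE \<omega> in \<nu>. \<forall>n. pword p (prefix_of \<omega> n) \<noteq> 0"
  unfolding AE_all_countable
proof
  fix n
  have "emeasure \<nu> {\<omega>. pword p (prefix_of \<omega> n) = 0} = ennreal (Ew p n (\<lambda>w. of_bool (pword p w = 0)))"
    by (rule emeasure_prefix_event)
  also have "Ew p n (\<lambda>w. of_bool (pword p w = 0)) = 0"
    unfolding Ew_def by (intro sum.neutral) auto
  finally have "{\<omega>. pword p (prefix_of \<omega> n) = 0} \<in> null_sets \<nu>"
  proof -
    assume *: "emeasure \<nu> {\<omega>. pword p (prefix_of \<omega> n) = 0} = ennreal 0"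
    have "{\<omega> \<in> space \<nu>. pword p (prefix_of \<omega> n) = 0} \<in> sets \<nu>"
      by measurable
    then show ?thesis
      using * by (auto simp: null_sets_def)
  qed
  then show "AE \<omega> in \<nu>. pword p (prefix_of \<omega> n) \<noteq> 0"
    by (rule AE_I') auto
qed

text \<open>The cylinder of the first n letters is coded into a set of diameter at most N R. This
  yields the upper bound for the local dimension.\<close>

lemma pword_le_measure_ball:
  assumes "r > N (prefix_of \<omega> n) * R"
  shows "pword p (prefix_of \<omega> n) \<le> measure \<mu> (ball (cod \<omega>) r)"
proof -
  interpret B: prob_space \<nu>
    by (rule prob_space_bernoulli)
  let ?w = "prefix_of \<omega> n"
  have split: "\<omega>' = prepend (prefix_of \<omega>' n) (\<lambda>j. \<omega>' (n + j))" for \<omega>' :: "nat \<Rightarrow> 'i"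
  proof (induction n arbitrary: \<omega>')
    case (Suc n)
    have cons: "case_nat (\<omega>' 0) (\<lambda>j. \<omega>' (Suc j)) = \<omega>'"
      by (rule ext) (simp split: nat.split)
    have "prefix_of \<omega>' (Suc n) = \<omega>' 0 # prefix_of (\<lambda>j. \<omega>' (Suc j)) n"
      using prefix_of_case_nat[of "\<omega>' 0" "\<lambda>j. \<omega>' (Suc j)" n] unfolding cons .
    then show ?case
      using Suc.IH[of "\<lambda>j. \<omega>' (Suc j)", symmetric] cons by (simp only: prepend_simps add_Suc)
  qed simp
  have "{\<omega>'. prefix_of \<omega>' n = ?w} \<subseteq> {\<omega>'. norm (cod \<omega> - cod \<omega>') < r}"
  proof
    fix \<omega>' assume "\<omega>' \<in> {\<omega>'. prefix_of \<omega>' n = ?w}"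
    then have "cod \<omega> - cod \<omega>' = word_prod A ?w *v (cod (\<lambda>j. \<omega> (n + j)) - cod (\<lambda>j. \<omega>' (n + j)))"
      using split[of \<omega>] split[of \<omega>'] cod_prepend by (metis (mono_tags, lifting) mem_Collect_eq)
    then have "norm (cod \<omega> - cod \<omega>') \<le> N ?w * norm (cod (\<lambda>j. \<omega> (n + j)) - cod (\<lambda>j. \<omega>' (n + j)))"
      using word_prod_norm_le by metis
    also have "\<dots> \<le> N ?w * R"
      using N_pos[of ?w] cod_bounded by (intro mult_left_mono) auto
    finally show "\<omega>' \<in> {\<omega>'. norm (cod \<omega> - cod \<omega>') < r}"
      using assms by simp
  qed
  moreover have "{\<omega>' \<in> space \<nu>. norm (cod \<omega> - cod \<omega>') < r} \<in> sets \<nu>"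
    by measurable
  ultimately have "measure \<nu> {\<omega>'. prefix_of \<omega>' n = ?w} \<le> measure \<mu> (ball (cod \<omega>) r)"
    unfolding measure_\<mu>_ball by (intro B.finite_measure_mono) auto
  moreover have "measure \<nu> {\<omega>'. prefix_of \<omega>' n = ?w} = pword p ?w"
  proof -
    have "emeasure \<nu> {\<omega>'. prefix_of \<omega>' n = ?w} = ennreal (Ew p n (\<lambda>v. of_bool (v = ?w)))"
      by (rule emeasure_prefix_event)
    also have "Ew p n (\<lambda>v. of_bool (v = ?w)) = (\<Sum>v\<in>{?w}. pword p v * of_bool (v = ?w))"
      unfolding Ew_def by (intro sum.mono_neutral_right) auto
    finally show ?thesis
      by (simp add: B.emeasure_eq_measure)
  qed
  ultimately show ?thesis by simp
qed

lemma AE_lower_local_dim: "AE \<omega> in \<nu>. lower_local_dim \<mu> (cod \<omega>) = ereal (h / \<gamma>)"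
proof -
  have "AE \<omega> in \<nu>. \<forall>k. \<forall>\<^sub>F n in sequentially.
    measure \<mu> (ball (cod \<omega>) (exp (- (real n * \<gamma>)))) \<le> exp (20 * (1 / real (Suc k)) * real n - real n * h)"
    unfolding AE_all_countable by (intro allI AE_small_ball_le) simp
  with AE_pword_nonzero AE_tendsto_mean_rate[OF additive_log_pword, of p p] AE_tendsto_mean_rate[OF almost_additive_ln_N, of p]
  show ?thesis
  proof eventually_elim
    case (elim \<omega>)
    have "lower_local_dim \<mu> (cod \<omega>) \<ge> ereal (h / \<gamma>)"
    proof (rule lower_local_dim_geI[OF prob_space_\<mu> sets_\<mu> \<gamma>_pos])
      fix \<epsilon> :: real assume "\<epsilon> > 0"
      \<comment> \<open>Countably many error levels are available almost surely; dividing by 20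
        absorbs the factor in \<open>AE_small_ball_le\<close>.\<close>
      then obtain k where k: "1 / real (Suc k) < \<epsilon> / 20"
        using nat_approx_posE[of "\<epsilon> / 20"] by auto
      from elim(4)[rule_format, of k]
      show "\<forall>\<^sub>F n in sequentially. measure \<mu> (ball (cod \<omega>) (exp (- (real n * \<gamma>)))) \<le> exp (\<epsilon> * real n - real n * h)"
      proof eventually_elim
        case (elim n)
        have "20 * (1 / real (Suc k)) * real n \<le> \<epsilon> * real n"
          using k by (intro mult_right_mono) auto
        then have "exp (20 * (1 / real (Suc k)) * real n - real n * h) \<le> exp (\<epsilon> * real n - real n * h)"
          by simp
        with elim show ?case
          by (rule order_trans)
      qed
    qed
    moreover have "lower_local_dim \<mu> (cod \<omega>) \<le> ereal (h / \<gamma>)"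
    proof (rule lower_local_dim_leI[OF \<gamma>_pos])
      \<comment> \<open>R + 1 instead of R makes the radius positive and strictly larger than N R,
        as open balls demand.\<close>
      let ?r = "\<lambda>n. N (prefix_of \<omega> n) * (R + 1)"
      show "?r n > 0" for n
        using N_pos[of "prefix_of \<omega> n"] R_nonneg by simp
      have "(\<lambda>n. ln (N (prefix_of \<omega> n)) / real n + ln (R + 1) / real n) \<longlonglongrightarrow> mean_rate p (\<lambda>w. ln (N w)) + 0"
        by (intro tendsto_add elim(3) lim_const_over_n)
      moreover have "ln (?r n) / real n = ln (N (prefix_of \<omega> n)) / real n + ln (R + 1) / real n" for n
        using N_pos[of "prefix_of \<omega> n"] R_nonneg by (simp add: ln_mult add_divide_distrib)
      ultimately show "(\<lambda>n. ln (?r n) / real n) \<longlonglongrightarrow> - \<gamma>"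
        by (simp add: \<gamma>_def)
      show "(\<lambda>n. log_pword p (prefix_of \<omega> n) / real n) \<longlonglongrightarrow> - h"
        using elim(2) by (simp add: mean_rate_log_pword h_def)
      show "exp (log_pword p (prefix_of \<omega> n)) \<le> measure \<mu> (ball (cod \<omega>) (?r n))" for n
        using pword_le_measure_ball[of \<omega> n "?r n"] pword_eq_exp[of p "prefix_of \<omega> n"] elim(1) N_pos[of "prefix_of \<omega> n"]
        by (simp add: algebra_simps)
    qed
    ultimately show ?case
      by (rule antisym[rotated])
  qed
qed

text \<open>The local dimension is almost surely one constant, and this is then its essential
  supremum.\<close>

lemma dim_H_measure_\<mu>: "dim_H_measure \<mu> = ereal (h / \<gamma>)"
proof -
  interpret M: prob_space \<mu>
    by (rule prob_space_\<mu>)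
  have meas: "lower_local_dim \<mu> \<in> borel_measurable borel"
    by (rule borel_measurable_lower_local_dim) (auto intro: M.finite_measure_axioms)
  then have meas': "lower_local_dim \<mu> \<in> borel_measurable \<mu>"
    by (simp cong: measurable_cong_sets)
  have "AE x in \<mu>. lower_local_dim \<mu> x = ereal (h / \<gamma>)"
    using AE_lower_local_dim meas unfolding \<mu>_def
    by (subst AE_distr_iff) (auto simp: \<mu>_def)
  then have "esssup \<mu> (lower_local_dim \<mu>) = esssup \<mu> (\<lambda>_. ereal (h / \<gamma>))"
    using meas' by (intro esssup_AE_cong) auto
  also have "\<dots> = ereal (h / \<gamma>)"
    using M.emeasure_space_1 by (intro esssup_const) simp
  finally show ?thesis
    by (simp add: dim_H_measure_def)
qed

end

theorem theorem4p1:
  fixes A :: "'i::finite \<Rightarrow> real^2^2"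
    and t :: "'i \<Rightarrow> real^2"
    and p :: "'i pmf"
  assumes contracting: "\<And>i. onorm ((*v) (A i)) < 1"
    and nonsingular: "\<And>i. invertible (A i)"
    and dominated: "dominated_splitting A"
    and non_overlapping: "backward_non_overlapping A"
    and bunched: "one_bunched A"
    and separated: "strong_separation (affine_ifs A t)"
  shows "dim_H_measure (self_affine_measure (affine_ifs A t) p) = ereal (lyapunov_dim A p)
    \<and> lyapunov_dim A p = bernoulli_entropy p / lyapunov_s A p
    \<and> bernoulli_entropy p / lyapunov_s A p \<le> 1"
proof -
  obtain V W e \<kappa> \<rho> where "projective_ifs A V W e \<kappa> \<rho>"
    using backward_non_overlapping_imp_projective_ifs[OF nonsingular non_overlapping] by blast
  then interpret projective_ifs A V W e \<kappa> \<rho> .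
  interpret aff: contracting_affine_ifs A t
    by unfold_locales (rule contracting)
  obtain c R where cR: "0 < c" "0 \<le> R"
    "\<And>\<eta> \<eta>'. \<eta> 0 \<noteq> \<eta>' 0 \<Longrightarrow> c \<le> norm (aff.cod \<eta> - aff.cod \<eta>')"
    "\<And>\<eta> \<eta>'. norm (aff.cod \<eta> - aff.cod \<eta>') \<le> R"
    using aff.strong_separation_cod[OF separated] by blast
  \<comment> \<open>Multiply the bunching inequality by \<open>alpha1\<close> and use that the
    product of the singular values is |det|.\<close>
  have cube: "onorm ((*v) (A i)) ^ 3 \<le> \<bar>det (A i)\<bar>" for i
  proof -
    have "alpha1 (A i) ^ 2 * alpha1 (A i) \<le> alpha2 (A i) * alpha1 (A i)"
      using bunched onorm_pos_if_invertible[OF nonsingular, of i]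
      by (intro mult_right_mono) (auto simp: one_bunched_def alpha1_eq_onorm)
    also have "\<dots> = \<bar>det (A i)\<bar>"
      using alpha1_mult_alpha2[of "A i"] by (simp add: mult.commute)
    finally show ?thesis
      by (simp add: alpha1_eq_onorm power3_eq_cube power2_eq_square)
  qed
  interpret coded_bernoulli_ifs A V W e \<kappa> \<rho> p aff.cod c R
    by unfold_locales (use contracting cube cR aff.cod_prepend in auto)
  have "self_affine_measure (affine_ifs A t) p = \<mu>"
    by (simp add: self_affine_measure_def \<mu>_def)
  then show ?thesis
    using dim_H_measure_\<mu> lyapunov_dim_eq h_over_\<gamma>_le_1 by (simp add: lyapunov_s_eq h_def)
qed

end
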